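(* The operator $S$ is bounded from $L^{\infty}_c(\mathbb{R})$ to $BMO_d(\mathbb{R})$; that is, there is a constant $C>0$ such that $$\|Sf\|_{BMO_d}\leq C\|f\|_{\infty}\quad\text{for all } f\in L^{\infty}_c(\mathbb{R}).$$ Consequently, for every $2<p<\infty$, $S$ is bounded on $L^p(\mathbb{R})$, i.e. there is a constant $C_p>0$ such that $\|Sf\|_{p}\leq C_p\|f\|_{p}$ for all $f\in L^p(\mathbb{R})$; hence the operators $S_{\mathcal{I}}$ are bounded on $L^p(\mathbb{R})$ uniformly with respect to $\mathcal{I}$, i.e. for every $2<p<\infty$ there is a constant $C_p>0$ independent of $\mathcal{I}$ such that $\|S_{\mathcal{I}}f\|_{p}\leq C_p\|f\|_{p}$ for all $f\in L^p(\mathbb{R})$ and all families $\mathcal{I}$.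
   Context: For $k\in\mathbb{Z}$, $\sigma_k$ denotes the $k$-th dyadic $\sigma$-algebra on $\mathbb{R}$, generated by the dyadic intervals $[j2^k,(j+1)2^k)$, $j\in\mathbb{Z}$, of side-length $2^k$. $\mathcal{E}_k$ is the conditional expectation with respect to $\sigma_k$, i.e. $\mathcal{E}_kf(x)$ is the average of $f$ over the dyadic interval of length $2^k$ containing $x$. For an interval $I$ of length $|I|$ write $M_{I}f=|I|^{-1}\int_{I}f(y)\,dy$. A family $\mathcal{I}=\{I_k(x)\}_{k\in\mathbb{Z},\,x\in\mathbb{R}}$ is an arbitrary choice, for every $k\in\mathbb{Z}$ and $x\in\mathbb{R}$, of an interval $I_k(x)$ of length $2^k$ containing $x$. For such a family, $$S_{\mathcal{I}}f(x)=\Big(\sum_{k\in\mathbb{Z}}|M_{I_k(x)}f-\mathcal{E}_kf(x)|^2\Big)^{1/2}\in[0,\infty].$$ Let $\mathcal{I}_k$ be the set of all intervals of length $2^k$ containing the origin, and for $I\in\mathcal{I}_k$ let $I+x=\{y+x:y\in I\}$. Define $$Sf(x)=\Big(\sum_{k\in\mathbb{Z}}\sup_{I\in\mathcal{I}_k}|M_{I+x}f-\mathcal{E}_kf(x)|^2\Big)^{1/2}\in[0,\infty].$$ These formulas are used for any locally integrable $f$ on $\mathbb{R}$. $L^\infty_c(\mathbb{R})$ is the space of compactly supported functions in $L^\infty(\mathbb{R})$. $BMO_d(\mathbb{R})$ is the dyadic BMO space: the locally integrable functions $g$ on $\mathbb{R}$ with $$\|g\|_{BMO_d}=\sup_{I\text{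 dyadic}}\frac{1}{|I|}\int_I|g-g_I|<\infty,\qquad g_I=\frac{1}{|I|}\int_I g,$$ the supremum being over all dyadic intervals $I\subset\mathbb{R}$ (of any length $2^k$, $k\in\mathbb{Z}$); an equivalent norm is $\sup_{I\text{ dyadic}}\inf_{a_I}\frac1{|I|}\int_I|g-a_I|$. *)

theory Defs
  imports "HOL-Analysis.Analysis" "HOL-Probability.Essential_Supremum"
begin

text \<open>
  Measurability and integrals refer to \<open>lebesgue\<close>. Functions \<open>f\<close> on the line are complex valued in
  the theorem; the averages are polymorphic because the dyadic BMO norm uses them for real valued
  functions.
\<close>

subsection \<open>Intervals, averages and dyadic conditional expectations\<close>

text \<open>Intervals may be open, closed or half-open; for \<open>r > 0\<close> the measure condition forces
  boundedness, since \<open>measure\<close> is \<open>0\<close> on sets of infinite measure.\<close>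

definition intervals_of_length :: "real \<Rightarrow> real set set" where
  "intervals_of_length r = {I. is_interval I \<and> measure lebesgue I = r}"

definition avg :: "real set \<Rightarrow> (real \<Rightarrow> 'a::{banach, second_countable_topology}) \<Rightarrow> 'a" where
  "avg I f = set_lebesgue_integral lebesgue I f /\<^sub>R measure lebesgue I"

definition dyadic_interval :: "int \<Rightarrow> int \<Rightarrow> real set" where
  "dyadic_interval k j = {of_int j * 2 powi k ..< (of_int j + 1) * 2 powi k}"

definition dyadic_containing :: "int \<Rightarrow> real \<Rightarrow> real set" where
  "dyadic_containing k x = dyadic_interval k \<lfloor>x / 2 powi k\<rfloor>"

lemma mem_dyadic_interval_iff: "x \<in> dyadic_interval k j \<longleftrightarrow> j = \<lfloor>x / 2 powi k\<rfloor>"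
proof -
  have pos: "(0::real) < 2 powi k" by simp
  have "x \<in> dyadic_interval k j \<longleftrightarrow> of_int j \<le> x / 2 powi k \<and> x / 2 powi k < of_int j + 1"
    unfolding dyadic_interval_def by (simp add: pos_le_divide_eq[OF pos] pos_divide_less_eq[OF pos])
  also have "\<dots> \<longleftrightarrow> j = \<lfloor>x / 2 powi k\<rfloor>"
    by linarith
  finally show ?thesis .
qed

lemma dyadic_containing_unique:
  "J \<in> range (dyadic_interval k) \<and> x \<in> J \<longleftrightarrow> J = dyadic_containing k x"
  by (auto simp: dyadic_containing_def mem_dyadic_interval_iff)

definition dyadic_expectation ::
    "int \<Rightarrow> (real \<Rightarrow> 'a::{banach, second_countable_topology}) \<Rightarrow> real \<Rightarrow> 'a" where
  "dyadic_expectation k f x = avg (dyadic_containing k x) f"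

subsection \<open>The square functions\<close>

text \<open>Real powers on \<open>[0, \<infinity>]\<close>, meant for exponents \<open>a > 0\<close>.\<close>

definition ennreal_powr :: "ennreal \<Rightarrow> real \<Rightarrow> ennreal" where
  "ennreal_powr t a = (if t = top then top else ennreal (enn2real t powr a))"

definition admissible_family :: "(int \<Rightarrow> real \<Rightarrow> real set) \<Rightarrow> bool" where
  "admissible_family \<I> \<longleftrightarrow> (\<forall>k x. \<I> k x \<in> intervals_of_length (2 powi k) \<and> x \<in> \<I> k x)"

definition sq_fun_family ::
    "(int \<Rightarrow> real \<Rightarrow> real set) \<Rightarrow> (real \<Rightarrow> complex) \<Rightarrow> real \<Rightarrow> ennreal" where
  "sq_fun_family \<I> f x =
     ennreal_powr
       (\<Sum>\<^sub>\<infinity>k\<in>(UNIV::int set). ennreal ((norm (avg (\<I> k x) f - dyadic_expectation k f x))\<^sup>2))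
       (1/2)"

definition intervals_at_origin :: "int \<Rightarrow> real set set" where
  "intervals_at_origin k = {I \<in> intervals_of_length (2 powi k). 0 \<in> I}"

definition sq_fun :: "(real \<Rightarrow> complex) \<Rightarrow> real \<Rightarrow> ennreal" where
  "sq_fun f x =
     ennreal_powr
       (\<Sum>\<^sub>\<infinity>k\<in>(UNIV::int set). SUP I\<in>intervals_at_origin k.
          ennreal ((norm (avg ((\<lambda>y. y + x) ` I) f - dyadic_expectation k f x))\<^sup>2))
       (1/2)"

subsection \<open>Function spaces\<close>

definition Lp_norm :: "real \<Rightarrow> (real \<Rightarrow> ennreal) \<Rightarrow> ennreal" where
  "Lp_norm p h = ennreal_powr (\<integral>\<^sup>+x. ennreal_powr (h x) p \<partial>lebesgue) (1/p)"

definition in_Lp :: "real \<Rightarrow> (real \<Rightarrow> complex) \<Rightarrow> bool" where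
  "in_Lp p f \<longleftrightarrow> f \<in> borel_measurable lebesgue \<and> Lp_norm p (\<lambda>x. ennreal (norm (f x))) < top"

text \<open>
  For an arbitrary family of intervals the square function need not be measurable, and
  \<open>nn_integral\<close> of a non-measurable function is a lower integral. The upper integral used here is
  the stronger reading; it agrees with the usual norm for measurable functions.
\<close>

definition outer_Lp_norm :: "real \<Rightarrow> (real \<Rightarrow> ennreal) \<Rightarrow> ennreal" where
  "outer_Lp_norm p h =
     (INF g\<in>{g \<in> borel_measurable lebesgue. \<forall>x. h x \<le> g x}. Lp_norm p g)"

lemma ennreal_powr_mono:
  assumes "s \<le> t" "0 \<le> a" shows "ennreal_powr s a \<le> ennreal_powr t a"
proof (cases "t = top")
  case False
  then have "s \<noteq> top" using assms(1) by (auto simp: top_unique)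
  moreover have "enn2real s \<le> enn2real t"
    using assms(1) False by (simp add: enn2real_mono top.not_eq_extremum)
  ultimately show ?thesis
    using False assms(2) by (auto simp: ennreal_powr_def intro!: ennreal_leI powr_mono2)
qed (simp add: ennreal_powr_def)

lemma outer_Lp_norm_measurable:
  assumes "h \<in> borel_measurable lebesgue" "0 < p"
  shows "outer_Lp_norm p h = Lp_norm p h"
proof (rule antisym)
  show "outer_Lp_norm p h \<le> Lp_norm p h"
    unfolding outer_Lp_norm_def using assms(1) by (intro INF_lower) auto
  show "Lp_norm p h \<le> outer_Lp_norm p h"
    unfolding outer_Lp_norm_def Lp_norm_def using assms(2)
    by (auto intro!: INF_greatest ennreal_powr_mono nn_integral_mono)
qed

definition Linf_norm :: "(real \<Rightarrow> complex) \<Rightarrow> ennreal" where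
  "Linf_norm f = esssup lebesgue (\<lambda>x. ennreal (norm (f x)))"

text \<open>The support is understood modulo null sets.\<close>

definition in_Linf_c :: "(real \<Rightarrow> complex) \<Rightarrow> bool" where
  "in_Linf_c f \<longleftrightarrow> f \<in> borel_measurable lebesgue \<and> Linf_norm f < top \<and>
     (\<exists>K. compact K \<and> (AE x in lebesgue. x \<notin> K \<longrightarrow> f x = 0))"

definition locally_integrable :: "(real \<Rightarrow> real) \<Rightarrow> bool" where
  "locally_integrable g \<longleftrightarrow> (\<forall>K. compact K \<longrightarrow> g absolutely_integrable_on K)"

definition BMO_d_norm :: "(real \<Rightarrow> real) \<Rightarrow> ennreal" where
  "BMO_d_norm g =
     (SUP I\<in>(\<Union>k. range (dyadic_interval k)).
        (\<integral>\<^sup>+x\<in>I. ennreal \<bar>g x - avg I g\<bar> \<partial>lebesgue) / emeasure lebesgue I)"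

definition in_BMO_d :: "(real \<Rightarrow> real) \<Rightarrow> bool" where
  "in_BMO_d g \<longleftrightarrow> locally_integrable g \<and> BMO_d_norm g < top"

end

theory Submission
  imports Defs
begin

text \<open>
  Write \<open>M\<close> for the average over a sliding interval of length \<open>2 powi
  k\<close> through \<open>x\<close> and \<open>E\<close> for the average over the dyadic one,
  and let \<open>Q\<close> be the dyadic interval. A sliding interval crosses at most one dyadic
  point of its scale. If \<open>f\<close> were constant on the dyadic intervals that it meets,
  \<open>M - E\<close> would be a fraction of the jump between the two means; in general there
  are two further errors, caused by the two end pieces, and these are bounded by the largest
  deviation of the primitive of \<open>f\<close> from its linear interpolation on a dyadic
  interval. A multiple of the sum of the squares of these quantities (\<open>majorant\<close>)
  dominates the supremum over all sliding intervals (\<open>slide_le_majorant\<close>) and is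
  constant on \<open>Q\<close>.

  The majorant is bounded in \<open>L\<^sup>2\<close> because both quantities satisfy
  contractive recursions: the squared deviations, summed over a scale, are at most
  \<open>3/4\<close> of those of the next finer scale plus martingale differences
  (\<open>osc_sum_finer\<close>), and the squared jumps are at most \<open>3/4\<close> of those
  of the next coarser scale plus martingale differences (\<open>jump_sum_coarser\<close>). The
  martingale differences are square summable by orthogonality, and the recursions can be summed
  over any finite range of scales (\<open>majorant_L2\<close>). Since the majorant is local, for
  every dyadic interval the scales up to its own contribute at most a multiple of the energy of
  \<open>f\<close> on the tripled interval (\<open>majorant_local\<close>).

  This local estimate has two consequences. For bounded \<open>f\<close> it controls the fine
  scales on \<open>Q\<close> in quadratic mean, while the coarse scales are almost constant on
  \<open>Q\<close>, as an average over an interval of length \<open>2 powi k\<close> moves by at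
  most a multiple of \<open>t / 2 powi k\<close> under a translation by \<open>t\<close>
  (\<open>wobble_diff\<close>). Hence the square function has bounded mean oscillation
  (\<open>sq_fun_oscillation\<close>).

  For \<open>p > 2\<close> put \<open>q = p / 2\<close>. The sum of the majorants over scales is
  an increasing adapted process whose present and future increments are controlled, in
  conditional mean, by a maximal function of \<open>\<bar>f\<bar>\<^sup>2\<close>. Garsia's
  inequality, which is summation by parts (\<open>Garsia\<close>), bounds its
  \<open>q\<close>-th moment by that of the maximal function, and the maximal function is
  bounded in \<open>Lq\<close> as \<open>q > 1\<close> (\<open>dyadic_max_strong_type\<close>).
  This replaces interpolation between \<open>L\<^sup>2\<close> and \<open>BMO\<close>. All
  moments are first taken over finitely many scales, where they are finite, and the bounds do
  not depend on the range; monotone convergence yields the square function itself. A choice of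
  intervals only picks terms below the suprema, so its square function is dominated pointwise.
\<close>

section \<open>Segment integrals and their Cauchy-Schwarz bounds\<close>

definition L1_loc :: "(real \<Rightarrow> complex) \<Rightarrow> bool" where
  "L1_loc f \<longleftrightarrow> (\<forall>a b. set_integrable lebesgue {a..<b} f)"

definition seg_integral :: "(real \<Rightarrow> complex) \<Rightarrow> real \<Rightarrow> real \<Rightarrow> complex" where
  "seg_integral f a b = set_lebesgue_integral lebesgue {a..<b} f"

text \<open>
  The values lie in \<open>[0, \<infinity>]\<close>, so that statements about energies also
  cover functions that are not square integrable.
\<close>

definition energy :: "(real \<Rightarrow> complex) \<Rightarrow> real set \<Rightarrow> ennreal" where
  "energy f A = (\<integral>\<^sup>+x\<in>A. ennreal ((norm (f x))\<^sup>2) \<partial>lebesgue)"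

lemma sq_sum_le2: "((a::real) + b)\<^sup>2 \<le> 2 * a\<^sup>2 + 2 * b\<^sup>2"
  using sum_squares_bound[of a b] by (simp add: power2_sum)

text \<open>
  The weight \<open>3/2\<close> is what makes the recursions between scales contract: passing to
  a neighbouring scale gains a factor \<open>1/2\<close>, and \<open>3/2 \<cdot> 1/2 = 3/4 <
  1\<close>.
\<close>

lemma sq_sum_le32: "((a::real) + b)\<^sup>2 \<le> 3/2 * a\<^sup>2 + 3 * b\<^sup>2"
  using zero_le_power2[of "a - 2 * b"] by (simp add: power2_sum power2_diff)

lemma dyadic_lebesgue [measurable]: "dyadic_interval k j \<in> sets lebesgue"
  by (simp add: dyadic_interval_def)

lemma measure_dyadic: "measure lebesgue (dyadic_interval k j) = 2 powi k"
  by (simp add: dyadic_interval_def algebra_simps)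

lemma emeasure_dyadic: "emeasure lebesgue (dyadic_interval k j) = ennreal (2 powi k)"
  by (simp add: dyadic_interval_def algebra_simps)

lemma mean_eq: "avg (dyadic_interval k j) f = seg_integral f (of_int j * 2 powi k) ((of_int j + 1) * 2 powi k) /\<^sub>R 2 powi k"
  by (simp add: avg_def seg_integral_def measure_dyadic) (simp add: dyadic_interval_def)

lemma powi_pred: "(2::real) powi (k - 1) = 2 powi k / 2"
  by (simp add: power_int_diff)

lemma seg_integral_split:
  assumes "L1_loc f" "a \<le> b" "b \<le> c" shows "seg_integral f a c = seg_integral f a b + seg_integral f b c"
proof -
  have "{a..<c} = {a..<b} \<union> {b..<c}" using assms by auto
  then show ?thesis using assms unfolding seg_integral_def L1_loc_def
    by (metis set_integral_Un ivl_disj_int(3) ivl_disj_int_two(3))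
qed

lemma norm_seg_integral_le:
  assumes "L1_loc f" "a \<le> c" "d \<le> b"
  shows "norm (seg_integral f c d) \<le> (LINT x:{a..<b}|lebesgue. norm (f x))"
proof -
  have i: "set_integrable lebesgue {a..<b} f" "set_integrable lebesgue {c..<d} f" using assms(1) by (auto simp: L1_loc_def)
  have "norm (seg_integral f c d) \<le> (LINT x:{c..<d}|lebesgue. norm (f x))"
    unfolding seg_integral_def by (rule set_integral_norm_bound[OF i(2)])
  also have "\<dots> \<le> (LINT x:{a..<b}|lebesgue. norm (f x))"
    unfolding set_lebesgue_integral_def
    using i[THEN set_integrable_norm] assms(2,3)
    by (intro integral_mono) (auto simp: set_integrable_def indicator_def)
  finally show ?thesis .
qed

lemma nn_Cauchy_Schwarz_set:
  assumes [measurable]: "f \<in> borel_measurable lebesgue" "A \<in> sets lebesgue"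
  shows "(\<integral>\<^sup>+x\<in>A. ennreal (norm (f x)) \<partial>lebesgue)\<^sup>2 \<le> emeasure lebesgue A * (\<integral>\<^sup>+x\<in>A. ennreal ((norm (f x))\<^sup>2) \<partial>lebesgue)"
proof -
  have "(\<integral>\<^sup>+x. indicator A x * (indicator A x * ennreal (norm (f x))) \<partial>lebesgue)\<^sup>2
     \<le> (\<integral>\<^sup>+x. (indicator A x)^2 \<partial>lebesgue) * (\<integral>\<^sup>+x. (indicator A x * ennreal (norm (f x)))\<^sup>2 \<partial>lebesgue)"
    by (rule Cauchy_Schwarz_nn_integral) auto
  also have "(\<integral>\<^sup>+x. (indicator A x)^2 \<partial>lebesgue) = (\<integral>\<^sup>+x. (indicator A x) \<partial>lebesgue)"
    by (intro nn_integral_cong) (auto simp: indicator_def)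
  also have "\<dots> = emeasure lebesgue A" using assms by simp
  also have "(\<integral>\<^sup>+x. (indicator A x * ennreal (norm (f x)))\<^sup>2 \<partial>lebesgue) = (\<integral>\<^sup>+x\<in>A. ennreal ((norm (f x))\<^sup>2) \<partial>lebesgue)"
    by (intro nn_integral_cong) (auto simp: indicator_def ennreal_power)
  also have "(\<integral>\<^sup>+x. indicator A x * (indicator A x * ennreal (norm (f x))) \<partial>lebesgue) = (\<integral>\<^sup>+x\<in>A. ennreal (norm (f x)) \<partial>lebesgue)"
    by (intro nn_integral_cong) (auto simp: indicator_def)
  finally show ?thesis .
qed

lemma seg_integral_Cauchy_Schwarz:
  assumes [measurable]: "f \<in> borel_measurable lebesgue" and "a \<le> b"
  shows "ennreal ((norm (seg_integral f a b))\<^sup>2) \<le> ennreal (b - a) * energy f {a..<b}"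
proof -
  have "ennreal (norm (seg_integral f a b)) \<le> (\<integral>\<^sup>+x\<in>{a..<b}. ennreal (norm (f x)) \<partial>lebesgue)"
  proof (cases "set_integrable lebesgue {a..<b} f")
    case True
    then have "ennreal (norm (seg_integral f a b)) \<le> (\<integral>\<^sup>+x. ennreal (norm (indicator {a..<b} x *\<^sub>R f x)) \<partial>lebesgue)"
      unfolding seg_integral_def set_lebesgue_integral_def set_integrable_def by (rule integral_norm_bound_ennreal)
    also have "\<dots> = (\<integral>\<^sup>+x\<in>{a..<b}. ennreal (norm (f x)) \<partial>lebesgue)"
      by (intro nn_integral_cong) (auto simp: indicator_def)
    finally show ?thesis .
  next
    case False
    then show ?thesis unfolding seg_integral_def set_lebesgue_integral_def set_integrable_def
      by (simp add: not_integrable_integral_eq)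
  qed
  then have "(ennreal (norm (seg_integral f a b)))\<^sup>2 \<le> (\<integral>\<^sup>+x\<in>{a..<b}. ennreal (norm (f x)) \<partial>lebesgue)\<^sup>2"
    by (intro power_mono) auto
  also have "\<dots> \<le> emeasure lebesgue {a..<b} * (\<integral>\<^sup>+x\<in>{a..<b}. ennreal ((norm (f x))\<^sup>2) \<partial>lebesgue)"
    by (rule nn_Cauchy_Schwarz_set) auto
  finally show ?thesis using assms(2) by (simp add: energy_def ennreal_power)
qed

lemma energy_mono: "A \<subseteq> B \<Longrightarrow> energy f A \<le> energy f B"
  unfolding energy_def by (intro nn_integral_mono) (auto simp: indicator_def)

lemma mean_energy:
  assumes [measurable]: "f \<in> borel_measurable lebesgue"
  shows "ennreal (2 powi k * (norm (avg (dyadic_interval k j) f))\<^sup>2) \<le> energy f (dyadic_interval k j)"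
proof -
  have "ennreal (2 powi k * (norm (avg (dyadic_interval k j) f))\<^sup>2) =
     ennreal (1/2 powi k) * ennreal ((norm (seg_integral f (of_int j * 2 powi k) ((of_int j + 1) * 2 powi k)))\<^sup>2)"
    by (simp add: mean_eq ennreal_mult'[symmetric] power_divide power2_eq_square divide_simps)
  also have "\<dots> \<le> ennreal (1/2 powi k) * (ennreal (2 powi k) * energy f (dyadic_interval k j))"
    using seg_integral_Cauchy_Schwarz[OF assms, of "of_int j * 2 powi k" "(of_int j + 1) * 2 powi k"]
    by (intro mult_left_mono) (auto simp: dyadic_interval_def algebra_simps)
  also have "\<dots> = energy f (dyadic_interval k j)"
    by (simp add: mult.assoc[symmetric] ennreal_mult'[symmetric])
  finally show ?thesis .
qed

section \<open>Primitives on a dyadic interval\<close>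

text \<open>
  The error made when the primitive of \<open>f\<close> is replaced by the linear function with
  the same values at the two ends of the dyadic interval; it vanishes at both ends.
\<close>

definition drift :: "(real \<Rightarrow> complex) \<Rightarrow> int \<Rightarrow> int \<Rightarrow> real \<Rightarrow> complex" where
  "drift f k j t = seg_integral f (of_int j * 2 powi k) t - (t - of_int j * 2 powi k) *\<^sub>R avg (dyadic_interval k j) f"

definition osc :: "(real \<Rightarrow> complex) \<Rightarrow> int \<Rightarrow> int \<Rightarrow> real" where
  "osc f k j = (SUP t\<in>{of_int j * 2 powi k..(of_int j + 1) * 2 powi k}. norm (drift f k j t))"

lemma norm_drift_le_osc:
  assumes "L1_loc f" "t \<in> {of_int j * 2 powi k..(of_int j + 1) * 2 powi k}"
  shows "norm (drift f k j t) \<le> osc f k j"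
  unfolding osc_def
proof (rule cSUP_upper[OF assms(2)])
  let ?a = "of_int j * 2 powi k :: real" let ?b = "(of_int j + 1) * 2 powi k :: real"
  show "bdd_above ((\<lambda>t. norm (drift f k j t)) ` {?a..?b})"
  proof (rule bdd_aboveI2)
    fix t assume t: "t \<in> {?a..?b}"
    have "norm (drift f k j t) \<le> norm (seg_integral f ?a t) + norm ((t - ?a) *\<^sub>R avg (dyadic_interval k j) f)"
      unfolding drift_def by (rule norm_triangle_ineq4)
    also have "\<dots> \<le> (LINT x:{?a..<?b}|lebesgue. norm (f x)) + (?b - ?a) * norm (avg (dyadic_interval k j) f)"
      using t by (intro add_mono norm_seg_integral_le[OF assms(1)]) (auto intro!: mult_right_mono)
    finally show "norm (drift f k j t) \<le> (LINT x:{?a..<?b}|lebesgue. norm (f x)) + (?b - ?a) * norm (avg (dyadic_interval k j) f)" .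
  qed
qed

lemma osc_le:
  assumes "\<And>t. t \<in> {of_int j * 2 powi k..(of_int j + 1) * 2 powi k} \<Longrightarrow> norm (drift f k j t) \<le> c"
  shows "osc f k j \<le> c"
  unfolding osc_def by (rule cSUP_least) (auto intro!: assms)

lemma osc_nonneg: assumes "L1_loc f" shows "0 \<le> osc f k j"
  using norm_drift_le_osc[OF assms, of "of_int j * 2 powi k" j k] norm_ge_zero
  by (smt (verit) atLeastAtMost_iff mult_right_mono zero_less_power_int)

text \<open>
  The drift is a difference of an integral over a part of the interval and a fraction of the
  integral over all of it; Cauchy-Schwarz bounds both.
\<close>

lemma osc_energy:
  assumes [measurable]: "f \<in> borel_measurable lebesgue" and l: "L1_loc f"
  shows "ennreal ((osc f k j)\<^sup>2) \<le> ennreal (4 * 2 powi k) * energy f (dyadic_interval k j)"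
proof (cases "energy f (dyadic_interval k j) = top")
  case True
  then show ?thesis by (simp add: ennreal_mult_top)
next
  case False
  let ?a = "of_int j * 2 powi k :: real" let ?b = "(of_int j + 1) * 2 powi k :: real"
  let ?d = "2 powi k :: real"
  define E where "E = enn2real (energy f (dyadic_interval k j))"
  have E: "energy f (dyadic_interval k j) = ennreal E" "0 \<le> E"
    using False by (auto simp: E_def ennreal_enn2real_if)
  have m: "?d * (norm (avg (dyadic_interval k j) f))\<^sup>2 \<le> E"
    using mean_energy[OF assms(1), of k j] E by simp
  have "osc f k j \<le> sqrt (4 * ?d * E)"
  proof (rule osc_le)
    fix t assume t: "t \<in> {?a..?b}"
    have "ennreal ((norm (seg_integral f ?a t))\<^sup>2) \<le> ennreal (t - ?a) * energy f {?a..<t}"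
      using t by (intro seg_integral_Cauchy_Schwarz) auto
    also have "\<dots> \<le> ennreal ?d * energy f (dyadic_interval k j)"
      using t by (intro mult_mono energy_mono ennreal_leI) (auto simp: dyadic_interval_def algebra_simps)
    finally have 1: "(norm (seg_integral f ?a t))\<^sup>2 \<le> ?d * E"
      using E by (simp add: ennreal_mult'[symmetric])
    have "(t - ?a)\<^sup>2 * (norm (avg (dyadic_interval k j) f))\<^sup>2 \<le> ?d\<^sup>2 * (norm (avg (dyadic_interval k j) f))\<^sup>2"
      using t by (intro mult_right_mono power_mono) (auto simp: algebra_simps)
    also have "\<dots> \<le> ?d * E" using m by (simp add: power2_eq_square mult.assoc)
    finally have 2: "(norm ((t - ?a) *\<^sub>R avg (dyadic_interval k j) f))\<^sup>2 \<le> ?d * E" by (simp add: power_mult_distrib)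
    have "(norm (drift f k j t))\<^sup>2 \<le> (norm (seg_integral f ?a t) + norm ((t - ?a) *\<^sub>R avg (dyadic_interval k j) f))\<^sup>2"
      unfolding drift_def by (intro power_mono norm_triangle_ineq4) auto
    also have "\<dots> \<le> 2 * (norm (seg_integral f ?a t))\<^sup>2 + 2 * (norm ((t - ?a) *\<^sub>R avg (dyadic_interval k j) f))\<^sup>2"
      by (rule sq_sum_le2)
    also have "\<dots> \<le> 4 * ?d * E" using 1 2 by simp
    finally show "norm (drift f k j t) \<le> sqrt (4 * ?d * E)" by (rule real_le_rsqrt)
  qed
  then have "(osc f k j)\<^sup>2 \<le> 4 * ?d * E"
    using osc_nonneg[OF l] E(2) by (metis power_mono real_sqrt_pow2 mult_nonneg_nonneg zero_le_power_int zero_le_numeral)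
  then show ?thesis using E by (simp add: ennreal_mult'[symmetric])
qed

section \<open>Consecutive scales\<close>

abbreviation mean :: "(real \<Rightarrow> complex) \<Rightarrow> int \<Rightarrow> int \<Rightarrow> complex" where
  "mean f k j \<equiv> avg (dyadic_interval k j) f"

text \<open>
  Sums over all dyadic intervals of one scale, written as integrals for the counting measure so
  that monotone convergence and Tonelli apply to them.
\<close>

abbreviation zsum :: "(int \<Rightarrow> ennreal) \<Rightarrow> ennreal" where
  "zsum F \<equiv> (\<integral>\<^sup>+j. F j \<partial>count_space UNIV)"

lemma zsum_shift: "zsum (\<lambda>j. F (j + c)) = zsum F"
  by (rule nn_integral_bij_count_space) (auto intro!: bij_betwI[where g="\<lambda>j. j - c"])

text \<open>
  Summing over all intervals of scale \<open>k - 1\<close> is summing over the left and the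
  right halves of all intervals of scale \<open>k\<close>.
\<close>

lemma zsum_parity: "zsum F = zsum (\<lambda>i. F (2 * i)) + zsum (\<lambda>i. F (2 * i + 1))"
proof -
  have 1: "zsum (\<lambda>j. F j * indicator {j. even j} j) = zsum (\<lambda>i. F (2 * i))"
    unfolding nn_integral_count_space_indicator[symmetric, of "{j. even j}" F, simplified]
    by (rule nn_integral_bij_count_space[symmetric])
       (auto intro!: bij_betwI[where g="\<lambda>j. j div 2"])
  have 2: "zsum (\<lambda>j. F j * indicator {j. odd j} j) = zsum (\<lambda>i. F (2 * i + 1))"
    unfolding nn_integral_count_space_indicator[symmetric, of "{j. odd j}" F, simplified]
    by (rule nn_integral_bij_count_space[symmetric])
       (auto intro!: bij_betwI[where g="\<lambda>j. j div 2"])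
  have "zsum F = zsum (\<lambda>j. F j * indicator {j. even j} j + F j * indicator {j. odd j} j)"
    by (intro nn_integral_cong) (auto simp: indicator_def)
  also have "\<dots> = zsum (\<lambda>j. F j * indicator {j. even j} j) + zsum (\<lambda>j. F j * indicator {j. odd j} j)"
    by (rule nn_integral_add) auto
  finally show ?thesis unfolding 1 2 .
qed

lemma mean_children:
  assumes "L1_loc f"
  shows "mean f k j = (mean f (k-1) (2*j) + mean f (k-1) (2*j+1)) /\<^sub>R 2"
proof -
  let ?d = "2 powi k :: real"
  have "seg_integral f (of_int j * ?d) ((of_int j + 1) * ?d) =
     seg_integral f (of_int j * ?d) ((of_int j + 1/2) * ?d) + seg_integral f ((of_int j + 1/2) * ?d) ((of_int j + 1) * ?d)"
    by (rule seg_integral_split[OF assms]) (auto intro!: mult_right_mono)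
  then show ?thesis
    by (simp add: mean_eq powi_pred algebra_simps add_divide_distrib inverse_eq_divide)
qed

text \<open>
  The common distance of the means over the two halves to the mean over the whole interval, i.e.
  the absolute value of the martingale difference of level \<open>k\<close>.
\<close>

definition gap :: "(real \<Rightarrow> complex) \<Rightarrow> int \<Rightarrow> int \<Rightarrow> real" where
  "gap f k j = norm (mean f (k-1) (2*j) - mean f (k-1) (2*j+1)) / 2"

text \<open>
  On each half, the linear interpolation belonging to the half and the one belonging to the
  whole interval differ by a linear function whose slope is, up to sign, the martingale
  difference. That function vanishes at the outer end of the half and is at most \<open>2 powi k
  / 2\<close> times the gap.
\<close>

lemma osc_children:
  assumes l: "L1_loc f"
  shows "osc f k j \<le> max (osc f (k-1) (2*j)) (osc f (k-1) (2*j+1)) + 2 powi k / 2 * gap f k j"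
proof (rule osc_le)
  let ?d = "2 powi k :: real"
  let ?a = "of_int j * ?d" and ?b = "(of_int j + 1) * ?d"
  define p where "p = mean f (k-1) (2*j)" define q where "q = mean f (k-1) (2*j+1)"
  define c where "c = ?a + ?d / 2"
  have m: "mean f k j = (p + q) /\<^sub>R 2" unfolding p_def q_def by (rule mean_children[OF l])
  have ca: "of_int (2*j) * 2 powi (k-1) = ?a" "(of_int (2*j) + 1) * 2 powi (k-1) = c"
    "of_int (2*j+1) * 2 powi (k-1) = c" "(of_int (2*j+1) + 1) * 2 powi (k-1) = ?b"
    by (simp_all add: powi_pred c_def algebra_simps)
  have g: "gap f k j = norm (p - q) / 2" by (simp add: gap_def p_def q_def)
  have d: "?d > 0" by simp
  fix t assume t: "t \<in> {?a..?b}"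
  show "norm (drift f k j t) \<le> max (osc f (k-1) (2*j)) (osc f (k-1) (2*j+1)) + ?d / 2 * gap f k j"
  proof (cases "t \<le> c")
    case True
    have "drift f k j t = drift f (k-1) (2*j) t + ((t - ?a)/2) *\<^sub>R (p - q)"
      unfolding drift_def ca m p_def[symmetric] by (simp add: field_simps scaleR_conv_of_real)
    then have "norm (drift f k j t) \<le> norm (drift f (k-1) (2*j) t) + norm (((t - ?a)/2) *\<^sub>R (p - q))"
      by (metis norm_triangle_ineq)
    also have "norm (drift f (k-1) (2*j) t) \<le> osc f (k-1) (2*j)"
      by (rule norm_drift_le_osc[OF l], unfold ca) (use t True in auto)
    also have "norm (((t - ?a)/2) *\<^sub>R (p - q)) \<le> ?d / 2 * gap f k j"
    proof -
      have "norm (((t - ?a)/2) *\<^sub>R (p - q)) = (t - ?a) * gap f k j" using t by (simp add: g)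
      also have "\<dots> \<le> ?d / 2 * gap f k j"
        using True by (intro mult_right_mono) (auto simp: c_def g)
      finally show ?thesis .
    qed
    finally show ?thesis by linarith
  next
    case False
    have s: "seg_integral f ?a t = seg_integral f ?a c + seg_integral f c t"
      by (rule seg_integral_split[OF l]) (use False d in \<open>auto simp: c_def\<close>)
    have pc: "seg_integral f ?a c = (?d/2) *\<^sub>R p"
      unfolding p_def mean_eq ca by (simp add: powi_pred)
    have "drift f k j t = drift f (k-1) (2*j+1) t + ((?d/2 - (t - c))/2) *\<^sub>R (p - q)"
      unfolding drift_def ca m q_def[symmetric] s pc
      by (simp add: field_simps scaleR_conv_of_real c_def)
    then have "norm (drift f k j t) \<le> norm (drift f (k-1) (2*j+1) t) + norm (((?d/2 - (t - c))/2) *\<^sub>R (p - q))"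
      by (metis norm_triangle_ineq)
    also have "norm (drift f (k-1) (2*j+1) t) \<le> osc f (k-1) (2*j+1)"
      by (rule norm_drift_le_osc[OF l], unfold ca) (use t False in auto)
    also have "norm (((?d/2 - (t - c))/2) *\<^sub>R (p - q)) \<le> ?d / 2 * gap f k j"
    proof -
      have "0 \<le> ?d/2 - (t - c)" using t by (simp add: c_def algebra_simps)
      then have "norm (((?d/2 - (t - c))/2) *\<^sub>R (p - q)) = (?d/2 - (t - c)) * gap f k j" by (simp add: g)
      also have "\<dots> \<le> ?d / 2 * gap f k j"
        using False by (intro mult_right_mono) (auto simp: g)
      finally show ?thesis .
    qed
    finally show ?thesis by linarith
  qed
qed

text \<open>
  The next four sums are square functions of a single scale, integrated over the line: of the
  drift, of the differences of adjacent means, of the martingale differences, and of the means.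
\<close>

definition osc_sum :: "(real \<Rightarrow> complex) \<Rightarrow> int \<Rightarrow> ennreal" where
  "osc_sum f k = zsum (\<lambda>j. ennreal ((osc f k j)\<^sup>2 / 2 powi k))"

definition jump_sum :: "(real \<Rightarrow> complex) \<Rightarrow> int \<Rightarrow> ennreal" where
  "jump_sum f k = zsum (\<lambda>j. ennreal (2 powi k * (norm (mean f k (j+1) - mean f k j))\<^sup>2))"

definition gap_sum :: "(real \<Rightarrow> complex) \<Rightarrow> int \<Rightarrow> ennreal" where
  "gap_sum f k = zsum (\<lambda>j. ennreal (2 powi k * (gap f k j)\<^sup>2))"

definition mean_sum :: "(real \<Rightarrow> complex) \<Rightarrow> int \<Rightarrow> ennreal" where
  "mean_sum f k = zsum (\<lambda>j. ennreal (2 powi k * (norm (mean f k j))\<^sup>2))"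

lemma ennreal_three_quarters: "ennreal (3/4) = 3/4"
  by (metis ennreal_divide_numeral ennreal_numeral zero_le_numeral)

lemma zsum_cmult: "zsum (\<lambda>j. c * F j) = c * zsum F"
  by (rule nn_integral_cmult) auto

lemma zsum_add: "zsum (\<lambda>j. F j + G j) = zsum F + zsum G"
  by (rule nn_integral_add) auto

text \<open>
  An interval of scale \<open>k\<close> is charged for the worse of its two halves, hence at
  most for their sum, and the weight \<open>1 / 2 powi k\<close> is half of that of the halves.
  So the drift sum of scale \<open>k\<close> is a contraction of that of scale \<open>k -
  1\<close>, up to martingale differences.
\<close>

lemma osc_sum_finer:
  assumes l: "L1_loc f"
  shows "osc_sum f k \<le> 3/4 * osc_sum f (k-1) + 3/4 * gap_sum f k"
proof -
  let ?l = "\<lambda>j. (osc f (k-1) (2*j))\<^sup>2 / 2 powi (k-1)" and ?r = "\<lambda>j. (osc f (k-1) (2*j+1))\<^sup>2 / 2 powi (k-1)"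
  have "(osc f k j)\<^sup>2 / 2 powi k \<le> 3/4 * ?l j + 3/4 * ?r j + 3/4 * (2 powi k * (gap f k j)\<^sup>2)" for j
  proof -
    let ?a = "osc f (k-1) (2*j)" and ?b = "osc f (k-1) (2*j+1)"
    have "(osc f k j)\<^sup>2 \<le> (max ?a ?b + 2 powi k / 2 * gap f k j)\<^sup>2"
      by (intro power_mono osc_children osc_nonneg l)
    also have "\<dots> \<le> 3/2 * (max ?a ?b)\<^sup>2 + 3 * (2 powi k / 2 * gap f k j)\<^sup>2"
      by (rule sq_sum_le32)
    also have "(max ?a ?b)\<^sup>2 \<le> ?a\<^sup>2 + ?b\<^sup>2" by (auto simp: max_def)
    finally have *: "(osc f k j)\<^sup>2 \<le> 3/2 * (?a\<^sup>2 + ?b\<^sup>2) + 3 * (2 powi k / 2 * gap f k j)\<^sup>2" by simp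
    have "(osc f k j)\<^sup>2 / 2 powi k \<le> (3/2 * (?a\<^sup>2 + ?b\<^sup>2) + 3 * (2 powi k / 2 * gap f k j)\<^sup>2) / 2 powi k"
      by (rule divide_right_mono[OF *]) simp
    also have "\<dots> = 3/4 * ?l j + 3/4 * ?r j + 3/4 * (2 powi k * (gap f k j)\<^sup>2)"
      by (simp add: powi_pred field_simps power2_eq_square)
    finally show ?thesis .
  qed
  then have "osc_sum f k \<le> zsum (\<lambda>j. ennreal (3/4 * ?l j + 3/4 * ?r j + 3/4 * (2 powi k * (gap f k j)\<^sup>2)))"
    unfolding osc_sum_def by (intro nn_integral_mono ennreal_leI) auto
  also have "\<dots> = zsum (\<lambda>j. ennreal (3/4) * (ennreal (?l j) + ennreal (?r j)) + ennreal (3/4) * ennreal (2 powi k * (gap f k j)\<^sup>2))"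
    by (intro nn_integral_cong)
       (simp add: ennreal_mult'[symmetric] ennreal_plus[symmetric] algebra_simps del: ennreal_plus)
  also have "\<dots> = ennreal (3/4) * (zsum (\<lambda>j. ennreal (?l j)) + zsum (\<lambda>j. ennreal (?r j))) + ennreal (3/4) * gap_sum f k"
    by (simp only: zsum_add zsum_cmult gap_sum_def)
  also have "zsum (\<lambda>j. ennreal (?l j)) + zsum (\<lambda>j. ennreal (?r j)) = osc_sum f (k-1)"
    unfolding osc_sum_def by (rule zsum_parity[symmetric])
  also have "ennreal (3/4) = 3/4"
    by (rule ennreal_three_quarters)
  finally show ?thesis .
qed

text \<open>
  Orthogonality of martingale differences, in the form of the parallelogram law on each pair of
  halves.
\<close>

lemma mean_sum_pred:
  assumes l: "L1_loc f"
  shows "mean_sum f (k-1) = mean_sum f k + gap_sum f k"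
proof -
  have p: "2 powi (k-1) * (norm u)\<^sup>2 + 2 powi (k-1) * (norm v)\<^sup>2 =
     2 powi k * (norm ((u + v) /\<^sub>R 2))\<^sup>2 + 2 powi k * (norm (u - v) / 2)\<^sup>2" for u v :: complex
    by (simp add: powi_pred power2_norm_eq_inner power_mult_distrib power_divide inner_add_left inner_add_right inner_diff_left inner_diff_right inner_commute field_simps)
  have ep: "0 \<le> a \<Longrightarrow> 0 \<le> b \<Longrightarrow> 0 \<le> c \<Longrightarrow> 0 \<le> d \<Longrightarrow> a + b = c + d \<Longrightarrow>
    ennreal a + ennreal b = ennreal c + ennreal d" for a b c d
    by (simp flip: ennreal_plus)
  have "mean_sum f (k-1) = zsum (\<lambda>j. ennreal (2 powi (k-1) * (norm (mean f (k-1) (2*j)))\<^sup>2)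
      + ennreal (2 powi (k-1) * (norm (mean f (k-1) (2*j+1)))\<^sup>2))"
    unfolding mean_sum_def zsum_add by (rule zsum_parity)
  also have "\<dots> = zsum (\<lambda>j. ennreal (2 powi k * (norm (mean f k j))\<^sup>2) + ennreal (2 powi k * (gap f k j)\<^sup>2))"
  proof (intro nn_integral_cong ep)
    fix j
    show "2 powi (k-1) * (norm (mean f (k-1) (2*j)))\<^sup>2 + 2 powi (k-1) * (norm (mean f (k-1) (2*j+1)))\<^sup>2 =
      2 powi k * (norm (mean f k j))\<^sup>2 + 2 powi k * (gap f k j)\<^sup>2"
      unfolding mean_children[OF l, of k] gap_def by (rule p)
  qed auto
  finally show ?thesis unfolding zsum_add mean_sum_def gap_sum_def .
qed

text \<open>
  Two adjacent intervals of scale \<open>k - 1\<close> are either the halves of one interval,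
  and then their means differ by twice the gap, or they touch at an end of scale
  \<open>k\<close>, and then their means differ by the difference of the parents' means up to
  two gaps. Only every second jump is of the latter kind, so the jump sum contracts towards
  finer scales.
\<close>

lemma jump_sum_coarser:
  assumes l: "L1_loc f"
  shows "jump_sum f (k-1) \<le> 3/4 * jump_sum f k + 8 * gap_sum f k"
proof -
  let ?m = "mean f (k-1)" let ?d = "2 powi k :: real"
  have e: "2 powi (k-1) * (norm (?m (2*j+1) - ?m (2*j)))\<^sup>2 = 2 * (?d * (gap f k j)\<^sup>2)" for j
    by (simp add: powi_pred gap_def norm_minus_commute power_divide)
  have o: "2 powi (k-1) * (norm (?m (2*j+1+1) - ?m (2*j+1)))\<^sup>2
     \<le> 3/4 * (?d * (norm (mean f k (j+1) - mean f k j))\<^sup>2) + 3 * (?d * (gap f k (j+1))\<^sup>2) + 3 * (?d * (gap f k j)\<^sup>2)" for j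
  proof -
    have "?m (2*j+1+1) - ?m (2*j+1) = (mean f k (j+1) - mean f k j) +
        ((?m (2*(j+1)) - ?m (2*(j+1)+1)) /\<^sub>R 2 + (?m (2*j) - ?m (2*j+1)) /\<^sub>R 2)"
      unfolding mean_children[OF l, of k] by (simp add: algebra_simps scaleR_conv_of_real)
    then have "norm (?m (2*j+1+1) - ?m (2*j+1)) \<le> norm (mean f k (j+1) - mean f k j) +
        norm ((?m (2*(j+1)) - ?m (2*(j+1)+1)) /\<^sub>R 2 + (?m (2*j) - ?m (2*j+1)) /\<^sub>R 2)"
      by (metis norm_triangle_ineq)
    also have "norm ((?m (2*(j+1)) - ?m (2*(j+1)+1)) /\<^sub>R 2 + (?m (2*j) - ?m (2*j+1)) /\<^sub>R 2)
        \<le> gap f k (j+1) + gap f k j"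
      by (rule order_trans[OF norm_triangle_ineq]) (simp add: gap_def)
    finally have "norm (?m (2*j+1+1) - ?m (2*j+1)) \<le> norm (mean f k (j+1) - mean f k j) + (gap f k (j+1) + gap f k j)"
      by simp
    then have "(norm (?m (2*j+1+1) - ?m (2*j+1)))\<^sup>2 \<le> (norm (mean f k (j+1) - mean f k j) + (gap f k (j+1) + gap f k j))\<^sup>2"
      by (intro power_mono) auto
    also have "\<dots> \<le> 3/2 * (norm (mean f k (j+1) - mean f k j))\<^sup>2 + 3 * (gap f k (j+1) + gap f k j)\<^sup>2"
      by (rule sq_sum_le32)
    also have "\<dots> \<le> 3/2 * (norm (mean f k (j+1) - mean f k j))\<^sup>2 + 3 * (2 * (gap f k (j+1))\<^sup>2 + 2 * (gap f k j)\<^sup>2)"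
      by (intro add_left_mono mult_left_mono sq_sum_le2) auto
    finally have "2 powi (k-1) * (norm (?m (2*j+1+1) - ?m (2*j+1)))\<^sup>2 \<le>
       2 powi (k-1) * (3/2 * (norm (mean f k (j+1) - mean f k j))\<^sup>2 + 3 * (2 * (gap f k (j+1))\<^sup>2 + 2 * (gap f k j)\<^sup>2))"
      by (rule mult_left_mono) simp
    then show ?thesis by (simp add: powi_pred algebra_simps)
  qed
  have ep: "ennreal x \<le> ennreal (3/4) * ennreal a + 3 * ennreal b + 3 * ennreal c"
    if "0 \<le> a" "0 \<le> b" "0 \<le> c" "x \<le> 3/4 * a + 3 * b + 3 * c" for x a b c
  proof -
    have "ennreal x \<le> ennreal (3/4 * a + 3 * b + 3 * c)" using that by (intro ennreal_leI) auto
    also have "\<dots> = ennreal (3/4 * a) + ennreal (3 * b) + ennreal (3 * c)" using that by simp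
    also have "\<dots> = ennreal (3/4) * ennreal a + 3 * ennreal b + 3 * ennreal c"
      by (simp only: ennreal_mult'[of "3/4" a] ennreal_mult'[of 3 b] ennreal_mult'[of 3 c] ennreal_numeral zero_le_numeral zero_le_divide_iff simp_thms)
    finally show ?thesis .
  qed
  define P where "P = zsum (\<lambda>j. ennreal (2 powi (k-1) * (norm (?m (2*j+1) - ?m (2*j)))\<^sup>2))"
  define R where "R = zsum (\<lambda>j. ennreal (2 powi (k-1) * (norm (?m (2*j+1+1) - ?m (2*j+1)))\<^sup>2))"
  have PR: "jump_sum f (k-1) = P + R"
    unfolding jump_sum_def P_def R_def by (rule zsum_parity)
  have P: "P = 2 * gap_sum f k"
    unfolding P_def e gap_sum_def zsum_cmult[symmetric] by (simp add: ennreal_mult')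
  have "R \<le> zsum (\<lambda>j. ennreal (3/4) * ennreal (?d * (norm (mean f k (j+1) - mean f k j))\<^sup>2)
      + 3 * ennreal (?d * (gap f k (j+1))\<^sup>2) + 3 * ennreal (?d * (gap f k j)\<^sup>2))"
    unfolding R_def by (intro nn_integral_mono ep o) auto
  also have "\<dots> = ennreal (3/4) * jump_sum f k + 3 * zsum (\<lambda>j. ennreal (?d * (gap f k (j+1))\<^sup>2)) + 3 * gap_sum f k"
    by (simp only: zsum_add zsum_cmult gap_sum_def jump_sum_def)
  also have "zsum (\<lambda>j. ennreal (?d * (gap f k (j+1))\<^sup>2)) = gap_sum f k"
    unfolding gap_sum_def by (rule zsum_shift)
  also have "ennreal (3/4) = 3/4"
    by (rule ennreal_three_quarters)
  finally have R: "R \<le> 3/4 * jump_sum f k + 3 * gap_sum f k + 3 * gap_sum f k" .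
  have "2 * g + (s + 3 * g + 3 * g) = s + 8 * g" for s g :: ennreal
  proof -
    have "2 * g + (s + 3 * g + 3 * g) = s + (2 * g + 3 * g + 3 * g)" by (simp add: ac_simps)
    also have "2 * g + 3 * g + 3 * g = (2 + 3 + 3) * g" by (simp only: distrib_right)
    finally show ?thesis by simp
  qed
  note eq = this
  have "2 * gap_sum f k + R \<le> 2 * gap_sum f k + (3/4 * jump_sum f k + 3 * gap_sum f k + 3 * gap_sum f k)"
    by (rule add_left_mono[OF R])
  then show ?thesis unfolding PR P by (simp only: eq)
qed

section \<open>Dyadic step functions\<close>

abbreviation cell :: "int \<Rightarrow> real \<Rightarrow> int" where
  "cell k x \<equiv> \<lfloor>x / 2 powi k\<rfloor>"

lemma measurable_cell: "cell k \<in> lebesgue \<rightarrow>\<^sub>M count_space UNIV"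
proof -
  have "cell k \<in> borel \<rightarrow>\<^sub>M count_space UNIV" by measurable
  then show ?thesis by (intro measurable_completion) simp
qed

lemma measurable_step_borel: "(\<lambda>x. h (cell k x)) \<in> borel_measurable lebesgue"
  by (rule measurable_compose[OF measurable_cell]) auto

text \<open>
  Integrals against functions that are constant on the dyadic intervals of one scale become sums
  over these intervals; this is the way in which conditional expectations enter all later
  arguments.
\<close>

lemma nn_integral_step:
  assumes [measurable]: "g \<in> borel_measurable lebesgue"
  shows "(\<integral>\<^sup>+x. h (cell k x) * g x \<partial>lebesgue) = zsum (\<lambda>j. h j * (\<integral>\<^sup>+x\<in>dyadic_interval k j. g x \<partial>lebesgue))"
proof -
  have "h (cell k x) * g x = zsum (\<lambda>j. h j * (g x * indicator (dyadic_interval k j) x))" for x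
    by (subst nn_integral_count_space'[of "{cell k x}"]) (auto simp: indicator_def mem_dyadic_interval_iff)
  then have "(\<integral>\<^sup>+x. h (cell k x) * g x \<partial>lebesgue) =
     (\<integral>\<^sup>+x. zsum (\<lambda>j. h j * (g x * indicator (dyadic_interval k j) x)) \<partial>lebesgue)" by simp
  also have "\<dots> = zsum (\<lambda>j. \<integral>\<^sup>+x. h j * (g x * indicator (dyadic_interval k j) x) \<partial>lebesgue)"
    by (rule nn_integral_count_space_nn_integral) auto
  also have "\<dots> = zsum (\<lambda>j. h j * (\<integral>\<^sup>+x\<in>dyadic_interval k j. g x \<partial>lebesgue))"
    by (intro nn_integral_cong nn_integral_cmult) auto
  finally show ?thesis .
qed

lemma nn_integral_step_const:
  "(\<integral>\<^sup>+x. h (cell k x) \<partial>lebesgue) = ennreal (2 powi k) * zsum h"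
proof -
  have "(\<integral>\<^sup>+x. h (cell k x) * 1 \<partial>lebesgue) = zsum (\<lambda>j. h j * ennreal (2 powi k))"
    by (subst nn_integral_step) (auto simp: emeasure_dyadic)
  then show ?thesis by (simp add: zsum_cmult[symmetric] mult.commute[of "ennreal _"])
qed

lemma zsum_energy:
  assumes [measurable]: "f \<in> borel_measurable lebesgue"
  shows "zsum (\<lambda>j. energy f (dyadic_interval k j)) = energy f UNIV"
  using nn_integral_step[of "\<lambda>x. ennreal ((norm (f x))\<^sup>2)" "\<lambda>_. 1" k] by (simp add: energy_def)

section \<open>The square sums over all scales\<close>

lemma mean_sum_le: assumes "f \<in> borel_measurable lebesgue" shows "mean_sum f k \<le> energy f UNIV"
  unfolding mean_sum_def zsum_energy[OF assms, of k, symmetric]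
  by (intro nn_integral_mono mean_energy assms)

lemma osc_sum_le: assumes "f \<in> borel_measurable lebesgue" "L1_loc f" shows "osc_sum f k \<le> 4 * energy f UNIV"
proof -
  have "osc_sum f k \<le> zsum (\<lambda>j. 4 * energy f (dyadic_interval k j))"
    unfolding osc_sum_def
  proof (intro nn_integral_mono)
    fix j
    have "ennreal ((osc f k j)\<^sup>2 / 2 powi k) = ennreal (1 / 2 powi k) * ennreal ((osc f k j)\<^sup>2)"
      by (subst ennreal_mult'[symmetric]) (auto simp: field_simps)
    also have "\<dots> \<le> ennreal (1 / 2 powi k) * (ennreal (4 * 2 powi k) * energy f (dyadic_interval k j))"
      by (intro mult_left_mono osc_energy assms) auto
    also have "\<dots> = 4 * energy f (dyadic_interval k j)"
      by (simp add: mult.assoc[symmetric] ennreal_mult'[symmetric])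
    finally show "ennreal ((osc f k j)\<^sup>2 / 2 powi k) \<le> 4 * energy f (dyadic_interval k j)" .
  qed
  then show ?thesis by (simp add: zsum_cmult zsum_energy assms)
qed

lemma jump_sum_le: assumes "f \<in> borel_measurable lebesgue" shows "jump_sum f k \<le> 4 * energy f UNIV"
proof -
  have ep: "ennreal (d * (norm (u - v))\<^sup>2) \<le> 2 * ennreal (d * (norm u)\<^sup>2) + 2 * ennreal (d * (norm v)\<^sup>2)" if "d \<ge> 0" for u v :: complex and d
  proof -
    have "(norm (u - v))\<^sup>2 \<le> (norm u + norm v)\<^sup>2" by (intro power_mono norm_triangle_ineq4) auto
    also have "\<dots> \<le> 2 * (norm u)\<^sup>2 + 2 * (norm v)\<^sup>2" by (rule sq_sum_le2)
    finally have "d * (norm (u - v))\<^sup>2 \<le> d * (2 * (norm u)\<^sup>2 + 2 * (norm v)\<^sup>2)" using that by (rule mult_left_mono)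
    then have "ennreal (d * (norm (u - v))\<^sup>2) \<le> ennreal (2 * (d * (norm u)\<^sup>2) + 2 * (d * (norm v)\<^sup>2))"
      by (intro ennreal_leI) (auto simp: algebra_simps)
    also have "\<dots> = ennreal (2 * (d * (norm u)\<^sup>2)) + ennreal (2 * (d * (norm v)\<^sup>2))" using that by simp
    finally show ?thesis
      using ennreal_mult'[of 2 "d * (norm u)\<^sup>2"] ennreal_mult'[of 2 "d * (norm v)\<^sup>2"] by (simp only: ennreal_numeral zero_le_numeral)
  qed
  have "jump_sum f k \<le> zsum (\<lambda>j. 2 * ennreal (2 powi k * (norm (mean f k (j+1)))\<^sup>2) + 2 * ennreal (2 powi k * (norm (mean f k j))\<^sup>2))"
    unfolding jump_sum_def by (intro nn_integral_mono ep) auto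
  also have "\<dots> = 2 * zsum (\<lambda>j. ennreal (2 powi k * (norm (mean f k (j+1)))\<^sup>2)) + 2 * mean_sum f k"
    by (simp only: zsum_add zsum_cmult mean_sum_def)
  also have "zsum (\<lambda>j. ennreal (2 powi k * (norm (mean f k (j+1)))\<^sup>2)) = mean_sum f k"
    unfolding mean_sum_def by (rule zsum_shift)
  also have "2 * mean_sum f k + 2 * mean_sum f k = (2 + 2) * mean_sum f k"
    by (simp only: distrib_right)
  also have "\<dots> = 4 * mean_sum f k" by simp
  also have "\<dots> \<le> 4 * energy f UNIV" by (intro mult_left_mono mean_sum_le assms) auto
  finally show ?thesis .
qed

text \<open>
  The gap sums telescope by orthogonality, starting from the means of the finest scale, which
  are controlled by Jensen's inequality.
\<close>

lemma sum_gap_sum: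
  assumes "L1_loc f" "f \<in> borel_measurable lebesgue"
  shows "(\<Sum>k\<in>{m..n}. gap_sum f k) \<le> energy f UNIV"
proof (cases "m \<le> n")
  case True
  then have "(\<Sum>k\<in>{m..n}. gap_sum f k) + mean_sum f n = mean_sum f (m - 1)"
  proof (induction n rule: int_ge_induct)
    case base
    show ?case using mean_sum_pred[OF assms(1), of m] by (simp add: add.commute)
  next
    case (step i)
    have "{m..i+1} = insert (i+1) {m..i}" using step.hyps by auto
    then have "(\<Sum>k\<in>{m..i+1}. gap_sum f k) + mean_sum f (i+1) = (\<Sum>k\<in>{m..i}. gap_sum f k) + (mean_sum f (i+1) + gap_sum f (i+1))"
      by (simp add: ac_simps)
    also have "mean_sum f (i+1) + gap_sum f (i+1) = mean_sum f i"
      using mean_sum_pred[OF assms(1), of "i+1"] by simp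
    finally show ?case using step.IH by simp
  qed
  then have "(\<Sum>k\<in>{m..n}. gap_sum f k) \<le> mean_sum f (m - 1)" by (metis le_iff_add)
  also have "\<dots> \<le> energy f UNIV" by (rule mean_sum_le[OF assms(2)])
  finally show ?thesis .
qed simp

text \<open>
  Finiteness of \<open>S\<close> is essential: it allows \<open>3/4 * S\<close> to be absorbed
  into the left-hand side.
\<close>

lemma ennreal_absorb:
  assumes "S \<le> 3/4 * (S + B) + E" "S < top" shows "(S::ennreal) \<le> 3 * B + 4 * E"
proof (cases "B = top \<or> E = top")
  case True then show ?thesis by (auto simp: ennreal_mult_top)
next
  case False
  obtain s b e where r: "S = ennreal s" "B = ennreal b" "E = ennreal e" "0 \<le> s" "0 \<le> b" "0 \<le> e"
    using assms(2) False by (metis ennreal_cases less_irrefl)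
  have 34: "3/4 = ennreal (3/4)"
    by (rule ennreal_three_quarters[symmetric])
  have "ennreal s \<le> ennreal (3/4 * (s + b) + e)"
    proof -
    have "ennreal (3/4 * (s + b) + e) = ennreal (3/4) * ennreal (s + b) + ennreal e"
      using r by (subst ennreal_plus, simp, simp, subst ennreal_mult', simp) rule
    then show ?thesis using assms(1) r unfolding 34 by simp
  qed
  then have "s \<le> 3/4 * (s + b) + e" using r by (subst (asm) ennreal_le_iff) auto
  then have "s \<le> 3 * b + 4 * e" by (simp add: field_simps)
  then have "ennreal s \<le> ennreal (3 * b + 4 * e)" by (rule ennreal_leI)
  also have "\<dots> = 3 * B + 4 * E" using r by (simp add: ennreal_mult')
  finally show ?thesis using r by simp
qed

lemma numeral_comb:
  "numeral a * (numeral b * E) + numeral c * (numeral d * E) = (numeral (a * b + c * d) * E :: ennreal)"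
  by (simp only: mult.assoc[symmetric] distrib_right[symmetric] numeral_times_numeral numeral_plus_numeral)

text \<open>
  Summing the contraction over a finite range of scales leaves one boundary term, the drift sum
  of the scale just below the range, and that is at most \<open>4\<close> times the energy. So
  the infinitely many finer scales never enter and no convergence of a martingale is needed.
\<close>

lemma sum_osc_sum:
  assumes f: "L1_loc f" "f \<in> borel_measurable lebesgue"
  shows "(\<Sum>k\<in>{m..n}. osc_sum f k) \<le> 15 * energy f UNIV"
proof (cases "energy f UNIV = top")
  case False
  let ?E = "energy f UNIV" let ?S = "\<Sum>k\<in>{m..n}. osc_sum f k"
  have fin: "osc_sum f k < top" for k
    using osc_sum_le[OF f(2,1), of k] False by (auto simp: ennreal_mult_less_top less_top intro: order.strict_trans1)
  have "?S \<le> (\<Sum>k\<in>{m..n}. 3/4 * osc_sum f (k-1) + 3/4 * gap_sum f k)"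
    by (intro sum_mono osc_sum_finer f)
  also have "\<dots> = 3/4 * (\<Sum>k\<in>{m..n}. osc_sum f (k-1)) + 3/4 * (\<Sum>k\<in>{m..n}. gap_sum f k)"
    by (simp add: sum.distrib sum_distrib_left)
  also have "\<dots> \<le> 3/4 * (?S + 4 * ?E) + 3/4 * ?E"
  proof (intro add_mono mult_left_mono sum_gap_sum f)
    have "(\<Sum>k\<in>{m..n}. osc_sum f (k-1)) = (\<Sum>k\<in>{m-1..n-1}. osc_sum f k)"
      by (rule sum.reindex_bij_witness[of _ "\<lambda>k. k + 1" "\<lambda>k. k - 1"]) auto
    also have "\<dots> \<le> (\<Sum>k\<in>insert (m-1) {m..n}. osc_sum f k)" by (rule sum_mono2) auto
    also have "\<dots> = ?S + osc_sum f (m-1)" by (simp add: add.commute)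
    also have "\<dots> \<le> ?S + 4 * ?E" by (intro add_left_mono osc_sum_le f)
    finally show "(\<Sum>k\<in>{m..n}. osc_sum f (k-1)) \<le> ?S + 4 * ?E" .
  qed auto
  finally have "?S \<le> 3 * (4 * ?E) + 4 * (3/4 * ?E)" by (rule ennreal_absorb) (use fin in auto)
  also have "\<dots> = 15 * ?E"
  proof -
    have 34: "3/4 = ennreal (3/4)"
    by (rule ennreal_three_quarters[symmetric])
    have "4 * (3/4) = (3::ennreal)" unfolding 34 by (simp flip: ennreal_mult' ennreal_numeral)
    then have "4 * (3/4 * ?E) = 3 * ?E" by (simp only: mult.assoc[symmetric])
    then show ?thesis
      by (simp only: mult.assoc[symmetric] distrib_right[symmetric]) simp
  qed
  finally show ?thesis .
qed (simp add: ennreal_mult_top)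

text \<open>
  Same argument as for the drift, but here the boundary term comes from the scale just above the
  range.
\<close>

lemma sum_jump_sum:
  assumes f: "L1_loc f" "f \<in> borel_measurable lebesgue"
  shows "(\<Sum>k\<in>{m..n}. jump_sum f k) \<le> 44 * energy f UNIV"
proof (cases "energy f UNIV = top")
  case False
  let ?E = "energy f UNIV" let ?S = "\<Sum>k\<in>{m..n}. jump_sum f k"
  have fin: "jump_sum f k < top" for k
    using jump_sum_le[OF f(2), of k] False by (auto simp: ennreal_mult_less_top less_top intro: order.strict_trans1)
  have "?S \<le> (\<Sum>k\<in>{m..n}. 3/4 * jump_sum f (k+1) + 8 * gap_sum f (k+1))"
    using jump_sum_coarser[OF f(1), of "_ + 1"] by (intro sum_mono) simp
  also have "\<dots> = 3/4 * (\<Sum>k\<in>{m..n}. jump_sum f (k+1)) + 8 * (\<Sum>k\<in>{m..n}. gap_sum f (k+1))"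
    by (simp add: sum.distrib sum_distrib_left)
  also have "(\<Sum>k\<in>{m..n}. gap_sum f (k+1)) = (\<Sum>k\<in>{m+1..n+1}. gap_sum f k)"
    by (rule sum.reindex_bij_witness[of _ "\<lambda>k. k - 1" "\<lambda>k. k + 1"]) auto
  also have "3/4 * (\<Sum>k\<in>{m..n}. jump_sum f (k+1)) + 8 * (\<Sum>k\<in>{m+1..n+1}. gap_sum f k) \<le> 3/4 * (?S + 4 * ?E) + 8 * ?E"
  proof (intro add_mono mult_left_mono sum_gap_sum f)
    have "(\<Sum>k\<in>{m..n}. jump_sum f (k+1)) = (\<Sum>k\<in>{m+1..n+1}. jump_sum f k)"
      by (rule sum.reindex_bij_witness[of _ "\<lambda>k. k - 1" "\<lambda>k. k + 1"]) auto
    also have "\<dots> \<le> (\<Sum>k\<in>insert (n+1) {m..n}. jump_sum f k)" by (rule sum_mono2) auto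
    also have "\<dots> = ?S + jump_sum f (n+1)" by (simp add: add.commute)
    also have "\<dots> \<le> ?S + 4 * ?E" by (intro add_left_mono jump_sum_le f)
    finally show "(\<Sum>k\<in>{m..n}. jump_sum f (k+1)) \<le> ?S + 4 * ?E" .
  qed auto
  finally have "?S \<le> 3 * (4 * ?E) + 4 * (8 * ?E)" by (rule ennreal_absorb) (use fin in auto)
  also have "\<dots> = 44 * ?E"
    by (subst numeral_comb) simp
  finally show ?thesis .
qed (simp add: ennreal_mult_top)

section \<open>A dyadic majorant of the square function\<close>

text \<open>
  An upper bound for the \<open>k\<close>-th summand of the square of the square function that
  is constant on dyadic intervals of scale \<open>k\<close>. This adaptedness to the dyadic
  filtration is what makes Garsia's argument available although the suprema over sliding
  intervals are not adapted.
\<close>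

definition majorant :: "(real \<Rightarrow> complex) \<Rightarrow> int \<Rightarrow> int \<Rightarrow> real" where
  "majorant f k j = 3 * (((osc f k (j-1))\<^sup>2 + (osc f k j)\<^sup>2 + (osc f k (j+1))\<^sup>2) / (2 powi k)\<^sup>2
     + (norm (mean f k (j+1) - mean f k j))\<^sup>2 + (norm (mean f k j - mean f k (j-1)))\<^sup>2)"

lemma majorant_nonneg: "0 \<le> majorant f k j" by (simp add: majorant_def)

lemma zsum_majorant:
  "ennreal (2 powi k) * zsum (\<lambda>j. ennreal (majorant f k j)) = 9 * osc_sum f k + 6 * jump_sum f k"
proof -
  let ?o = "\<lambda>j. ennreal ((osc f k j)\<^sup>2 / 2 powi k)"
  let ?s = "\<lambda>j. ennreal (2 powi k * (norm (mean f k (j+1) - mean f k j))\<^sup>2)"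
  have e3: "ennreal (3 * (a + b + c + d + e)) = 3 * (ennreal a + ennreal b + ennreal c + ennreal d + ennreal e)"
    if "0 \<le> a" "0 \<le> b" "0 \<le> c" "0 \<le> d" "0 \<le> e" for a b c d e
    using that ennreal_mult'[of 3 "a + b + c + d + e"] by simp
  have "ennreal (2 powi k) * ennreal (majorant f k j) = 3 * (?o (j + - 1) + ?o j + ?o (j + 1) + ?s j + ?s (j + - 1))" for j
  proof -
    have "2 powi k * majorant f k j = 3 * ((osc f k (j + - 1))\<^sup>2 / 2 powi k + (osc f k j)\<^sup>2 / 2 powi k + (osc f k (j+1))\<^sup>2 / 2 powi k
       + 2 powi k * (norm (mean f k (j+1) - mean f k j))\<^sup>2 + 2 powi k * (norm (mean f k (j + - 1 + 1) - mean f k (j + - 1)))\<^sup>2)"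
      by (simp add: majorant_def field_simps power2_eq_square)
    then show ?thesis
      by (subst ennreal_mult'[symmetric], simp, subst e3[symmetric]) simp_all
  qed
  then have "ennreal (2 powi k) * zsum (\<lambda>j. ennreal (majorant f k j)) =
     zsum (\<lambda>j. 3 * (?o (j + - 1) + ?o j + ?o (j + 1) + ?s j + ?s (j + - 1)))"
    by (simp only: zsum_cmult[symmetric])
  also have "\<dots> = 3 * (osc_sum f k + osc_sum f k + osc_sum f k + jump_sum f k + jump_sum f k)"
    unfolding zsum_cmult zsum_add zsum_shift[of ?o] zsum_shift[of ?s] osc_sum_def jump_sum_def ..
  also have "\<dots> = 9 * osc_sum f k + 6 * jump_sum f k"
  proof -
    have "3 * (a + a + a + b + b) = 9 * a + 6 * b" for a b :: ennreal
    proof -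
      have "3 * (a + a + a + b + b) = (3 * a + 3 * a + 3 * a) + (3 * b + 3 * b)"
        by (simp only: distrib_left add.assoc)
      also have "\<dots> = (3 + 3 + 3) * a + (3 + 3) * b" by (simp only: distrib_right)
      finally show ?thesis by simp
    qed
    then show ?thesis .
  qed
  finally show ?thesis .
qed

text \<open>
  The constant is \<open>399 = 9 \<cdot> 15 + 6 \<cdot> 44\<close>, from the bounds for the
  drift and for the jumps.
\<close>

theorem majorant_L2:
  assumes f: "L1_loc f" "f \<in> borel_measurable lebesgue"
  shows "(\<integral>\<^sup>+x. ennreal (\<Sum>k\<in>{m..n}. majorant f k (cell k x)) \<partial>lebesgue) \<le> 399 * energy f UNIV"
proof -
  have "(\<integral>\<^sup>+x. ennreal (\<Sum>k\<in>{m..n}. majorant f k (cell k x)) \<partial>lebesgue) =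
     (\<integral>\<^sup>+x. (\<Sum>k\<in>{m..n}. ennreal (majorant f k (cell k x))) \<partial>lebesgue)"
    by (intro nn_integral_cong) (simp add: sum_ennreal majorant_nonneg)
  also have "\<dots> = (\<Sum>k\<in>{m..n}. (\<integral>\<^sup>+x. ennreal (majorant f k (cell k x)) \<partial>lebesgue))"
    by (rule nn_integral_sum) (rule measurable_step_borel)
  also have "\<dots> = 9 * (\<Sum>k\<in>{m..n}. osc_sum f k) + 6 * (\<Sum>k\<in>{m..n}. jump_sum f k)"
    by (simp add: nn_integral_step_const[of "\<lambda>j. ennreal (majorant f _ j)"] zsum_majorant sum.distrib sum_distrib_left)
  also have "\<dots> \<le> 9 * (15 * energy f UNIV) + 6 * (44 * energy f UNIV)"
    by (intro add_mono mult_left_mono sum_osc_sum sum_jump_sum f) auto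
  also have "\<dots> = 399 * energy f UNIV" by (subst numeral_comb) simp
  finally show ?thesis .
qed

section \<open>Localisation\<close>

definition triple :: "int \<Rightarrow> int \<Rightarrow> real set" where
  "triple k j = {(of_int j - 1) * 2 powi k ..< (of_int j + 2) * 2 powi k}"

lemma triple_lebesgue [measurable]: "triple k j \<in> sets lebesgue"
  by (simp add: triple_def)

lemma powi_le_split: assumes "k \<le> (l::int)" shows "(2::real) powi l = 2 powi k * of_int (2 ^ nat (l - k))"
proof -
  have "(2::real) powi l = 2 powi (k + (l - k))" by simp
  also have "\<dots> = 2 powi k * 2 powi (l - k)" by (rule power_int_add) simp
  also have "(2::real) powi (l - k) = of_int (2 ^ nat (l - k))" using assms by (simp add: power_int_def)
  finally show ?thesis .
qed

text \<open>
  Dyadic intervals are nested, expressed through their indices.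
\<close>

lemma cell_coarser: assumes "k \<le> l" shows "cell l x = cell k x div 2 ^ nat (l - k)"
proof -
  have "x / 2 powi l = x / 2 powi k / real_of_int (2 ^ nat (l - k))"
    unfolding powi_le_split[OF assms] by simp
  then show ?thesis by (metis floor_divide_real_eq_div zero_le_numeral zero_le_power)
qed

lemma triple_nested:
  assumes "k \<le> l" shows "triple k (cell k x) \<subseteq> triple l (cell l x)"
proof -
  define d where "d = (2::real) powi k" define n :: int where "n = 2 ^ nat (l - k)"
  have n: "n \<ge> 1" by (simp add: n_def)
  have l: "2 powi l = d * of_int n" unfolding d_def n_def by (rule powi_le_split[OF assms])
  have d: "d > 0" by (simp add: d_def)
  define i where "i = cell k x" define j where "j = cell l x"
  have j: "j = i div n" unfolding i_def j_def n_def by (rule cell_coarser[OF assms])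
  have "j * n \<le> i" "i + 1 \<le> (j + 1) * n" unfolding j using n
    by (simp_all add: div_mod_decomp_int algebra_simps)
       (smt (verit, best) minus_mod_eq_mult_div pos_mod_bound pos_mod_sign mult.commute)+
  then have "(j - 1) * n \<le> i - 1" "i + 2 \<le> (j + 2) * n" using n by (simp_all add: algebra_simps)
  then have "of_int ((j - 1) * n) * d \<le> of_int (i - 1) * d" "of_int (i + 2) * d \<le> of_int ((j + 2) * n) * d"
    using d by (simp_all only: of_int_le_iff mult_le_cancel_right_pos)
  then have "triple k i \<subseteq> triple l j"
    unfolding triple_def d_def[symmetric] l by (auto simp: algebra_simps)
  then show ?thesis unfolding i_def j_def .
qed

lemma seg_integral_cong: "(\<And>x. x \<in> {a..<b} \<Longrightarrow> f x = g x) \<Longrightarrow> seg_integral f a b = seg_integral g a b"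
  unfolding seg_integral_def set_lebesgue_integral_def by (intro Bochner_Integration.integral_cong) (auto simp: indicator_def)

lemma mean_cong: "(\<And>x. x \<in> dyadic_interval k j \<Longrightarrow> f x = g x) \<Longrightarrow> mean f k j = mean g k j"
  unfolding mean_eq by (subst seg_integral_cong[of _ _ f g]) (auto simp: dyadic_interval_def)

lemma osc_cong: assumes "\<And>x. x \<in> dyadic_interval k j \<Longrightarrow> f x = g x" shows "osc f k j = osc g k j"
proof -
  have "drift f k j t = drift g k j t" if "t \<in> {of_int j * 2 powi k..(of_int j + 1) * 2 powi k}" for t
  proof -
    have "mean f k j = mean g k j" by (rule mean_cong[OF assms])
    moreover have "seg_integral f (of_int j * 2 powi k) t = seg_integral g (of_int j * 2 powi k) t"
      by (rule seg_integral_cong, rule assms) (use that in \<open>auto simp: dyadic_interval_def\<close>)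
    ultimately show ?thesis by (simp only: drift_def)
  qed
  then show ?thesis unfolding osc_def by (intro SUP_cong) auto
qed

lemma majorant_cong: assumes "\<And>x. x \<in> triple k j \<Longrightarrow> f x = g x" shows "majorant f k j = majorant g k j"
proof -
  have s: "dyadic_interval k (j-1) \<subseteq> triple k j" "dyadic_interval k j \<subseteq> triple k j" "dyadic_interval k (j+1) \<subseteq> triple k j"
  proof -
    define d where "d = (2::real) powi k"
    have "d > 0" by (simp add: d_def)
    then show "dyadic_interval k (j-1) \<subseteq> triple k j" "dyadic_interval k j \<subseteq> triple k j" "dyadic_interval k (j+1) \<subseteq> triple k j"
      unfolding triple_def dyadic_interval_def d_def[symmetric]
      by (simp_all add: ivl_subset left_diff_distrib distrib_right)
  qed
  have "osc f k i = osc g k i" "mean f k i = mean g k i" if "i \<in> {j-1, j, j+1}" for i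
    using that s by (auto intro!: osc_cong mean_cong assms)
  then show ?thesis unfolding majorant_def by simp
qed

lemma L1_loc_restrict:
  assumes "L1_loc f" "S \<in> sets lebesgue" shows "L1_loc (\<lambda>x. indicator S x *\<^sub>R f x)"
  unfolding L1_loc_def
proof (intro allI)
  fix a b
  have "set_integrable lebesgue {a..<b} f" using assms by (simp add: L1_loc_def)
  then have "set_integrable lebesgue ({a..<b} \<inter> S) f"
    by (rule set_integrable_subset) (use assms in auto)
  then show "set_integrable lebesgue {a..<b} (\<lambda>x. indicator S x *\<^sub>R f x)"
    unfolding set_integrable_def indicator_inter_arith scaleR_scaleR .
qed

text \<open>
  For the scales up to that of an interval, the majorant on the interval only sees
  \<open>f\<close> on its triple. So the global square integral bound, applied to
  \<open>f\<close> cut off outside the triple, becomes a local one. This Carleson type estimate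
  drives both the \<open>Lp\<close> and the \<open>BMO\<close> bound.
\<close>

theorem majorant_local:
  assumes f: "L1_loc f" and [measurable]: "f \<in> borel_measurable lebesgue"
  shows "(\<integral>\<^sup>+x\<in>dyadic_interval l j. ennreal (\<Sum>k\<in>{m..l}. majorant f k (cell k x)) \<partial>lebesgue) \<le> 399 * energy f (triple l j)"
proof -
  define g where "g = (\<lambda>x. indicator (triple l j) x *\<^sub>R f x)"
  have "(\<integral>\<^sup>+x\<in>dyadic_interval l j. ennreal (\<Sum>k\<in>{m..l}. majorant f k (cell k x)) \<partial>lebesgue) \<le>
     (\<integral>\<^sup>+x. ennreal (\<Sum>k\<in>{m..l}. majorant g k (cell k x)) \<partial>lebesgue)"
  proof (intro nn_integral_mono)
    fix x
    show "ennreal (\<Sum>k\<in>{m..l}. majorant f k (cell k x)) * indicator (dyadic_interval l j) x \<le> ennreal (\<Sum>k\<in>{m..l}. majorant g k (cell k x))"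
    proof (cases "x \<in> dyadic_interval l j")
      case True
      then have j: "j = cell l x" by (simp add: mem_dyadic_interval_iff)
      have "majorant f k (cell k x) = majorant g k (cell k x)" if "k \<in> {m..l}" for k
        by (rule majorant_cong) (use triple_nested[of k l x] that in \<open>auto simp: g_def j\<close>)
      then show ?thesis using True by simp
    qed simp
  qed
  also have "\<dots> \<le> 399 * energy g UNIV"
    unfolding g_def by (intro majorant_L2 L1_loc_restrict f) auto
  also have "energy g UNIV = energy f (triple l j)"
    unfolding energy_def g_def by (intro nn_integral_cong) (auto simp: indicator_def)
  finally show ?thesis .
qed

section \<open>Sliding averages\<close>

lemma sq_sum_le3: "((a::real) + b + c)\<^sup>2 \<le> 3 * (a\<^sup>2 + b\<^sup>2 + c\<^sup>2)"
  using sum_squares_bound[of a b] sum_squares_bound[of a c] sum_squares_bound[of b c]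
  by (simp add: power2_sum algebra_simps)

lemma slide_eq: "avg {s..<s + 2 powi k} f = seg_integral f s (s + 2 powi k) /\<^sub>R 2 powi k"
  by (simp add: avg_def seg_integral_def)

text \<open>
  An interval of dyadic length that is not dyadic itself crosses exactly one dyadic point of its
  scale. Splitting it there leaves two end pieces, which are partial integrals over dyadic
  intervals and hence equal to drifts up to linear terms.
\<close>

lemma slide_decomp:
  assumes l: "L1_loc f" and s: "s \<in> {of_int i * 2 powi k..(of_int i + 1) * 2 powi k}"
  shows "seg_integral f s (s + 2 powi k) = drift f k (i+1) (s + 2 powi k) - drift f k i s
    + ((of_int i + 1) * 2 powi k - s) *\<^sub>R mean f k i + (s - of_int i * 2 powi k) *\<^sub>R mean f k (i+1)"
proof -
  define d where "d = (2::real) powi k"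
  have d: "d > 0" by (simp add: d_def)
  let ?a = "of_int i * d" let ?b = "(of_int i + 1) * d"
  have s': "?a \<le> s" "s \<le> ?b" using s by (auto simp: d_def)
  have m: "seg_integral f ?a ?b = d *\<^sub>R mean f k i" by (simp add: mean_eq d_def)
  have 1: "seg_integral f s (s + d) = seg_integral f s ?b + seg_integral f ?b (s + d)"
    by (rule seg_integral_split[OF l]) (use s' in \<open>auto simp: algebra_simps\<close>)
  have "seg_integral f ?a ?b = seg_integral f ?a s + seg_integral f s ?b" by (rule seg_integral_split[OF l]) (use s' in auto)
  then have 2: "seg_integral f s ?b = d *\<^sub>R mean f k i - seg_integral f ?a s" using m by simp
  show ?thesis unfolding drift_def d_def[symmetric] 1 2 of_int_add of_int_1
    by (simp add: algebra_simps scaleR_conv_of_real)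
qed

text \<open>
  The interval meets at most two dyadic intervals, one of which contains \<open>x\<close>. By
  the decomposition its average is a convex combination of their means plus two drifts;
  subtracting the mean around \<open>x\<close> leaves the drifts and a fraction of one jump.
\<close>

lemma slide_le_majorant:
  assumes l: "L1_loc f" and s: "s \<in> {x - 2 powi k..x}"
  shows "(norm (avg {s..<s + 2 powi k} f - mean f k (cell k x)))\<^sup>2 \<le> majorant f k (cell k x)"
proof -
  define d where "d = (2::real) powi k"
  have d: "d > 0" by (simp add: d_def)
  define j where "j = cell k x"
  have x: "of_int j * d \<le> x" "x < (of_int j + 1) * d"
    using mem_dyadic_interval_iff[of x k j] by (auto simp: j_def d_def dyadic_interval_def)
  \<comment> \<open>the dyadic interval that contains the left end point \<open>s\<close>; it is the one around \<open>x\<close> or its left neighbour\<close>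
  define i where "i = (if s < of_int j * d then j - 1 else j)"
  have si: "of_int i * d \<le> s" "s \<le> (of_int i + 1) * d"
    using s x d by (auto simp: i_def d_def[symmetric] algebra_simps)
  have osc: "norm (drift f k (i+1) (s + d)) \<le> osc f k (i+1)" "norm (drift f k i s) \<le> osc f k i"
    using si by (auto intro!: norm_drift_le_osc[OF l] simp: d_def[symmetric] algebra_simps)
  define e where "e = mean f k (i+1) - mean f k i"
  obtain c where c: "\<bar>c\<bar> \<le> d" and eq: "seg_integral f s (s + d) - d *\<^sub>R mean f k j = drift f k (i+1) (s + d) - drift f k i s + c *\<^sub>R e"
  proof (cases "j = i")
    case True
    show ?thesis
      by (rule that[of "s - of_int i * d"])
         (use si True slide_decomp[OF l, of s i k] in \<open>auto simp: d_def[symmetric] e_def algebra_simps\<close>)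
  next
    case False
    then have ji: "j = i + 1" by (auto simp: i_def split: if_splits)
    show ?thesis
      by (rule that[of "s - (of_int i + 1) * d"])
         (use si ji slide_decomp[OF l, of s i k] in \<open>auto simp: d_def[symmetric] e_def algebra_simps\<close>)
  qed
  have "norm (seg_integral f s (s + d) - d *\<^sub>R mean f k j) \<le> norm (drift f k (i+1) (s + d)) + norm (drift f k i s) + norm (c *\<^sub>R e)"
    unfolding eq by (intro order_trans[OF norm_triangle_ineq] add_mono norm_triangle_ineq4 order_refl)
  also have "\<dots> \<le> osc f k (i+1) + osc f k i + d * norm e"
    using osc c by (intro add_mono) (auto intro!: mult_right_mono)
  finally have n: "norm (seg_integral f s (s + d) - d *\<^sub>R mean f k j) \<le> osc f k (i+1) + osc f k i + d * norm e" .
  have "avg {s..<s + d} f - mean f k j = (seg_integral f s (s + d) - d *\<^sub>R mean f k j) /\<^sub>R d"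
    using d slide_eq[of s k f] by (simp add: d_def[symmetric] algebra_simps)
  then have "(norm (avg {s..<s + d} f - mean f k j))\<^sup>2 = (norm (seg_integral f s (s + d) - d *\<^sub>R mean f k j))\<^sup>2 / d\<^sup>2"
    using d by (simp only: norm_scaleR) (simp add: power_divide power_mult_distrib field_simps)
  also have "\<dots> \<le> (osc f k (i+1) + osc f k i + d * norm e)\<^sup>2 / d\<^sup>2"
    by (intro divide_right_mono power_mono n) auto
  also have "\<dots> \<le> 3 * ((osc f k (i+1))\<^sup>2 + (osc f k i)\<^sup>2 + (d * norm e)\<^sup>2) / d\<^sup>2"
    by (intro divide_right_mono sq_sum_le3) auto
  also have "\<dots> = 3 * (((osc f k (i+1))\<^sup>2 + (osc f k i)\<^sup>2) / d\<^sup>2 + (norm e)\<^sup>2)"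
    using d by (simp add: field_simps power_mult_distrib)
  also have "\<dots> \<le> majorant f k j"
  proof (cases "j = i")
    case True
    have "((osc f k (i+1))\<^sup>2 + (osc f k i)\<^sup>2) / d\<^sup>2 \<le> ((osc f k (i-1))\<^sup>2 + (osc f k i)\<^sup>2 + (osc f k (i+1))\<^sup>2) / d\<^sup>2"
      by (rule divide_right_mono) auto
    moreover have add: "A \<le> B \<Longrightarrow> 0 \<le> Z \<Longrightarrow> 3 * (A + Y) \<le> 3 * (B + Y + Z)" for A B Y Z :: real by simp
    ultimately show ?thesis unfolding majorant_def d_def[symmetric] True e_def by (intro add) auto
  next
    case False
    then have ji: "j = i + 1" by (auto simp: i_def split: if_splits)
    have "((osc f k (i+1))\<^sup>2 + (osc f k i)\<^sup>2) / d\<^sup>2 \<le> ((osc f k i)\<^sup>2 + (osc f k (i+1))\<^sup>2 + (osc f k (i+1+1))\<^sup>2) / d\<^sup>2"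
      by (rule divide_right_mono) auto
    moreover have add: "A \<le> B \<Longrightarrow> 0 \<le> Z \<Longrightarrow> 3 * (A + Y) \<le> 3 * (B + Z + Y)" for A B Y Z :: real by simp
    ultimately show ?thesis unfolding majorant_def d_def[symmetric] ji e_def add_diff_cancel_right' by (intro add) auto
  qed
  finally show ?thesis unfolding d_def j_def .
qed

section \<open>Intervals through a point\<close>

text \<open>
  An interval of finite positive measure is known up to its end points, so for a given length
  averages over it only depend on the left end point.
\<close>

lemma interval_sandwich:
  assumes "I \<in> intervals_of_length r" "0 < r"
  obtains a where "{a<..<a + r} \<subseteq> I" "I \<subseteq> {a..a + r}" "I \<in> sets lebesgue"
proof -
  have I: "is_interval I" "measure lebesgue I = r" using assms by (auto simp: intervals_of_length_def)
  have S: "I \<in> sets lebesgue" using I(2) assms(2) measure_notin_sets by fastforce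
  have F: "I \<in> fmeasurable lebesgue" using I(2) assms(2) S
    by (auto simp: fmeasurable_def measure_def less_top[symmetric])
  have ne: "I \<noteq> {}" using I(2) assms(2) by auto
  have d: "z - y \<le> r" if "y \<in> I" "z \<in> I" for y z
  proof (cases "y \<le> z")
    case True
    have "{y..z} \<subseteq> I" using mem_is_interval_1_I[OF I(1) that] by auto
    then have "measure lebesgue {y..z} \<le> measure lebesgue I" using F by (intro measure_mono_fmeasurable) auto
    then show ?thesis using True I(2) by simp
  qed (use assms(2) in auto)
  obtain w where w: "w \<in> I" using ne by auto
  have bd: "bdd_below I" "bdd_above I"
  proof -
    show "bdd_below I" using d[OF _ w] by (intro bdd_belowI[of I "w - r"]) (simp add: algebra_simps)
    show "bdd_above I" using d[OF w] by (intro bdd_aboveI[of I "w + r"]) (simp add: algebra_simps)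
  qed
  define a where "a = Inf I" define b where "b = Sup I"
  have ab: "I \<subseteq> {a..b}" using bd by (auto simp: a_def b_def cInf_lower cSup_upper)
  have in_I: "{a<..<b} \<subseteq> I"
  proof
    fix x assume "x \<in> {a<..<b}"
    then obtain y z where "y \<in> I" "y < x" "z \<in> I" "x < z"
      using cInf_less_iff[OF ne bd(1), of x] less_cSup_iff[OF ne bd(2), of x] by (auto simp: a_def b_def)
    then show "x \<in> I" using I(1) by (meson is_interval_1 less_imp_le)
  qed
  have "a \<le> b" using ab ne by auto
  have "b - a \<le> r" using measure_mono_fmeasurable[OF in_I _ F] I(2) \<open>a \<le> b\<close> by simp
  moreover have "r \<le> b - a" using measure_mono_fmeasurable[OF ab S] I(2) \<open>a \<le> b\<close> by simp
  ultimately have "b = a + r" by simp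
  then show ?thesis using that[of a] ab in_I S by simp
qed

lemma avg_interval:
  assumes [measurable]: "f \<in> borel_measurable lebesgue"
    and "{a<..<a + r} \<subseteq> I" "I \<subseteq> {a..a + r}" "I \<in> sets lebesgue" "0 < r"
  shows "avg I f = avg {a..<a + r} f"
proof -
  have [measurable]: "I \<in> sets lebesgue" "{a..<a + r} \<in> sets lebesgue" using assms(4) by auto
  have "finite {a, a + r}" by simp
  then have "AE x in lebesgue. x \<notin> {a, a + r}"
    by (intro AE_not_in null_sets_completionI) (simp add: finite_imp_null_set_lborel)
  then have ae: "AE x in lebesgue. indicator I x = (indicator {a..<a + r} x :: real)"
  proof eventually_elim
    case (elim x)
    have "x \<in> {a<..<a + r} \<Longrightarrow> x \<in> I" "x \<in> I \<Longrightarrow> x \<in> {a..a + r}" using assms(2,3) by blast+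
    then have "x \<in> I \<longleftrightarrow> x \<in> {a..<a + r}" using elim by (cases "x \<in> I") auto
    then show ?case by (auto simp: indicator_def)
  qed
  have "set_lebesgue_integral lebesgue I f = set_lebesgue_integral lebesgue {a..<a + r} f"
    unfolding set_lebesgue_integral_def
    by (rule integral_cong_AE) (use ae in \<open>auto elim!: eventually_mono\<close>)
  moreover have "measure lebesgue I = measure lebesgue {a..<a + r}"
  proof -
    have "emeasure lebesgue I = emeasure lebesgue {a..<a + r}"
      by (rule emeasure_eq_AE) (use ae in \<open>auto elim!: eventually_mono simp: indicator_def split: if_splits\<close>)
    then show ?thesis by (simp add: measure_def)
  qed
  ultimately show ?thesis by (simp add: avg_def)
qed

lemma intervals_of_length_translate:
  assumes "I \<in> intervals_of_length r" shows "(\<lambda>y. y + x) ` I \<in> intervals_of_length r"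
  using assms measure_translation[of x I]
  by (auto simp: intervals_of_length_def add.commute[of _ x] is_interval_translation)

lemma translate_sandwich:
  assumes "{a<..<a + r} \<subseteq> I" "I \<subseteq> {a..a + r}"
  shows "{x + a<..<x + a + r} \<subseteq> (\<lambda>y. y + x) ` I" "(\<lambda>y. y + x) ` I \<subseteq> {x + a..x + a + (r::real)}"
proof
  fix z assume "z \<in> {x + a<..<x + a + r}"
  then have "z - x \<in> I" using assms(1) by (auto simp: subset_iff)
  then show "z \<in> (\<lambda>y. y + x) ` I" by (intro image_eqI[of _ _ "z - x"]) auto
qed (use assms(2) in auto)

text \<open>
  The \<open>k\<close>-th term of the square function as a real number, with half-open intervals
  parametrised by the offset of the left end from \<open>x\<close>.
\<close>

definition wobble :: "(real \<Rightarrow> complex) \<Rightarrow> int \<Rightarrow> real \<Rightarrow> real" where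
  "wobble f k x = (SUP a\<in>{- (2 powi k)..0}. norm (avg {x + a..<x + a + 2 powi k} f - mean f k (cell k x)))"

lemma slide_le_wobble:
  assumes "L1_loc f" "a \<in> {- (2 powi k)..0}"
  shows "norm (avg {x + a..<x + a + 2 powi k} f - mean f k (cell k x)) \<le> wobble f k x"
  unfolding wobble_def
proof (rule cSUP_upper[OF assms(2)], rule bdd_aboveI2)
  fix b :: real assume "b \<in> {- (2 powi k)..0}"
  then show "norm (avg {x + b..<x + b + 2 powi k} f - mean f k (cell k x)) \<le> sqrt (majorant f k (cell k x))"
    by (intro real_le_rsqrt slide_le_majorant assms) auto
qed

lemma wobble_le:
  assumes "\<And>a. a \<in> {- (2 powi k)..0} \<Longrightarrow> norm (avg {x + a..<x + a + 2 powi k} f - mean f k (cell k x)) \<le> c"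
  shows "wobble f k x \<le> c"
  unfolding wobble_def by (rule cSUP_least) (auto intro!: assms)

lemma wobble_nonneg: assumes "L1_loc f" shows "0 \<le> wobble f k x"
  using slide_le_wobble[OF assms, of 0 k x] by (auto intro: order_trans[OF norm_ge_zero])

lemma wobble_le_majorant: assumes "L1_loc f" shows "(wobble f k x)\<^sup>2 \<le> majorant f k (cell k x)"
proof -
  have "wobble f k x \<le> sqrt (majorant f k (cell k x))"
    by (intro wobble_le real_le_rsqrt slide_le_majorant assms) auto
  then show ?thesis using wobble_nonneg[OF assms] majorant_nonneg
    by (metis power_mono real_sqrt_pow2)
qed

lemma SUP_intervals_eq_wobble:
  assumes f: "L1_loc f" and [measurable]: "f \<in> borel_measurable lebesgue"
  shows "(SUP I\<in>intervals_at_origin k. ennreal ((norm (avg ((\<lambda>y. y + x) ` I) f - dyadic_expectation k f x))\<^sup>2))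
     = ennreal ((wobble f k x)\<^sup>2)" (is "(SUP I\<in>?S. ?F I) = ?R")
proof (rule antisym)
  have dy: "dyadic_expectation k f x = mean f k (cell k x)"
    by (simp add: dyadic_expectation_def dyadic_containing_def)
  show "(SUP I\<in>?S. ?F I) \<le> ?R"
  proof (rule SUP_least)
    fix I assume I: "I \<in> ?S"
    then have I': "I \<in> intervals_of_length (2 powi k)" "0 \<in> I" by (auto simp: intervals_at_origin_def)
    obtain a where a: "{a<..<a + 2 powi k} \<subseteq> I" "I \<subseteq> {a..a + 2 powi k}"
      by (rule interval_sandwich[OF I'(1)]) auto
    obtain b where b: "(\<lambda>y. y + x) ` I \<in> sets lebesgue"
      by (rule interval_sandwich[OF intervals_of_length_translate[OF I'(1), of x]]) auto
    have "avg ((\<lambda>y. y + x) ` I) f = avg {x + a..<x + a + 2 powi k} f"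
      by (rule avg_interval[OF _ translate_sandwich[OF a] b]) auto
    moreover have "a \<in> {- (2 powi k)..0}" using a(2) I'(2) by auto
    ultimately show "?F I \<le> ?R" unfolding dy
      using slide_le_wobble[OF f] by (intro ennreal_leI power_mono) auto
  qed
  show "?R \<le> (SUP I\<in>?S. ?F I)"
  proof (cases "(SUP I\<in>?S. ?F I)" rule: ennreal_cases)
    case (real c)
    note c = real(2,1)
    have "wobble f k x \<le> sqrt c"
    proof (rule wobble_le)
      fix a :: real assume a: "a \<in> {- (2 powi k)..0}"
      let ?I = "{a..<a + 2 powi k}" let ?J = "{a..a + 2 powi k}"
      have "0 \<in> ?J" using a by simp
      then have J: "?J \<in> ?S" unfolding intervals_at_origin_def intervals_of_length_def by (simp add: is_interval_cc)
      have J': "avg ((\<lambda>y. y + x) ` ?J) f = avg {x + a..<x + a + 2 powi k} f"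
      proof (rule avg_interval)
        have e: "(\<lambda>y. y + x) ` ?J = {a + x..a + 2 powi k + x}" by (rule image_add_atLeastAtMost')
        have c: "a + x = x + a" "a + 2 powi k + x = x + a + 2 powi k" by simp_all
        show "{x + a<..<x + a + 2 powi k} \<subseteq> (\<lambda>y. y + x) ` ?J" "(\<lambda>y. y + x) ` ?J \<subseteq> {x + a..x + a + 2 powi k}"
          "(\<lambda>y. y + x) ` ?J \<in> sets lebesgue"
          unfolding e c by (simp_all add: greaterThanLessThan_subseteq_atLeastAtMost_iff)
      qed auto
      have "?F ?J \<le> ennreal c"
        using SUP_upper[OF J, of ?F] unfolding c(1) .
      then have "ennreal ((norm (avg {x + a..<x + a + 2 powi k} f - mean f k (cell k x)))\<^sup>2) \<le> ennreal c"
        unfolding dy J' .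
      then have "(norm (avg {x + a..<x + a + 2 powi k} f - mean f k (cell k x)))\<^sup>2 \<le> c" using c(2) by simp
      then show "norm (avg {x + a..<x + a + 2 powi k} f - mean f k (cell k x)) \<le> sqrt c"
        by (rule real_le_rsqrt)
    qed
    then have "(wobble f k x)\<^sup>2 \<le> c" using wobble_nonneg[OF f] c(2) by (metis power_mono real_sqrt_pow2)
    then show ?thesis using c by simp
  next
    case top
    then show ?thesis by (simp only: top_greatest)
  qed
qed

section \<open>Absorption and layer-cake arguments\<close>

text \<open>
  Young's inequality for the exponents \<open>q\<close> and \<open>q / (q - 1)\<close>, in the
  form in which the power \<open>a powr (q - 1)\<close> is already dual to \<open>z\<close>.
\<close>

lemma powr_Young:
  assumes "1 < q" "0 \<le> z" "0 \<le> (a::real)"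
  shows "q * (z * a powr (q - 1)) \<le> z powr q + (q - 1) * a powr q"
proof -
  have "z * a powr (q - 1) \<le> z powr q / q + (a powr (q - 1)) powr (q / (q - 1)) / (q / (q - 1))"
    by (rule Youngs_inequality) (use assms in \<open>auto simp: field_simps\<close>)
  also have "(a powr (q - 1)) powr (q / (q - 1)) = a powr q" using assms by (simp add: powr_powr)
  finally have "z * a powr (q - 1) \<le> (z powr q + (q - 1) * a powr q) / q"
    by (simp add: add_divide_distrib diff_divide_distrib algebra_simps)
  then show ?thesis using assms(1) by (simp add: field_simps)
qed

text \<open>
  The common last step of Doob's, Jensen's and Garsia's inequality: Young's inequality turns the
  right-hand side into a multiple of the \<open>q\<close>-th moment of \<open>Z\<close> plus
  \<open>1 - 1/q\<close> times the left-hand side. Finiteness is needed for subtracting the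
  latter.
\<close>

lemma Lq_absorb:
  fixes A Z :: "'a \<Rightarrow> real"
  assumes [measurable]: "A \<in> borel_measurable M" "Z \<in> borel_measurable M"
    and nn: "\<And>x. 0 \<le> A x" "\<And>x. 0 \<le> Z x" and q: "1 < q" and C: "0 < C"
    and le: "(\<integral>\<^sup>+x. ennreal (A x powr q) \<partial>M) \<le> ennreal C * (\<integral>\<^sup>+x. ennreal (Z x * A x powr (q - 1)) \<partial>M)"
    and fin: "(\<integral>\<^sup>+x. ennreal (A x powr q) \<partial>M) < top"
  shows "(\<integral>\<^sup>+x. ennreal (A x powr q) \<partial>M) \<le> ennreal (C powr q) * (\<integral>\<^sup>+x. ennreal (Z x powr q) \<partial>M)"
proof (cases "(\<integral>\<^sup>+x. ennreal (Z x powr q) \<partial>M) = top")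
  case True then show ?thesis using C by (simp add: ennreal_mult_top)
next
  case False
  let ?I = "\<integral>\<^sup>+x. ennreal (A x powr q) \<partial>M" and ?J = "\<integral>\<^sup>+x. ennreal (Z x powr q) \<partial>M"
  obtain i where i: "?I = ennreal i" "0 \<le> i" using fin by (cases ?I rule: ennreal_cases) auto
  obtain j where j: "?J = ennreal j" "0 \<le> j" using False by (cases ?J rule: ennreal_cases) auto
  have "ennreal (q * i) = ennreal q * ?I" unfolding i(1) using q by (simp add: ennreal_mult')
  also have "\<dots> \<le> ennreal q * (ennreal C * (\<integral>\<^sup>+x. ennreal (Z x * A x powr (q - 1)) \<partial>M))"
    by (intro mult_left_mono le) auto
  also have "\<dots> = (\<integral>\<^sup>+x. ennreal (q * ((C * Z x) * A x powr (q - 1))) \<partial>M)"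
    using q C nn by (simp add: nn_integral_cmult[symmetric] ennreal_mult'[symmetric] mult.assoc)
  also have "\<dots> \<le> (\<integral>\<^sup>+x. ennreal (C powr q * Z x powr q) + ennreal ((q - 1) * A x powr q) \<partial>M)"
  proof (intro nn_integral_mono)
    fix x
    have "q * ((C * Z x) * A x powr (q - 1)) \<le> (C * Z x) powr q + (q - 1) * A x powr q"
      by (rule powr_Young) (use q C nn in auto)
    also have "(C * Z x) powr q = C powr q * Z x powr q" using C nn by (simp add: powr_mult)
    finally have "ennreal (q * ((C * Z x) * A x powr (q - 1))) \<le> ennreal (C powr q * Z x powr q + (q - 1) * A x powr q)"
      by (rule ennreal_leI)
    also have "\<dots> = ennreal (C powr q * Z x powr q) + ennreal ((q - 1) * A x powr q)"
      by (rule ennreal_plus) (use q in auto)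
    finally show "ennreal (q * ((C * Z x) * A x powr (q - 1))) \<le> ennreal (C powr q * Z x powr q) + ennreal ((q - 1) * A x powr q)" .
  qed
  also have "\<dots> = (\<integral>\<^sup>+x. ennreal (C powr q * Z x powr q) \<partial>M) + (\<integral>\<^sup>+x. ennreal ((q - 1) * A x powr q) \<partial>M)"
    by (rule nn_integral_add) auto
  also have "(\<integral>\<^sup>+x. ennreal (C powr q * Z x powr q) \<partial>M) = ennreal (C powr q) * ?J"
    by (simp add: nn_integral_cmult[symmetric] ennreal_mult')
  also have "(\<integral>\<^sup>+x. ennreal ((q - 1) * A x powr q) \<partial>M) = ennreal (q - 1) * ?I"
    using q by (simp add: nn_integral_cmult[symmetric] ennreal_mult')
  also have "ennreal (C powr q) * ?J + ennreal (q - 1) * ?I = ennreal (C powr q * j + (q - 1) * i)"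
    unfolding i(1) j(1) using q i j by (simp add: ennreal_mult')
  finally have "q * i \<le> C powr q * j + (q - 1) * i"
    using q i j by (subst (asm) ennreal_le_iff) auto
  then have "i \<le> C powr q * j" by (simp add: algebra_simps)
  then show ?thesis unfolding i(1) j(1) by (simp add: ennreal_mult'[symmetric] ennreal_leI)
qed

lemma nn_integral_powr_less:
  assumes s: "0 < s" and t: "0 \<le> t"
  shows "(\<integral>\<^sup>+l. ennreal (s * l powr (s - 1)) * indicator {0<..<t} l \<partial>lborel) = ennreal (t powr s)"
proof -
  have "((\<lambda>l. l powr (s - 1)) has_integral t powr (s - 1 + 1) / (s - 1 + 1)) {0..t}"
    by (rule has_integral_powr_from_0) (use s t in auto)
  then have "((\<lambda>l. s * l powr (s - 1)) has_integral s * (t powr (s - 1 + 1) / (s - 1 + 1))) {0..t}"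
    by (rule has_integral_mult_right)
  then have h: "((\<lambda>l. s * l powr (s - 1)) has_integral t powr s) {0..t}" using s by simp
  have "(\<integral>\<^sup>+l. ennreal (indicator {0..t} l * (s * l powr (s - 1))) \<partial>lborel) = ennreal (t powr s)"
    by (rule nn_integral_has_integral_lebesgue[OF _ h]) (use s in auto)
  moreover have "(\<integral>\<^sup>+l. ennreal (s * l powr (s - 1)) * indicator {0<..<t} l \<partial>lborel) =
      (\<integral>\<^sup>+l. ennreal (indicator {0..t} l * (s * l powr (s - 1))) \<partial>lborel)"
  proof (rule nn_integral_cong_AE)
    have "AE l in lborel. l \<notin> {0, t}"
      by (intro AE_not_in finite_imp_null_set_lborel) simp
    then show "AE l in lborel. ennreal (s * l powr (s - 1)) * indicator {0<..<t} l = ennreal (indicator {0..t} l * (s * l powr (s - 1)))"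
      by eventually_elim (auto simp: indicator_def)
  qed
  ultimately show ?thesis by simp
qed

lemma sigma_finite_lebesgue: "sigma_finite_measure (lebesgue :: real measure)"
proof
  obtain A :: "real set set" where A: "countable A" "A \<subseteq> sets lborel" "\<Union> A = space lborel" "\<forall>a\<in>A. emeasure lborel a \<noteq> \<infinity>"
    using lborel.sigma_finite_countable by blast
  then show "\<exists>A::real set set. countable A \<and> A \<subseteq> sets lebesgue \<and> \<Union> A = space lebesgue \<and> (\<forall>a\<in>A. emeasure lebesgue a \<noteq> \<infinity>)"
    by (intro exI[of _ A]) (auto simp: emeasure_completion subset_iff)
qed

lemma layer_cake:
  fixes N :: "real \<Rightarrow> real"
  assumes [measurable]: "N \<in> borel_measurable lebesgue" "g \<in> borel_measurable lebesgue"
    and N: "\<And>x. 0 \<le> N x" and s: "0 < s"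
  shows "(\<integral>\<^sup>+x. g x * ennreal (N x powr s) \<partial>lebesgue) =
    (\<integral>\<^sup>+l. ennreal (s * l powr (s - 1)) * indicator {0<..} l * (\<integral>\<^sup>+x. g x * indicator {x. l < N x} x \<partial>lebesgue) \<partial>lborel)"
proof -
  interpret L: sigma_finite_measure "lebesgue :: real measure" by (rule sigma_finite_lebesgue)
  interpret P: pair_sigma_finite "lebesgue :: real measure" "lborel :: real measure" ..
  have "(\<integral>\<^sup>+x. g x * ennreal (N x powr s) \<partial>lebesgue) =
    (\<integral>\<^sup>+x. (\<integral>\<^sup>+l. g x * (ennreal (s * l powr (s - 1)) * indicator {0<..<N x} l) \<partial>lborel) \<partial>lebesgue)"
    by (intro nn_integral_cong) (simp add: nn_integral_cmult nn_integral_powr_less s N)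
  also have "\<dots> = (\<integral>\<^sup>+x. (\<integral>\<^sup>+l. g x * (ennreal (s * l powr (s - 1)) * (indicator {0<..} l * indicator {p. snd p < N (fst p)} (x, l))) \<partial>lborel) \<partial>lebesgue)"
    by (intro nn_integral_cong) (auto simp: indicator_def)
  also have "\<dots> = (\<integral>\<^sup>+l. (\<integral>\<^sup>+x. g x * (ennreal (s * l powr (s - 1)) * (indicator {0<..} l * indicator {p. snd p < N (fst p)} (x, l))) \<partial>lebesgue) \<partial>lborel)"
    by (rule P.Fubini'[symmetric]) measurable
  also have "\<dots> = (\<integral>\<^sup>+l. (\<integral>\<^sup>+x. ennreal (s * l powr (s - 1)) * indicator {0<..} l * (g x * indicator {x. l < N x} x) \<partial>lebesgue) \<partial>lborel)"
    by (intro nn_integral_cong) (auto simp: indicator_def ac_simps)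
  also have "\<dots> = (\<integral>\<^sup>+l. ennreal (s * l powr (s - 1)) * indicator {0<..} l * (\<integral>\<^sup>+x. g x * indicator {x. l < N x} x \<partial>lebesgue) \<partial>lborel)"
    by (intro nn_integral_cong nn_integral_cmult) measurable
  finally show ?thesis .
qed

text \<open>
  Integrate the weak type bound against \<open>q * l powr (q - 2)\<close> and undo the
  layer-cake formula on both sides. It matters that the weak type bound only involves
  \<open>g\<close> on the level set itself; this yields the form of the estimate that can be
  absorbed.
\<close>

lemma weak_to_strong:
  fixes N g :: "real \<Rightarrow> real"
  assumes [measurable]: "N \<in> borel_measurable lebesgue" "g \<in> borel_measurable lebesgue"
    and N: "\<And>x. 0 \<le> N x" "\<And>x. 0 \<le> g x" and q: "1 < q" and C: "0 \<le> C"
    and weak: "\<And>l. 0 < l \<Longrightarrow> ennreal l * emeasure lebesgue {x. l < N x} \<le> ennreal C * (\<integral>\<^sup>+x\<in>{x. l < N x}. ennreal (g x) \<partial>lebesgue)"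
  shows "(\<integral>\<^sup>+x. ennreal (N x powr q) \<partial>lebesgue) \<le> ennreal (C * q / (q - 1)) * (\<integral>\<^sup>+x. ennreal (g x * N x powr (q - 1)) \<partial>lebesgue)"
proof -
  have S: "{x. l < N x} \<in> sets lebesgue" for l
    using borel_measurable_less[of "\<lambda>_. l" lebesgue N] by simp
  have "(\<integral>\<^sup>+x. ennreal (N x powr q) \<partial>lebesgue) = (\<integral>\<^sup>+x. 1 * ennreal (N x powr q) \<partial>lebesgue)" by simp
  also have "\<dots> = (\<integral>\<^sup>+l. ennreal (q * l powr (q - 1)) * indicator {0<..} l * (\<integral>\<^sup>+x. 1 * indicator {x. l < N x} x \<partial>lebesgue) \<partial>lborel)"
    by (rule layer_cake) (use N q in auto)
  also have "\<dots> \<le> (\<integral>\<^sup>+l. ennreal (C * q / (q - 1)) * (ennreal ((q - 1) * l powr (q - 1 - 1)) * indicator {0<..} l * (\<integral>\<^sup>+x. ennreal (g x) * indicator {x. l < N x} x \<partial>lebesgue)) \<partial>lborel)"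
  proof (intro nn_integral_mono)
    fix l :: real
    let ?E = "\<integral>\<^sup>+x. ennreal (g x) * indicator {x. l < N x} x \<partial>lebesgue"
    show "ennreal (q * l powr (q - 1)) * indicator {0<..} l * (\<integral>\<^sup>+x. 1 * indicator {x. l < N x} x \<partial>lebesgue)
      \<le> ennreal (C * q / (q - 1)) * (ennreal ((q - 1) * l powr (q - 1 - 1)) * indicator {0<..} l * ?E)"
    proof (cases "0 < l")
      case True
      have eq: "q * l powr (q - 1) = q * l powr (q - 1 - 1) * l" using True by (simp add: powr_diff power2_eq_square)
      have "ennreal (q * l powr (q - 1)) = ennreal (q * l powr (q - 1 - 1)) * ennreal l"
        by (subst eq, rule ennreal_mult'') (use True in auto)
      then have "ennreal (q * l powr (q - 1)) * emeasure lebesgue {x. l < N x} = ennreal (q * l powr (q - 1 - 1)) * (ennreal l * emeasure lebesgue {x. l < N x})"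
        by (simp only: mult.assoc)
      also have "\<dots> \<le> ennreal (q * l powr (q - 1 - 1)) * (ennreal C * ?E)"
        by (intro mult_left_mono weak True) auto
      also have "\<dots> = ennreal (C * q / (q - 1)) * (ennreal ((q - 1) * l powr (q - 1 - 1)) * ?E)"
        unfolding mult.assoc[symmetric] using q C by (simp add: ennreal_mult'[symmetric] mult.commute)
      finally show ?thesis using True S by simp
    qed simp
  qed
  also have "\<dots> = ennreal (C * q / (q - 1)) * (\<integral>\<^sup>+l. ennreal ((q - 1) * l powr (q - 1 - 1)) * indicator {0<..} l * (\<integral>\<^sup>+x. ennreal (g x) * indicator {x. l < N x} x \<partial>lebesgue) \<partial>lborel)"
  proof (rule nn_integral_cmult)
    interpret L: sigma_finite_measure "lebesgue :: real measure" by (rule sigma_finite_lebesgue)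
    have "(\<lambda>l. \<integral>\<^sup>+x. ennreal (g x) * indicator {p. fst p < N (snd p)} (l, x) \<partial>lebesgue) \<in> borel_measurable lborel"
      by measurable
    then have [measurable]: "(\<lambda>l. \<integral>\<^sup>+x. ennreal (g x) * indicator {x. l < N x} x \<partial>lebesgue) \<in> borel_measurable lborel"
      by (simp add: indicator_def)
    show "(\<lambda>l. ennreal ((q - 1) * l powr (q - 1 - 1)) * indicator {0<..} l * (\<integral>\<^sup>+x. ennreal (g x) * indicator {x. l < N x} x \<partial>lebesgue)) \<in> borel_measurable lborel"
      by measurable
  qed
  also have "(\<integral>\<^sup>+l. ennreal ((q - 1) * l powr (q - 1 - 1)) * indicator {0<..} l * (\<integral>\<^sup>+x. ennreal (g x) * indicator {x. l < N x} x \<partial>lebesgue) \<partial>lborel)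
    = (\<integral>\<^sup>+x. ennreal (g x) * ennreal (N x powr (q - 1)) \<partial>lebesgue)"
    by (rule layer_cake[symmetric]) (use N q in auto)
  also have "\<dots> = (\<integral>\<^sup>+x. ennreal (g x * N x powr (q - 1)) \<partial>lebesgue)"
    using N by (simp add: ennreal_mult')
  finally show ?thesis .
qed

section \<open>An inequality of Garsia type\<close>

lemma powr_tail_telescope:
  fixes a :: "int \<Rightarrow> real"
  assumes "m \<le> n"
  shows "(\<Sum>l\<in>{m..n}. sum a {l..n} powr r - sum a {l+1..n} powr r) = sum a {m..n} powr r"
  using assms
proof (induction m rule: int_le_induct)
  case base show ?case by simp
next
  case (step i)
  have "{i - 1..n} = insert (i - 1) {i..n}" using step.hyps by auto
  then show ?case using step.IH by simp
qed

text \<open>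
  Summation by parts. When the sequence is extended by a term \<open>b\<close> at the lower end,
  the left-hand side grows by at most \<open>q * b * t powr (q - 1)\<close> for the new total
  \<open>t\<close>, by Young's inequality; the right-hand side grows by exactly this amount
  because the increments of \<open>sum a {l..n} powr (q - 1)\<close> telescope.
\<close>

lemma Garsia_pointwise:
  fixes a :: "int \<Rightarrow> real"
  assumes "m \<le> n" and q: "1 < q" and nn: "\<And>k. 0 \<le> a k"
  shows "sum a {m..n} powr q \<le> q * (\<Sum>l\<in>{m..n}. (sum a {l..n} powr (q - 1) - sum a {l+1..n} powr (q - 1)) * sum a {m..l})"
  using assms(1)
proof (induction m rule: int_le_induct)
  case base
  have "a n powr q = a n powr (q - 1) * a n" using nn[of n] by (cases "a n = 0") (auto simp: powr_diff)
  moreover have "0 \<le> a n powr (q - 1) * a n" using nn by simp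
  then have "a n powr (q - 1) * a n \<le> q * (a n powr (q - 1) * a n)" using q by (simp add: mult_le_cancel_right1)
  ultimately show ?case by simp
next
  case (step m)
  let ?t = "\<lambda>l. sum a {l..n}" let ?B = "\<lambda>l. ?t l powr (q - 1) - ?t (l + 1) powr (q - 1)"
  have ins: "{m - 1..l} = insert (m - 1) {m..l}" if "m \<le> l" for l using that by auto
  have r: "sum a {m-1..l} = a (m-1) + sum a {m..l}" if "m \<le> l" for l using that by (simp add: ins)
  have tel: "(\<Sum>l\<in>{m..n}. ?B l) = ?t m powr (q - 1)"
    by (rule powr_tail_telescope[OF step.hyps])
  have s: "?t (m-1) = a (m-1) + ?t m" by (rule r[OF step.hyps])
  have tn: "0 \<le> ?t l" for l by (intro sum_nonneg nn)
  have Y: "q * (?t m * ?t (m-1) powr (q - 1)) \<le> ?t m powr q + (q - 1) * ?t (m-1) powr q"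
    by (rule powr_Young[OF q tn tn])
  have P: "?t (m-1) powr q = (a (m-1) + ?t m) * ?t (m-1) powr (q - 1)"
    unfolding s[symmetric] using tn[of "m-1"] by (cases "?t (m-1) = 0") (auto simp: powr_diff)
  have "?t (m-1) powr q \<le> ?t m powr q + q * (a (m-1) * ?t (m-1) powr (q - 1))"
  proof -
    have "q * (a (m-1) * ?t (m-1) powr (q - 1)) = q * ?t (m-1) powr q - q * (?t m * ?t (m-1) powr (q - 1))"
      unfolding P by (simp add: algebra_simps)
    then show ?thesis using Y by (simp add: algebra_simps)
  qed
  also have "?t m powr q \<le> q * (\<Sum>l\<in>{m..n}. ?B l * sum a {m..l})" by (rule step.IH)
  also have "q * (\<Sum>l\<in>{m..n}. ?B l * sum a {m..l}) + q * (a (m-1) * ?t (m-1) powr (q - 1)) =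
     q * (\<Sum>l\<in>{m-1..n}. ?B l * sum a {m-1..l})"
  proof -
    have "(\<Sum>l\<in>{m-1..n}. ?B l * sum a {m-1..l}) = ?B (m-1) * a (m-1) + (\<Sum>l\<in>{m..n}. ?B l * sum a {m-1..l})"
      using step.hyps by (simp add: ins)
    also have "(\<Sum>l\<in>{m..n}. ?B l * sum a {m-1..l}) = (\<Sum>l\<in>{m..n}. ?B l * a (m-1) + ?B l * sum a {m..l})"
      by (intro sum.cong) (auto simp: r distrib_left)
    also have "\<dots> = ?t m powr (q - 1) * a (m-1) + (\<Sum>l\<in>{m..n}. ?B l * sum a {m..l})"
      by (simp only: sum.distrib tel flip: sum_distrib_right)
    finally show ?thesis by (simp add: algebra_simps)
  qed
  finally show ?case by simp
qed

text \<open>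
  Let \<open>a k (cell k x)\<close> be an adapted nonnegative process. Each increment that
  occurs in the pointwise inequality is nonnegative and measurable at level \<open>l\<close>,
  while it multiplies exactly the partial sum that the hypothesis compares with \<open>Z\<close>
  on all intervals of level \<open>l\<close>. After the comparison the increments telescope to
  the power of the whole sum.
\<close>

lemma Garsia:
  fixes a :: "int \<Rightarrow> int \<Rightarrow> real"
  assumes mn: "m \<le> n" and q: "1 < q" and nn: "\<And>k j. 0 \<le> a k j" "\<And>x. 0 \<le> Z x"
    and [measurable]: "Z \<in> borel_measurable lebesgue"
    and loc: "\<And>l j. l \<in> {m..n} \<Longrightarrow>
      (\<integral>\<^sup>+x\<in>dyadic_interval l j. ennreal (\<Sum>k\<in>{m..l}. a k (cell k x)) \<partial>lebesgue) \<le> (\<integral>\<^sup>+x\<in>dyadic_interval l j. ennreal (Z x) \<partial>lebesgue)"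
  shows "(\<integral>\<^sup>+x. ennreal ((\<Sum>k\<in>{m..n}. a k (cell k x)) powr q) \<partial>lebesgue)
    \<le> ennreal q * (\<integral>\<^sup>+x. ennreal (Z x * (\<Sum>k\<in>{m..n}. a k (cell k x)) powr (q - 1)) \<partial>lebesgue)"
proof -
  define A where "A = (\<lambda>x. \<Sum>k\<in>{m..n}. a k (cell k x))"
  define R where "R = (\<lambda>l x. \<Sum>k\<in>{m..l}. a k (cell k x))"
  \<comment> \<open>the increment of level \<open>l\<close> as a function of the interval of level \<open>l\<close>; coarser levels are reached by integer division\<close>
  define b where "b = (\<lambda>l i. (\<Sum>k\<in>{l..n}. a k (i div 2 ^ nat (k - l))) powr (q - 1) - (\<Sum>k\<in>{l+1..n}. a k (i div 2 ^ nat (k - l))) powr (q - 1))"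
  have R_meas [measurable]: "R l \<in> borel_measurable lebesgue" for l
    unfolding R_def by (intro borel_measurable_sum measurable_step_borel)
  have A_meas [measurable]: "A \<in> borel_measurable lebesgue"
    unfolding A_def by (intro borel_measurable_sum measurable_step_borel)
  have b_meas [measurable]: "(\<lambda>x. b l (cell l x)) \<in> borel_measurable lebesgue" for l
    by (rule measurable_step_borel)
  have R_nn: "0 \<le> R l x" for l x unfolding R_def by (intro sum_nonneg nn)
  have b_nn: "0 \<le> b l i" for l i
  proof -
    have "(\<Sum>k\<in>{l+1..n}. a k (i div 2 ^ nat (k - l))) \<le> (\<Sum>k\<in>{l..n}. a k (i div 2 ^ nat (k - l)))"
      by (rule sum_mono2) (auto simp: nn)
    then show ?thesis unfolding b_def using q by (simp add: powr_mono2 sum_nonneg nn)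
  qed
  have b_eq: "b l (cell l x) = (\<Sum>k\<in>{l..n}. a k (cell k x)) powr (q - 1) - (\<Sum>k\<in>{l+1..n}. a k (cell k x)) powr (q - 1)" for l x
    unfolding b_def by (simp add: cell_coarser[symmetric])
  have pt: "A x powr q \<le> q * (\<Sum>l\<in>{m..n}. b l (cell l x) * R l x)" for x
    unfolding A_def R_def b_eq by (rule Garsia_pointwise[OF mn q]) (rule nn)
  have tel: "(\<Sum>l\<in>{m..n}. b l (cell l x)) = A x powr (q - 1)" for x
    unfolding A_def b_eq by (rule powr_tail_telescope[OF mn])
  have "(\<integral>\<^sup>+x. ennreal (A x powr q) \<partial>lebesgue) \<le> (\<integral>\<^sup>+x. ennreal q * (\<Sum>l\<in>{m..n}. ennreal (b l (cell l x)) * ennreal (R l x)) \<partial>lebesgue)"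
  proof (intro nn_integral_mono)
    fix x
    have "ennreal (A x powr q) \<le> ennreal (q * (\<Sum>l\<in>{m..n}. b l (cell l x) * R l x))"
      by (rule ennreal_leI[OF pt])
    also have "\<dots> = ennreal q * ennreal (\<Sum>l\<in>{m..n}. b l (cell l x) * R l x)"
      by (rule ennreal_mult') (use q in simp)
    also have "ennreal (\<Sum>l\<in>{m..n}. b l (cell l x) * R l x) = (\<Sum>l\<in>{m..n}. ennreal (b l (cell l x)) * ennreal (R l x))"
      unfolding ennreal_mult'[OF b_nn, symmetric] by (rule sum_ennreal[symmetric]) (simp add: b_nn R_nn)
    finally show "ennreal (A x powr q) \<le> ennreal q * (\<Sum>l\<in>{m..n}. ennreal (b l (cell l x)) * ennreal (R l x))" .
  qed
  also have "\<dots> = ennreal q * (\<Sum>l\<in>{m..n}. \<integral>\<^sup>+x. ennreal (b l (cell l x)) * ennreal (R l x) \<partial>lebesgue)"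
    by (subst nn_integral_cmult, measurable) (subst nn_integral_sum, auto)
  also have "\<dots> \<le> ennreal q * (\<Sum>l\<in>{m..n}. \<integral>\<^sup>+x. ennreal (b l (cell l x)) * ennreal (Z x) \<partial>lebesgue)"
  proof (intro mult_left_mono sum_mono)
    fix l assume l: "l \<in> {m..n}"
    have "(\<integral>\<^sup>+x. ennreal (b l (cell l x)) * ennreal (R l x) \<partial>lebesgue) = zsum (\<lambda>j. ennreal (b l j) * (\<integral>\<^sup>+x\<in>dyadic_interval l j. ennreal (R l x) \<partial>lebesgue))"
      by (rule nn_integral_step) measurable
    also have "\<dots> \<le> zsum (\<lambda>j. ennreal (b l j) * (\<integral>\<^sup>+x\<in>dyadic_interval l j. ennreal (Z x) \<partial>lebesgue))"
      unfolding R_def by (intro nn_integral_mono mult_left_mono loc l) auto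
    also have "\<dots> = (\<integral>\<^sup>+x. ennreal (b l (cell l x)) * ennreal (Z x) \<partial>lebesgue)"
      by (rule nn_integral_step[symmetric]) measurable
    finally show "(\<integral>\<^sup>+x. ennreal (b l (cell l x)) * ennreal (R l x) \<partial>lebesgue) \<le> (\<integral>\<^sup>+x. ennreal (b l (cell l x)) * ennreal (Z x) \<partial>lebesgue)" .
  qed auto
  also have "(\<Sum>l\<in>{m..n}. \<integral>\<^sup>+x. ennreal (b l (cell l x)) * ennreal (Z x) \<partial>lebesgue) = (\<integral>\<^sup>+x. (\<Sum>l\<in>{m..n}. ennreal (b l (cell l x)) * ennreal (Z x)) \<partial>lebesgue)"
    by (rule nn_integral_sum[symmetric]) measurable
  also have "\<dots> = (\<integral>\<^sup>+x. ennreal (Z x * A x powr (q - 1)) \<partial>lebesgue)"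
  proof (intro nn_integral_cong)
    fix x
    have "(\<Sum>l\<in>{m..n}. ennreal (b l (cell l x)) * ennreal (Z x)) = ennreal (A x powr (q - 1)) * ennreal (Z x)"
      by (simp only: sum_distrib_right[symmetric] sum_ennreal b_nn tel)
    also have "\<dots> = ennreal (Z x * A x powr (q - 1))"
      by (subst ennreal_mult'') (simp_all add: mult.commute)
    finally show "(\<Sum>l\<in>{m..n}. ennreal (b l (cell l x)) * ennreal (Z x)) = ennreal (Z x * A x powr (q - 1))" .
  qed
  finally show ?thesis unfolding A_def .
qed

section \<open>A dyadic maximal function with neighbours\<close>

definition cell_density :: "(real \<Rightarrow> real) \<Rightarrow> int \<Rightarrow> int \<Rightarrow> real" where
  "cell_density g k j = enn2real (\<integral>\<^sup>+x\<in>dyadic_interval k j. ennreal (g x) \<partial>lebesgue) / 2 powi k"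

text \<open>
  Neighbours are included because the local bound for the majorant involves the triple of an
  interval.
\<close>

definition near_density :: "(real \<Rightarrow> real) \<Rightarrow> int \<Rightarrow> int \<Rightarrow> real" where
  "near_density g k j = Max ((\<lambda>i. cell_density g k (j + i)) ` {-1..1})"

definition dyadic_max :: "int \<Rightarrow> int \<Rightarrow> (real \<Rightarrow> real) \<Rightarrow> real \<Rightarrow> real" where
  "dyadic_max m n g x = Max ((\<lambda>k. near_density g k (cell k x)) ` {m..n})"

definition cell_finite :: "(real \<Rightarrow> real) \<Rightarrow> bool" where
  "cell_finite g \<longleftrightarrow> (\<forall>k j. (\<integral>\<^sup>+x\<in>dyadic_interval k j. ennreal (g x) \<partial>lebesgue) < top)"

lemma cell_density_nonneg: "0 \<le> cell_density g k j" by (simp add: cell_density_def)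

lemma cell_density_eq: "cell_finite g \<Longrightarrow> (\<integral>\<^sup>+x\<in>dyadic_interval k j. ennreal (g x) \<partial>lebesgue) = ennreal (2 powi k * cell_density g k j)"
  by (simp add: cell_density_def cell_finite_def)

lemma cell_density_le_near: "i \<in> {-1..1} \<Longrightarrow> cell_density g k (j + i) \<le> near_density g k j"
  unfolding near_density_def by (intro Max_ge) auto

lemma near_density_le_max: "k \<in> {m..n} \<Longrightarrow> near_density g k (cell k x) \<le> dyadic_max m n g x"
  unfolding dyadic_max_def by (intro Max_ge) auto

lemma cell_density_le_max: "k \<in> {m..n} \<Longrightarrow> i \<in> {-1..1} \<Longrightarrow> cell_density g k (cell k x + i) \<le> dyadic_max m n g x"
  by (blast intro: order_trans cell_density_le_near near_density_le_max)

lemma dyadic_max_nonneg: assumes "m \<le> n" shows "0 \<le> dyadic_max m n g x"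
  using cell_density_le_max[of m m n 0 g x] assms by (auto intro: order_trans[OF cell_density_nonneg])

lemma dyadic_max_attained: assumes "m \<le> n" obtains k i where "k \<in> {m..n}" "i \<in> {-1..1}" "dyadic_max m n g x = cell_density g k (cell k x + i)"
proof -
  have "dyadic_max m n g x \<in> (\<lambda>k. near_density g k (cell k x)) ` {m..n}"
    unfolding dyadic_max_def by (rule Max_in) (use assms in auto)
  then obtain k where k: "k \<in> {m..n}" "dyadic_max m n g x = near_density g k (cell k x)" by auto
  have "near_density g k (cell k x) \<in> (\<lambda>i. cell_density g k (cell k x + i)) ` {-1..1}"
    unfolding near_density_def by (rule Max_in) auto
  then show ?thesis using k that by auto
qed

lemma dyadic_max_measurable [measurable]: "dyadic_max m n g \<in> borel_measurable lebesgue"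
  unfolding dyadic_max_def[abs_def] by (intro borel_measurable_Max measurable_step_borel) auto

text \<open>
  Adjacent intervals have ancestors that are equal or adjacent. This is why the neighbours of
  selected intervals suffice to cover the level sets of the maximal function.
\<close>

lemma div_neighbour:
  fixes i e n :: int assumes "e \<in> {-1..1}" "0 < n"
  obtains d where "d \<in> {-1..1}" "(i + e) div n = i div n + d"
proof (rule that)
  have m: "0 \<le> i mod n" "i mod n < n" using assms by auto
  have i: "i + e = (i mod n + e) + (i div n) * n" by (simp add: mult.commute)
  have eq: "(i + e) div n = i div n + (i mod n + e) div n"
    by (subst i, subst div_mult_self1) (use assms in auto)
  show "(i + e) div n = i div n + ((i + e) div n - i div n)" by simp
  have "- n \<le> i mod n + e" "i mod n + e < 2 * n" using m assms(1) unfolding atLeastAtMost_iff by linarith+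
  moreover have "(i mod n + e) div n * n \<le> i mod n + e"
    unfolding minus_mod_eq_div_mult[symmetric] using assms(2) by simp
  ultimately have "(i mod n + e) div n * n < 2 * n" "- n \<le> i mod n + e" by linarith+
  moreover from this(2) have "(- n) div n \<le> (i mod n + e) div n" using assms(2) by (rule zdiv_mono1)
  ultimately have "(- n) div n \<le> (i mod n + e) div n" "(i mod n + e) div n < 2"
    using assms(2) by auto
  moreover have "(- n) div n = - 1" using assms(2) by (metis div_minus_minus div_self minus_minus div_minus1_right less_irrefl mult_minus1_right nonzero_mult_div_cancel_left)
  ultimately show "(i + e) div n - i div n \<in> {-1..1}" using eq by auto
qed

text \<open>
  Select the intervals with density above \<open>l\<close> that are maximal in the range of
  scales. They are disjoint and lie in the level set, so \<open>l\<close> times their total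
  length is at most the integral of \<open>g\<close> over the level set. If a neighbour of the
  interval around \<open>x\<close> has large density, then \<open>x\<close> lies in a selected
  interval or in a neighbour of one; so the triples of the selected intervals cover the level
  set, which costs the factor \<open>3\<close>.
\<close>

lemma dyadic_max_weak_type:
  assumes mn: "m \<le> n" and g: "cell_finite g" and [measurable]: "g \<in> borel_measurable lebesgue" and l: "0 < l"
  shows "ennreal l * emeasure lebesgue {x. l < dyadic_max m n g x} \<le> ennreal 3 * (\<integral>\<^sup>+x\<in>{x. l < dyadic_max m n g x}. ennreal (g x) \<partial>lebesgue)"
proof -
  let ?E = "{x. l < dyadic_max m n g x}"
  define top_cell where "top_cell k j \<longleftrightarrow> l < cell_density g k j \<and> (\<forall>k'\<in>{k<..n}. cell_density g k' (j div 2 ^ nat (k' - k)) \<le> l)" for k j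
  define d where "d k j = (if top_cell k j then 1 else 0 :: ennreal)" for k j
  have E: "?E \<in> sets lebesgue" using borel_measurable_less[of "\<lambda>_. l" lebesgue "dyadic_max m n g"] by simp
  \<comment> \<open>the triples of the selected intervals cover the level set\<close>
  have cover: "indicator ?E x \<le> (\<Sum>k\<in>{m..n}. \<Sum>i\<in>{-1..1}. d k (cell k x + i))" for x
  proof (cases "x \<in> ?E")
    case True
    obtain k i where k: "k \<in> {m..n}" "i \<in> {-1..1}" "l < cell_density g k (cell k x + i)"
      using True by (metis dyadic_max_attained[OF mn] mem_Collect_eq)
    define S where "S = {k'\<in>{k..n}. l < cell_density g k' ((cell k x + i) div 2 ^ nat (k' - k))}"
    have "k \<in> S" using k by (auto simp: S_def)
    have "finite S" unfolding S_def by (rule finite_subset[of _ "{k..n}"]) auto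
    \<comment> \<open>the ancestor of the neighbour that is maximal among those of large density\<close>
    define K where "K = Max S"
    have K: "K \<in> S" "\<And>k'. k' \<in> S \<Longrightarrow> k' \<le> K"
      unfolding K_def using \<open>k \<in> S\<close> \<open>finite S\<close> by (auto intro!: Max_in Max_ge)
    then have kK: "k \<le> K" "K \<le> n" by (auto simp: S_def)
    have "top_cell K ((cell k x + i) div 2 ^ nat (K - k))"
      unfolding top_cell_def
    proof (intro conjI ballI)
      show "l < cell_density g K ((cell k x + i) div 2 ^ nat (K - k))" using K(1) by (simp add: S_def)
      fix k' assume k': "k' \<in> {K<..n}"
      have "nat (k' - k) = nat (K - k) + nat (k' - K)" using kK k' by auto
      then have "(cell k x + i) div 2 ^ nat (K - k) div 2 ^ nat (k' - K) = (cell k x + i) div 2 ^ nat (k' - k)"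
        by (simp add: power_add zdiv_zmult2_eq)
      then show "cell_density g k' ((cell k x + i) div 2 ^ nat (K - k) div 2 ^ nat (k' - K)) \<le> l"
      proof -
        have "k' \<notin> S" using K(2)[of k'] k' by auto
        then show ?thesis using \<open>_ div _ div _ = _\<close> k' kK by (simp add: S_def not_less)
      qed
    qed
    moreover obtain e where e: "e \<in> {-1..1}" "(cell k x + i) div 2 ^ nat (K - k) = cell K x + e"
      using div_neighbour[OF k(2), of "2 ^ nat (K - k)" "cell k x"] cell_coarser[OF kK(1)] by (metis zero_less_numeral zero_less_power)
    ultimately have "1 \<le> d K (cell K x + e)" by (simp add: d_def)
    also have "\<dots> \<le> (\<Sum>i\<in>{-1..1}. d K (cell K x + i))"
      by (rule member_le_sum) (use e in auto)
    also have "\<dots> \<le> (\<Sum>k\<in>{m..n}. \<Sum>i\<in>{-1..1}. d k (cell k x + i))"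
      by (rule member_le_sum[of K "{m..n}" "\<lambda>k. \<Sum>i\<in>{-1..1}. d k (cell k x + i)"]) (use kK k in auto)
    finally show ?thesis using True by simp
  qed simp
  \<comment> \<open>the selected intervals are disjoint and contained in the level set\<close>
  have packed: "(\<Sum>k\<in>{m..n}. d k (cell k x)) \<le> indicator ?E x" for x
  proof (cases "\<exists>k\<in>{m..n}. top_cell k (cell k x)")
    case True
    then obtain k where k: "k \<in> {m..n}" "top_cell k (cell k x)" by auto
    have "x \<in> ?E" using cell_density_le_max[OF k(1), of 0 g x] k(2) by (auto simp: top_cell_def)
    have u: "\<not> top_cell k' (cell k' x)" if "k' \<in> {m..n}" "k' \<noteq> k" for k'
    proof
      assume t: "top_cell k' (cell k' x)"
      show False
      proof (cases "k < k'")
        case True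
        have "cell_density g k' (cell k x div 2 ^ nat (k' - k)) \<le> l"
          using k(2) that True by (auto simp: top_cell_def)
        then show False using t cell_coarser[of k k' x] True by (simp add: top_cell_def)
      next
        case False
        have "cell_density g k (cell k' x div 2 ^ nat (k - k')) \<le> l"
          using t that False k(1) by (auto simp: top_cell_def)
        then show False using k(2) cell_coarser[of k' k x] False by (simp add: top_cell_def)
      qed
    qed
    have "(\<Sum>k'\<in>{m..n}. d k' (cell k' x)) = (\<Sum>k'\<in>{m..n}. if k' = k then 1 else 0)"
      by (intro sum.cong) (use k u in \<open>auto simp: d_def\<close>)
    then show ?thesis using k(1) \<open>x \<in> ?E\<close> by simp
  next
    case False
    then have "(\<Sum>k\<in>{m..n}. d k (cell k x)) = 0" by (auto simp: d_def)
    then show ?thesis by simp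
  qed
  have each: "ennreal l * (\<integral>\<^sup>+x. d k (cell k x + i) \<partial>lebesgue) \<le> (\<integral>\<^sup>+x. d k (cell k x) * ennreal (g x) \<partial>lebesgue)" for k i
  proof -
    have "ennreal l * (\<integral>\<^sup>+x. d k (cell k x + i) \<partial>lebesgue) = ennreal l * (ennreal (2 powi k) * zsum (\<lambda>j. d k (j + i)))"
      by (subst nn_integral_step_const[of "\<lambda>j. d k (j + i)"]) rule
    also have "zsum (\<lambda>j. d k (j + i)) = zsum (d k)" by (rule zsum_shift)
    also have "ennreal l * (ennreal (2 powi k) * zsum (d k)) = ennreal (2 powi k * l) * zsum (d k)"
      using l by (simp add: ennreal_mult'' ac_simps)
    also have "\<dots> = zsum (\<lambda>j. d k j * ennreal (2 powi k * l))"
      unfolding zsum_cmult[symmetric] by (simp only: mult.commute)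
    also have "\<dots> \<le> zsum (\<lambda>j. d k j * (\<integral>\<^sup>+x\<in>dyadic_interval k j. ennreal (g x) \<partial>lebesgue))"
      unfolding cell_density_eq[OF g] by (intro nn_integral_mono) (auto simp: d_def top_cell_def intro!: ennreal_leI)
    also have "\<dots> = (\<integral>\<^sup>+x. d k (cell k x) * ennreal (g x) \<partial>lebesgue)"
      by (rule nn_integral_step[symmetric]) measurable
    finally show ?thesis .
  qed
  have "ennreal l * emeasure lebesgue ?E = ennreal l * (\<integral>\<^sup>+x. indicator ?E x \<partial>lebesgue)"
    using E by simp
  also have "\<dots> \<le> ennreal l * (\<integral>\<^sup>+x. (\<Sum>k\<in>{m..n}. \<Sum>i\<in>{-1..1}. d k (cell k x + i)) \<partial>lebesgue)"
    by (intro mult_left_mono nn_integral_mono cover) auto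
  also have "\<dots> = (\<Sum>k\<in>{m..n}. \<Sum>i\<in>{-1..1}. ennreal l * (\<integral>\<^sup>+x. d k (cell k x + i) \<partial>lebesgue))"
    by (simp add: nn_integral_sum measurable_step_borel[of "\<lambda>j. d _ (j + _)"] borel_measurable_sum sum_distrib_left)
  also have "\<dots> \<le> (\<Sum>k\<in>{m..n}. \<Sum>i\<in>{-1..1::int}. (\<integral>\<^sup>+x. d k (cell k x) * ennreal (g x) \<partial>lebesgue))"
    by (intro sum_mono each)
  also have "\<dots> = 3 * (\<Sum>k\<in>{m..n}. (\<integral>\<^sup>+x. d k (cell k x) * ennreal (g x) \<partial>lebesgue))"
    by (simp add: sum_distrib_left)
  also have "(\<Sum>k\<in>{m..n}. (\<integral>\<^sup>+x. d k (cell k x) * ennreal (g x) \<partial>lebesgue)) = (\<integral>\<^sup>+x. (\<Sum>k\<in>{m..n}. d k (cell k x) * ennreal (g x)) \<partial>lebesgue)"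
  proof -
    have [measurable]: "(\<lambda>x. d k (cell k x)) \<in> borel_measurable lebesgue" for k by (rule measurable_step_borel)
    show ?thesis by (rule nn_integral_sum[symmetric]) measurable
  qed
  also have "\<dots> \<le> (\<integral>\<^sup>+x. ennreal (g x) * indicator ?E x \<partial>lebesgue)"
  proof (intro nn_integral_mono)
    fix x
    show "(\<Sum>k\<in>{m..n}. d k (cell k x) * ennreal (g x)) \<le> ennreal (g x) * indicator ?E x"
      unfolding sum_distrib_right[symmetric] by (subst mult.commute) (intro mult_left_mono packed, simp)
  qed
  finally show ?thesis by (simp add: mult_left_mono)
qed

text \<open>
  Jensen's inequality, obtained by absorption: if \<open>c\<close> is the mean of
  \<open>g\<close> over the interval, then the integrals of \<open>c powr q\<close> and of
  \<open>g * c powr (q - 1)\<close> over it coincide.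
\<close>

lemma cell_density_powr:
  assumes g: "cell_finite g" "\<And>x. 0 \<le> g x" and [measurable]: "g \<in> borel_measurable lebesgue" and q: "1 < q"
  shows "ennreal (2 powi k * cell_density g k j powr q) \<le> (\<integral>\<^sup>+x\<in>dyadic_interval k j. ennreal (g x powr q) \<partial>lebesgue)"
proof -
  let ?Q = "dyadic_interval k j"
  define c where "c = cell_density g k j"
  have c: "0 \<le> c" by (simp add: c_def cell_density_nonneg)
  have I: "(\<integral>\<^sup>+x. ennreal ((c * indicator ?Q x) powr q) \<partial>lebesgue) = ennreal (2 powi k * c powr q)"
  proof -
    have "(\<integral>\<^sup>+x. ennreal ((c * indicator ?Q x) powr q) \<partial>lebesgue) = (\<integral>\<^sup>+x. ennreal (c powr q) * indicator ?Q x \<partial>lebesgue)"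
      by (intro nn_integral_cong) (auto simp: indicator_def)
    also have "\<dots> = ennreal (c powr q) * ennreal (2 powi k)"
      by (subst nn_integral_cmult_indicator) (auto simp: emeasure_dyadic)
    finally show ?thesis by (simp add: ennreal_mult' mult.commute)
  qed
  have J: "(\<integral>\<^sup>+x. ennreal ((g x * indicator ?Q x) * (c * indicator ?Q x) powr (q - 1)) \<partial>lebesgue) = ennreal (2 powi k * c powr q)"
  proof -
    have "(\<integral>\<^sup>+x. ennreal ((g x * indicator ?Q x) * (c * indicator ?Q x) powr (q - 1)) \<partial>lebesgue) = (\<integral>\<^sup>+x. ennreal (c powr (q - 1)) * (ennreal (g x) * indicator ?Q x) \<partial>lebesgue)"
      using g by (intro nn_integral_cong) (auto simp: indicator_def ennreal_mult'' mult.commute)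
    also have "\<dots> = ennreal (c powr (q - 1)) * ennreal (2 powi k * c)"
      by (subst nn_integral_cmult) (auto simp: cell_density_eq[OF g(1)] c_def)
    also have "\<dots> = ennreal (2 powi k * (c * c powr (q - 1)))" using c by (simp add: ennreal_mult'[symmetric] ac_simps)
    also have "c * c powr (q - 1) = c powr q" using c by (cases "c = 0") (auto simp: powr_diff)
    finally show ?thesis .
  qed
  have "(\<integral>\<^sup>+x. ennreal ((c * indicator ?Q x) powr q) \<partial>lebesgue) \<le> ennreal (1 powr q) * (\<integral>\<^sup>+x. ennreal ((g x * indicator ?Q x) powr q) \<partial>lebesgue)"
    by (rule Lq_absorb) (use c g q in \<open>auto simp: I J\<close>)
  also have "\<dots> = (\<integral>\<^sup>+x\<in>?Q. ennreal (g x powr q) \<partial>lebesgue)"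
    by simp (intro nn_integral_cong, auto simp: indicator_def)
  finally show ?thesis unfolding I unfolding c_def .
qed

text \<open>
  The maximum runs over finitely many densities, whose \<open>q\<close>-th moments are
  controlled by Jensen's inequality. That bound depends on the number of scales and only serves
  to establish finiteness; absorption then gives a constant that does not depend on the scales.
\<close>

theorem dyadic_max_strong_type:
  assumes mn: "m \<le> n" and g: "cell_finite g" "\<And>x. 0 \<le> g x" and [measurable]: "g \<in> borel_measurable lebesgue" and q: "1 < q"
  shows "(\<integral>\<^sup>+x. ennreal (dyadic_max m n g x powr q) \<partial>lebesgue) \<le> ennreal ((3 * q / (q - 1)) powr q) * (\<integral>\<^sup>+x. ennreal (g x powr q) \<partial>lebesgue)"
    and "(\<integral>\<^sup>+x. ennreal (g x powr q) \<partial>lebesgue) < top \<Longrightarrow> (\<integral>\<^sup>+x. ennreal (dyadic_max m n g x powr q) \<partial>lebesgue) < top"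
proof -
  let ?G = "\<integral>\<^sup>+x. ennreal (g x powr q) \<partial>lebesgue"
  have "(\<integral>\<^sup>+x. ennreal (dyadic_max m n g x powr q) \<partial>lebesgue) \<le> (\<integral>\<^sup>+x. (\<Sum>k\<in>{m..n}. \<Sum>i\<in>{-1..1}. ennreal (cell_density g k (cell k x + i) powr q)) \<partial>lebesgue)"
  proof (intro nn_integral_mono)
    fix x
    obtain k i where k: "k \<in> {m..n}" "i \<in> {-1..1}" "dyadic_max m n g x = cell_density g k (cell k x + i)" by (rule dyadic_max_attained[OF mn])
    have "ennreal (cell_density g k (cell k x + i) powr q) \<le> (\<Sum>i\<in>{-1..1}. ennreal (cell_density g k (cell k x + i) powr q))"
      by (rule member_le_sum[of i]) (use k in auto)
    also have "\<dots> \<le> (\<Sum>k\<in>{m..n}. \<Sum>i\<in>{-1..1}. ennreal (cell_density g k (cell k x + i) powr q))"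
      by (rule member_le_sum[of k]) (use k in auto)
    finally show "ennreal (dyadic_max m n g x powr q) \<le> (\<Sum>k\<in>{m..n}. \<Sum>i\<in>{-1..1}. ennreal (cell_density g k (cell k x + i) powr q))"
      by (simp only: k(3))
  qed
  also have "\<dots> = (\<Sum>k\<in>{m..n}. \<Sum>i\<in>{-1..1}. (\<integral>\<^sup>+x. ennreal (cell_density g k (cell k x + i) powr q) \<partial>lebesgue))"
    by (simp add: nn_integral_sum measurable_step_borel[of "\<lambda>j. ennreal (cell_density g _ (j + _) powr q)"] borel_measurable_sum del: sum_ennreal)
  also have "\<dots> \<le> (\<Sum>k\<in>{m..n}. \<Sum>i\<in>{-1..1::int}. ?G)"
  proof (intro sum_mono)
    fix k i :: int
    have "(\<integral>\<^sup>+x. ennreal (cell_density g k (cell k x + i) powr q) \<partial>lebesgue) = ennreal (2 powi k) * zsum (\<lambda>j. ennreal (cell_density g k (j + i) powr q))"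
      by (rule nn_integral_step_const)
    also have "zsum (\<lambda>j. ennreal (cell_density g k (j + i) powr q)) = zsum (\<lambda>j. ennreal (cell_density g k j powr q))"
      by (rule zsum_shift)
    also have "ennreal (2 powi k) * zsum (\<lambda>j. ennreal (cell_density g k j powr q)) = zsum (\<lambda>j. ennreal (2 powi k * cell_density g k j powr q))"
      by (simp add: zsum_cmult[symmetric] ennreal_mult')
    also have "\<dots> \<le> zsum (\<lambda>j. 1 * (\<integral>\<^sup>+x\<in>dyadic_interval k j. ennreal (g x powr q) \<partial>lebesgue))"
      unfolding mult_1 by (intro nn_integral_mono cell_density_powr g q) measurable
    also have "\<dots> = (\<integral>\<^sup>+x. 1 * ennreal (g x powr q) \<partial>lebesgue)"
      by (rule nn_integral_step[of _ "\<lambda>_. 1", symmetric]) measurable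
    finally show "(\<integral>\<^sup>+x. ennreal (cell_density g k (cell k x + i) powr q) \<partial>lebesgue) \<le> ?G" by simp
  qed
  also have "\<dots> = of_nat (card {m..n} * card {-1..1::int}) * ?G" by (simp add: mult.assoc)
  finally have b: "(\<integral>\<^sup>+x. ennreal (dyadic_max m n g x powr q) \<partial>lebesgue) \<le> of_nat (card {m..n} * card {-1..1::int}) * ?G" .
  show fin: "(\<integral>\<^sup>+x. ennreal (dyadic_max m n g x powr q) \<partial>lebesgue) < top" if "?G < top"
    by (rule order.strict_trans1[OF b]) (use that in \<open>simp add: ennreal_mult_less_top of_nat_less_top del: of_nat_mult\<close>)
  show "(\<integral>\<^sup>+x. ennreal (dyadic_max m n g x powr q) \<partial>lebesgue) \<le> ennreal ((3 * q / (q - 1)) powr q) * ?G"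
  proof (cases "?G < top")
    case True
    show ?thesis
      by (intro Lq_absorb weak_to_strong dyadic_max_weak_type dyadic_max_nonneg fin True mn g q) (use q in auto)
  next
    case False
    then have "?G = top" using less_top[of ?G] by blast
    then show ?thesis using q by (simp add: ennreal_mult_top)
  qed
qed

section \<open>Powers of the majorant\<close>

lemma energy_cell:
  assumes "cell_finite (\<lambda>x. (norm (f x))\<^sup>2)"
  shows "energy f (dyadic_interval k j) = ennreal (2 powi k * cell_density (\<lambda>x. (norm (f x))\<^sup>2) k j)"
  unfolding energy_def by (rule cell_density_eq[OF assms])

lemma mean_le_density:
  assumes "f \<in> borel_measurable lebesgue" "cell_finite (\<lambda>x. (norm (f x))\<^sup>2)"
  shows "(norm (mean f k j))\<^sup>2 \<le> cell_density (\<lambda>x. (norm (f x))\<^sup>2) k j"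
proof -
  have "2 powi k * (norm (mean f k j))\<^sup>2 \<le> 2 powi k * cell_density (\<lambda>x. (norm (f x))\<^sup>2) k j"
    using mean_energy[OF assms(1), of k j] unfolding energy_cell[OF assms(2)]
    by (simp add: cell_density_nonneg)
  then show ?thesis by simp
qed

lemma osc_le_density:
  assumes "f \<in> borel_measurable lebesgue" "L1_loc f" "cell_finite (\<lambda>x. (norm (f x))\<^sup>2)"
  shows "(osc f k j)\<^sup>2 / (2 powi k)\<^sup>2 \<le> 4 * cell_density (\<lambda>x. (norm (f x))\<^sup>2) k j"
proof -
  have "ennreal ((osc f k j)\<^sup>2) \<le> ennreal (4 * 2 powi k * (2 powi k * cell_density (\<lambda>x. (norm (f x))\<^sup>2) k j))"
    using osc_energy[OF assms(1,2), of k j] unfolding energy_cell[OF assms(3)]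
    by (simp add: ennreal_mult'[symmetric])
  then have "(osc f k j)\<^sup>2 \<le> 4 * 2 powi k * (2 powi k * cell_density (\<lambda>x. (norm (f x))\<^sup>2) k j)"
    by (simp add: cell_density_nonneg)
  then show ?thesis by (simp add: field_simps power2_eq_square)
qed

text \<open>
  Used only qualitatively: a sum of finitely many majorants inherits a finite
  \<open>q\<close>-th moment from the maximal function. With all densities at most
  \<open>D\<close>, each of the five terms of the majorant is at most \<open>4 * D\<close>, and
  the factor \<open>3\<close> in front gives \<open>60\<close>.
\<close>

lemma majorant_le_dyadic_max:
  assumes f: "f \<in> borel_measurable lebesgue" "L1_loc f" "cell_finite (\<lambda>x. (norm (f x))\<^sup>2)" and k: "k \<in> {m..n}"
  shows "majorant f k (cell k x) \<le> 60 * dyadic_max m n (\<lambda>x. (norm (f x))\<^sup>2) x"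
proof -
  define D where "D = dyadic_max m n (\<lambda>x. (norm (f x))\<^sup>2) x"
  define j where "j = cell k x"
  have d: "cell_density (\<lambda>x. (norm (f x))\<^sup>2) k (j + i) \<le> D" if "i \<in> {-1..1}" for i
    unfolding D_def j_def by (rule cell_density_le_max[OF k that])
  have m: "(norm (mean f k (j + i)))\<^sup>2 \<le> D" if "i \<in> {-1..1}" for i
    using mean_le_density[OF f(1,3), of k "j + i"] d[OF that] by linarith
  have o: "(osc f k (j + i))\<^sup>2 / (2 powi k)\<^sup>2 \<le> 4 * D" if "i \<in> {-1..1}" for i
    using osc_le_density[OF f, of k "j + i"] d[OF that] by linarith
  have s: "(norm (mean f k (j + i) - mean f k (j + i')))\<^sup>2 \<le> 4 * D" if "i \<in> {-1..1}" "i' \<in> {-1..1}" for i i'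
  proof -
    have "(norm (mean f k (j + i) - mean f k (j + i')))\<^sup>2 \<le> (norm (mean f k (j + i)) + norm (mean f k (j + i')))\<^sup>2"
      by (intro power_mono norm_triangle_ineq4) auto
    also have "\<dots> \<le> 2 * (norm (mean f k (j + i)))\<^sup>2 + 2 * (norm (mean f k (j + i')))\<^sup>2" by (rule sq_sum_le2)
    finally show ?thesis using m[OF that(1)] m[OF that(2)] by linarith
  qed
  have "majorant f k j = 3 * ((osc f k (j + -1))\<^sup>2 / (2 powi k)\<^sup>2 + (osc f k (j + 0))\<^sup>2 / (2 powi k)\<^sup>2 + (osc f k (j + 1))\<^sup>2 / (2 powi k)\<^sup>2
     + (norm (mean f k (j + 1) - mean f k (j + 0)))\<^sup>2 + (norm (mean f k (j + 0) - mean f k (j + -1)))\<^sup>2)"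
    by (simp add: majorant_def add_divide_distrib)
  also have "\<dots> \<le> 3 * (4 * D + 4 * D + 4 * D + 4 * D + 4 * D)"
    by (intro mult_left_mono add_mono o s) auto
  finally show ?thesis by (simp add: D_def j_def)
qed

lemma energy_triple:
  assumes g: "cell_finite (\<lambda>x. (norm (f x))\<^sup>2)" and [measurable]: "f \<in> borel_measurable lebesgue"
  shows "energy f (triple k j) \<le> ennreal (3 * (2 powi k * near_density (\<lambda>x. (norm (f x))\<^sup>2) k j))"
proof -
  let ?g = "\<lambda>x. (norm (f x))\<^sup>2"
  have ind: "indicator (triple k j) x \<le> (\<Sum>i\<in>{-1..1}. indicator (dyadic_interval k (j + i)) x :: ennreal)" for x
  proof (cases "x \<in> triple k j")
    case True
    define d where "d = (2::real) powi k"
    have d: "d > 0" by (simp add: d_def)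
    have x: "(of_int j - 1) * d \<le> x" "x < (of_int j + 2) * d" using True by (auto simp: triple_def d_def)
    then have "of_int (j - 1) \<le> x / d" "x / d < of_int (j + 2)" using d by (simp_all add: field_simps)
    then have c: "j - 1 \<le> cell k x" "cell k x < j + 2" unfolding d_def by (simp_all add: le_floor_iff floor_less_iff)
    have "1 = (indicator (dyadic_interval k (j + (cell k x - j))) x :: ennreal)"
      by (simp add: mem_dyadic_interval_iff)
    also have "\<dots> \<le> (\<Sum>i\<in>{-1..1}. indicator (dyadic_interval k (j + i)) x :: ennreal)"
      by (rule member_le_sum[of "cell k x - j"]) (use c in auto)
    finally show ?thesis using True by simp
  qed simp
  have "energy f (triple k j) \<le> (\<integral>\<^sup>+x. (\<Sum>i\<in>{-1..1}. ennreal (?g x) * indicator (dyadic_interval k (j + i)) x) \<partial>lebesgue)"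
    unfolding energy_def sum_distrib_left[symmetric] by (intro nn_integral_mono mult_left_mono ind) auto
  also have "\<dots> = (\<Sum>i\<in>{-1..1}. \<integral>\<^sup>+x. ennreal (?g x) * indicator (dyadic_interval k (j + i)) x \<partial>lebesgue)"
    by (rule nn_integral_sum) measurable
  also have "\<dots> = (\<Sum>i\<in>{-1..1}. ennreal (2 powi k * cell_density ?g k (j + i)))"
    by (simp only: cell_density_eq[OF g])
  also have "\<dots> \<le> (\<Sum>i\<in>{-1..1::int}. ennreal (2 powi k * near_density ?g k j))"
    by (intro sum_mono ennreal_leI mult_left_mono cell_density_le_near) auto
  also have "\<dots> = ennreal (3 * (2 powi k * near_density ?g k j))"
    by (simp add: ennreal_mult')
  finally show ?thesis .
qed

text \<open>
  The three factors are the losses in Garsia's inequality, in the local bound (\<open>1197 = 3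
  \<cdot> 399\<close>) and in the maximal inequality.
\<close>

definition Lq_const :: "real \<Rightarrow> real" where
  "Lq_const q = q powr q * (1197 powr q * (3 * q / (q - 1)) powr q)"

lemma Lq_const_pos: "1 < q \<Longrightarrow> 0 < Lq_const q"
  by (simp add: Lq_const_def)

text \<open>
  Garsia's inequality applies with \<open>Z\<close> a multiple of the maximal function of the
  square of \<open>\<bar>f\<bar>\<close>: the local bound says that the majorants of scales up
  to \<open>l\<close> integrate over an interval of scale \<open>l\<close> to at most the energy
  of its triple, and this is dominated by the integral of the maximal function over the
  interval. The bound is uniform in the range of scales.
\<close>

theorem majorant_Lq:
  assumes mn: "m \<le> n" and [measurable]: "f \<in> borel_measurable lebesgue" and l: "L1_loc f" and g: "cell_finite (\<lambda>x. (norm (f x))\<^sup>2)" and q: "1 < q"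
    and fin: "(\<integral>\<^sup>+x. ennreal (((norm (f x))\<^sup>2) powr q) \<partial>lebesgue) < top"
  shows "(\<integral>\<^sup>+x. ennreal ((\<Sum>k\<in>{m..n}. majorant f k (cell k x)) powr q) \<partial>lebesgue)
    \<le> ennreal (Lq_const q) * (\<integral>\<^sup>+x. ennreal (((norm (f x))\<^sup>2) powr q) \<partial>lebesgue)"
proof -
  let ?g = "\<lambda>x. (norm (f x))\<^sup>2" let ?D = "dyadic_max m n ?g"
  let ?A = "\<lambda>x. \<Sum>k\<in>{m..n}. majorant f k (cell k x)"
  have A_meas [measurable]: "?A \<in> borel_measurable lebesgue"
    by (intro borel_measurable_sum measurable_step_borel)
  have A_nn: "0 \<le> ?A x" for x by (intro sum_nonneg majorant_nonneg)
  have D_nn: "0 \<le> ?D x" for x by (rule dyadic_max_nonneg[OF mn])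
  have D_fin: "(\<integral>\<^sup>+x. ennreal (?D x powr q) \<partial>lebesgue) < top"
    by (rule dyadic_max_strong_type(2)) (use mn g q fin in auto)
  have A_fin: "(\<integral>\<^sup>+x. ennreal (?A x powr q) \<partial>lebesgue) < top"
  proof -
    define c where "c = real (card {m..n}) * 60"
    have "?A x \<le> c * ?D x" for x
    proof -
      have "?A x \<le> (\<Sum>k\<in>{m..n}. 60 * ?D x)" by (intro sum_mono majorant_le_dyadic_max l g) auto
      then show ?thesis by (simp add: c_def)
    qed
    then have "?A x powr q \<le> c powr q * ?D x powr q" for x
      using powr_mono2[of q "?A x" "c * ?D x"] q A_nn[of x] D_nn[of x] by (simp add: powr_mult c_def)
    then have "(\<integral>\<^sup>+x. ennreal (?A x powr q) \<partial>lebesgue) \<le> (\<integral>\<^sup>+x. ennreal (c powr q) * ennreal (?D x powr q) \<partial>lebesgue)"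
      by (intro nn_integral_mono) (simp add: ennreal_mult'[symmetric] ennreal_leI)
    also have "\<dots> = ennreal (c powr q) * (\<integral>\<^sup>+x. ennreal (?D x powr q) \<partial>lebesgue)"
      by (rule nn_integral_cmult) measurable
    also have "\<dots> < top" using D_fin by (simp add: ennreal_mult_less_top)
    finally show ?thesis .
  qed
  have loc: "(\<integral>\<^sup>+x\<in>dyadic_interval l j. ennreal (\<Sum>k\<in>{m..l}. majorant f k (cell k x)) \<partial>lebesgue)
      \<le> (\<integral>\<^sup>+x\<in>dyadic_interval l j. ennreal (1197 * ?D x) \<partial>lebesgue)" if "l \<in> {m..n}" for l j
  proof -
    have near: "0 \<le> near_density ?g l j"
      by (rule order_trans[OF cell_density_nonneg cell_density_le_near[of 0]]) simp
    have "(\<integral>\<^sup>+x\<in>dyadic_interval l j. ennreal (\<Sum>k\<in>{m..l}. majorant f k (cell k x)) \<partial>lebesgue) \<le> 399 * energy f (triple l j)"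
      by (rule majorant_local) (use \<open>L1_loc f\<close> in auto)
    also have "\<dots> \<le> 399 * ennreal (3 * (2 powi l * near_density ?g l j))"
      by (intro mult_left_mono energy_triple g) auto
    also have "\<dots> = ennreal (1197 * near_density ?g l j) * ennreal (2 powi l)"
      using near ennreal_mult'[of 399 "3 * (2 powi l * near_density ?g l j)"] ennreal_mult''[of "2 powi l" "1197 * near_density ?g l j"]
      by (simp add: mult.commute mult.left_commute)
    also have "\<dots> = (\<integral>\<^sup>+x\<in>dyadic_interval l j. ennreal (1197 * near_density ?g l j) \<partial>lebesgue)"
      by (subst nn_integral_cmult_indicator) (auto simp: emeasure_dyadic)
    also have "\<dots> \<le> (\<integral>\<^sup>+x\<in>dyadic_interval l j. ennreal (1197 * ?D x) \<partial>lebesgue)"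
    proof (intro nn_integral_mono)
      fix x
      show "ennreal (1197 * near_density ?g l j) * indicator (dyadic_interval l j) x \<le> ennreal (1197 * ?D x) * indicator (dyadic_interval l j) x"
        using near_density_le_max[OF that, of ?g x] by (auto simp: indicator_def mem_dyadic_interval_iff intro!: ennreal_leI)
    qed
    finally show ?thesis .
  qed
  have "(\<integral>\<^sup>+x. ennreal (?A x powr q) \<partial>lebesgue) \<le> ennreal (q powr q) * (\<integral>\<^sup>+x. ennreal ((1197 * ?D x) powr q) \<partial>lebesgue)"
  proof (rule Lq_absorb[OF A_meas _ A_nn _ q _ _ A_fin])
    show "(\<integral>\<^sup>+x. ennreal (?A x powr q) \<partial>lebesgue) \<le> ennreal q * (\<integral>\<^sup>+x. ennreal (1197 * ?D x * ?A x powr (q - 1)) \<partial>lebesgue)"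
      by (rule Garsia[OF mn q]) (use majorant_nonneg D_nn loc in auto)
  qed (use q D_nn in auto)
  also have "(\<integral>\<^sup>+x. ennreal ((1197 * ?D x) powr q) \<partial>lebesgue) = ennreal (1197 powr q) * (\<integral>\<^sup>+x. ennreal (?D x powr q) \<partial>lebesgue)"
    by (simp add: powr_mult D_nn ennreal_mult' nn_integral_cmult)
  also have "ennreal (q powr q) * (ennreal (1197 powr q) * (\<integral>\<^sup>+x. ennreal (?D x powr q) \<partial>lebesgue))
     \<le> ennreal (q powr q) * (ennreal (1197 powr q) * (ennreal ((3 * q / (q - 1)) powr q) * (\<integral>\<^sup>+x. ennreal (?g x powr q) \<partial>lebesgue)))"
    by (intro mult_left_mono dyadic_max_strong_type(1) mn g q) auto
  also have "\<dots> = ennreal (Lq_const q) * (\<integral>\<^sup>+x. ennreal (?g x powr q) \<partial>lebesgue)"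
    unfolding mult.assoc[symmetric] by (simp add: Lq_const_def ennreal_mult'[symmetric] mult.assoc)
  finally show ?thesis .
qed

section \<open>Real powers of extended nonnegative numbers\<close>

lemma ennreal_powr_real: "0 \<le> r \<Longrightarrow> ennreal_powr (ennreal r) a = ennreal (r powr a)"
  by (simp add: ennreal_powr_def)

lemma ennreal_powr_powr: "ennreal_powr (ennreal_powr t a) b = ennreal_powr t (a * b)"
  by (simp add: ennreal_powr_def powr_powr)

lemma ennreal_powr_1: "ennreal_powr t 1 = t"
  by (cases t rule: ennreal_cases) (auto simp: ennreal_powr_def)

lemma ennreal_powr_mult: "0 < c \<Longrightarrow> ennreal_powr (ennreal c * t) a = ennreal (c powr a) * ennreal_powr t a"
  by (cases t rule: ennreal_cases) (auto simp: ennreal_powr_def ennreal_mult_top powr_mult ennreal_mult'[symmetric])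

lemma ennreal_powr_measurable [measurable]:
  assumes [measurable]: "h \<in> borel_measurable M" shows "(\<lambda>x. ennreal_powr (h x) a) \<in> borel_measurable M"
  unfolding ennreal_powr_def by measurable

text \<open>
  A real power with positive exponent is an order isomorphism, with the reciprocal power as its
  inverse.
\<close>

lemma ennreal_powr_SUP:
  fixes t :: "nat \<Rightarrow> ennreal"
  assumes "0 < a" shows "ennreal_powr (SUP i. t i) a = (SUP i. ennreal_powr (t i) a)"
proof (rule antisym)
  let ?y = "SUP i. ennreal_powr (t i) a"
  have "t i \<le> ennreal_powr ?y (1/a)" for i
  proof -
    have "t i = ennreal_powr (ennreal_powr (t i) a) (1/a)"
      unfolding ennreal_powr_powr using assms by (simp add: ennreal_powr_1)
    also have "\<dots> \<le> ennreal_powr ?y (1/a)"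
      using assms by (intro ennreal_powr_mono SUP_upper) auto
    finally show ?thesis .
  qed
  then have "ennreal_powr (SUP i. t i) a \<le> ennreal_powr (ennreal_powr ?y (1/a)) a"
    using assms by (intro ennreal_powr_mono SUP_least) auto
  also have "\<dots> = ?y" unfolding ennreal_powr_powr using assms by (simp add: ennreal_powr_1)
  finally show "ennreal_powr (SUP i. t i) a \<le> ?y" .
  show "?y \<le> ennreal_powr (SUP i. t i) a"
    using assms by (intro SUP_least ennreal_powr_mono SUP_upper) auto
qed

section \<open>The square function as a monotone limit\<close>

lemma infsum_int_eq_SUP:
  fixes h :: "int \<Rightarrow> ennreal"
  shows "(\<Sum>\<^sub>\<infinity>k\<in>UNIV. h k) = (SUP N::nat. \<Sum>k\<in>{-int N..int N}. h k)"
proof (rule antisym)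
  have e: "(\<Sum>\<^sub>\<infinity>k\<in>UNIV. h k) = (SUP F\<in>{F. finite F \<and> F \<subseteq> UNIV}. sum h F)"
    by (rule nonneg_infsum_complete) simp
  show "(\<Sum>\<^sub>\<infinity>k\<in>UNIV. h k) \<le> (SUP N::nat. \<Sum>k\<in>{-int N..int N}. h k)"
    unfolding e
  proof (rule SUP_least)
    fix F :: "int set" assume "F \<in> {F. finite F \<and> F \<subseteq> UNIV}"
    then have F: "finite F" by simp
    \<comment> \<open>\<open>0\<close> is inserted since \<open>F\<close> may be empty\<close>
    define N where "N = nat (Max (insert 0 (abs ` F)))"
    have "\<bar>x\<bar> \<le> int N" if "x \<in> F" for x
    proof -
      have "\<bar>x\<bar> \<le> Max (insert 0 (abs ` F))" using F that by (intro Max_ge) auto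
      moreover have "0 \<le> Max (insert 0 (abs ` F))" using F by (intro Max_ge) auto
      ultimately show ?thesis unfolding N_def by simp
    qed
    then have "F \<subseteq> {-int N..int N}" by (auto simp: abs_le_iff) (smt (verit))+
    then have "sum h F \<le> sum h {-int N..int N}" by (intro sum_mono2) auto
    also have "\<dots> \<le> (SUP N::nat. \<Sum>k\<in>{-int N..int N}. h k)" by (rule SUP_upper) simp
    finally show "sum h F \<le> (SUP N::nat. \<Sum>k\<in>{-int N..int N}. h k)" .
  qed
  show "(SUP N::nat. \<Sum>k\<in>{-int N..int N}. h k) \<le> (\<Sum>\<^sub>\<infinity>k\<in>UNIV. h k)"
    unfolding e by (intro SUP_least SUP_upper) auto
qed

text \<open>
  Truncation to finitely many scales keeps all quantities finite, as the absorption arguments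
  require.
\<close>

definition sq_partial :: "(real \<Rightarrow> complex) \<Rightarrow> nat \<Rightarrow> real \<Rightarrow> real" where
  "sq_partial f N x = (\<Sum>k\<in>{-int N..int N}. (wobble f k x)\<^sup>2)"

lemma sq_partial_nonneg: "0 \<le> sq_partial f N x" unfolding sq_partial_def by (intro sum_nonneg) auto

lemma sq_partial_mono: "N \<le> N' \<Longrightarrow> sq_partial f N x \<le> sq_partial f N' x"
  unfolding sq_partial_def by (intro sum_mono2) auto

lemma sq_partial_le_majorant: "L1_loc f \<Longrightarrow> sq_partial f N x \<le> (\<Sum>k\<in>{-int N..int N}. majorant f k (cell k x))"
  unfolding sq_partial_def by (intro sum_mono wobble_le_majorant)

lemma sq_fun_eq:
  assumes "L1_loc f" "f \<in> borel_measurable lebesgue"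
  shows "sq_fun f x = ennreal_powr (SUP N. ennreal (sq_partial f N x)) (1/2)"
  unfolding sq_fun_def SUP_intervals_eq_wobble[OF assms] infsum_int_eq_SUP sq_partial_def
  by (simp add: sum_ennreal)

section \<open>Measurability of the square function\<close>

lemma seg_integral_closed:
  assumes "f \<in> borel_measurable lebesgue" "a \<le> t"
  shows "seg_integral f a t = set_lebesgue_integral lebesgue {a..t} f"
proof (cases "a = t")
  case False
  then have "a < t" using assms(2) by simp
  have "avg {a..t} f = avg {a..<a + (t - a)} f"
    by (rule avg_interval[OF assms(1)]) (use \<open>a < t\<close> in \<open>auto simp: greaterThanLessThan_subseteq_atLeastAtMost_iff\<close>)
  then show ?thesis using \<open>a < t\<close> by (simp add: avg_def seg_integral_def)
next
  case True
  have "AE x in lebesgue. x \<notin> {t}"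
    by (intro AE_not_in null_sets_completionI) (simp add: finite_imp_null_set_lborel)
  then have "set_lebesgue_integral lebesgue {t..t} f = 0"
    unfolding set_lebesgue_integral_def by (intro integral_eq_zero_AE) (auto elim!: eventually_mono)
  then show ?thesis unfolding True by (simp add: seg_integral_def set_lebesgue_integral_def)
qed

lemma isCont_seg_integral:
  assumes [measurable]: "f \<in> borel_measurable lebesgue" and l: "L1_loc f" and "a < t"
  shows "isCont (seg_integral f a) t"
proof -
  have abs: "f absolutely_integrable_on {a..u}" if "u \<le> t + 1" for u
  proof -
    have "set_integrable lebesgue {a..<t+2} f" using l by (simp add: L1_loc_def)
    then show ?thesis by (rule set_integrable_subset) (use that in auto)
  qed
  have "f integrable_on {a..t+1}"
    using set_lebesgue_integral_eq_integral(1)[OF abs[of "t+1"]] by simp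
  then have "continuous_on {a..t+1} (\<lambda>u. integral {a..u} f)"
    by (rule indefinite_integral_continuous_1)
  moreover have "integral {a..u} f = seg_integral f a u" if "u \<in> {a..t+1}" for u
    using that set_lebesgue_integral_eq_integral(2)[OF abs[of u]] by (simp add: seg_integral_closed)
  ultimately have "continuous_on {a..t+1} (seg_integral f a)" by (metis (no_types, lifting) continuous_on_cong)
  then have "continuous_on {a<..<t+1} (seg_integral f a)" by (rule continuous_on_subset) auto
  then show ?thesis using \<open>a < t\<close> by (simp add: continuous_on_eq_continuous_at)
qed

lemma continuous_slide:
  assumes f: "f \<in> borel_measurable lebesgue" "L1_loc f" and d: "0 \<le> d"
  shows "continuous_on UNIV (\<lambda>s. seg_integral f s (s + d))"
proof (rule continuous_at_imp_continuous_on, rule ballI)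
  fix s :: real
  define a where "a = s - 1"
  have "isCont (\<lambda>u. seg_integral f a (u + d)) s"
    by (rule isCont_o2[of s "\<lambda>u. u + d" "seg_integral f a"]) (use d in \<open>auto intro!: isCont_seg_integral f continuous_intros simp: a_def\<close>)
  moreover have "isCont (seg_integral f a) s" by (rule isCont_seg_integral[OF f]) (simp add: a_def)
  ultimately have c: "isCont (\<lambda>u. seg_integral f a (u + d) - seg_integral f a u) s" by (intro continuous_intros)
  have "\<forall>\<^sub>F u in nhds s. u \<in> {a<..}" by (rule eventually_nhds_in_open) (auto simp: a_def)
  then have "\<forall>\<^sub>F u in nhds s. seg_integral f u (u + d) = seg_integral f a (u + d) - seg_integral f a u"
  proof eventually_elim
    case (elim u)
    then show ?case using seg_integral_split[OF f(2), of a u "u + d"] d by simp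
  qed
  then show "isCont (\<lambda>s. seg_integral f s (s + d)) s" using c by (simp add: isCont_cong)
qed

text \<open>
  The average over a sliding interval depends continuously on the interval, so a countable dense
  set of offsets suffices; this is the source of measurability.
\<close>

lemma wobble_rational:
  assumes f: "f \<in> borel_measurable lebesgue" "L1_loc f"
  shows "ennreal (wobble f k x) = (SUP a\<in>{- (2 powi k)<..<0} \<inter> \<rat>. ennreal (norm (avg {x + a..<x + a + 2 powi k} f - mean f k (cell k x))))"
    (is "_ = (SUP a\<in>?R. ennreal (?h a))")
proof (rule antisym)
  have "continuous_on UNIV (\<lambda>a. seg_integral f (x + a) (x + a + 2 powi k))"
    by (rule continuous_on_compose2[OF continuous_slide[OF f, of "2 powi k"], of UNIV "\<lambda>a. x + a"]) (auto intro!: continuous_intros)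
  then have cont: "continuous_on UNIV ?h" unfolding slide_eq by (intro continuous_intros)
  show "(SUP a\<in>?R. ennreal (?h a)) \<le> ennreal (wobble f k x)"
    by (intro SUP_least ennreal_leI slide_le_wobble f) auto
  show "ennreal (wobble f k x) \<le> (SUP a\<in>?R. ennreal (?h a))"
  proof (cases "(SUP a\<in>?R. ennreal (?h a))" rule: ennreal_cases)
    case (real c)
    have R: "?R \<subseteq> {a. ?h a \<le> c}"
    proof
      fix a assume a: "a \<in> ?R"
      have "ennreal (?h a) \<le> ennreal c" unfolding real(2)[symmetric] by (rule SUP_upper[OF a])
      then show "a \<in> {a. ?h a \<le> c}" using real(1) by simp
    qed
    have "closed {a. ?h a \<le> c}" by (rule closed_Collect_le[OF cont]) (rule continuous_on_const)
    then have "closure ?R \<subseteq> {a. ?h a \<le> c}" by (rule closure_minimal[OF R])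
    moreover have "{- (2 powi k)<..<0} \<subseteq> closure ?R"
      using open_Int_closure_subset[of "{- (2 powi k)<..<(0::real)}" \<rat>] by (simp add: Rats_closure_real)
    then have "closure {- (2 powi k)<..<0} \<subseteq> closure ?R" by (metis closure_closure closure_mono)
    then have "{- (2 powi k)..0} \<subseteq> closure ?R" by (simp add: closure_greaterThanLessThan)
    ultimately have "wobble f k x \<le> c" by (intro wobble_le) blast
    then show ?thesis unfolding real(2) by (rule ennreal_leI)
  next
    case top then show ?thesis by (simp only: top_greatest)
  qed
qed

lemma wobble_measurable:
  assumes f: "f \<in> borel_measurable lebesgue" "L1_loc f"
  shows "wobble f k \<in> borel_measurable lebesgue"
proof -
  have "(\<lambda>x. ennreal (wobble f k x)) \<in> borel_measurable lebesgue"
    unfolding wobble_rational[OF f]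
  proof (rule borel_measurable_SUP)
    show "countable ({- (2 powi k)<..<0} \<inter> (\<rat> :: real set))" using countable_rat by (rule countable_subset[rotated]) auto
    fix a :: real
    have "continuous_on UNIV (\<lambda>x. seg_integral f (x + a) (x + a + 2 powi k))"
      by (rule continuous_on_compose2[OF continuous_slide[OF f, of "2 powi k"], of UNIV "\<lambda>x. x + a"]) (auto intro!: continuous_intros)
    then have "(\<lambda>x. seg_integral f (x + a) (x + a + 2 powi k)) \<in> borel_measurable borel"
      by (rule borel_measurable_continuous_onI)
    then have [measurable]: "(\<lambda>x. seg_integral f (x + a) (x + a + 2 powi k)) \<in> borel_measurable lebesgue"
      by (intro measurable_completion) simp
    have [measurable]: "(\<lambda>x. mean f k (cell k x)) \<in> borel_measurable lebesgue" by (rule measurable_step_borel)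
    show "(\<lambda>x. ennreal (norm (avg {x + a..<x + a + 2 powi k} f - mean f k (cell k x)))) \<in> borel_measurable lebesgue"
      unfolding slide_eq by measurable
  qed
  then have "(\<lambda>x. enn2real (ennreal (wobble f k x))) \<in> borel_measurable lebesgue" by measurable
  then show ?thesis by (simp add: wobble_nonneg[OF f(2)])
qed

lemma sq_partial_measurable:
  assumes f: "f \<in> borel_measurable lebesgue" "L1_loc f"
  shows "sq_partial f N \<in> borel_measurable lebesgue"
  unfolding sq_partial_def[abs_def] by (intro borel_measurable_sum borel_measurable_power wobble_measurable f)

lemma sq_fun_measurable:
  assumes f: "f \<in> borel_measurable lebesgue" "L1_loc f"
  shows "sq_fun f \<in> borel_measurable lebesgue"
proof -
  note [measurable] = sq_partial_measurable[OF f]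
  show ?thesis unfolding sq_fun_eq[OF f(2,1), abs_def] by measurable
qed

section \<open>Boundedness on Lp\<close>

lemma nn_integral_finite_on:
  assumes [measurable]: "u \<in> borel_measurable lebesgue" "A \<in> sets lebesgue"
    and h: "\<And>x. h x \<le> 1 + u x" and u: "\<And>x. 0 \<le> u x" "(\<integral>\<^sup>+x. ennreal (u x) \<partial>lebesgue) < top" and A: "emeasure lebesgue A < top"
  shows "(\<integral>\<^sup>+x\<in>A. ennreal (h x) \<partial>lebesgue) < top"
proof -
  have "(\<integral>\<^sup>+x\<in>A. ennreal (h x) \<partial>lebesgue) \<le> (\<integral>\<^sup>+x. indicator A x + ennreal (u x) \<partial>lebesgue)"
  proof (intro nn_integral_mono)
    fix x
    have "ennreal (h x) \<le> 1 + ennreal (u x)" using ennreal_leI[OF h[of x]] u(1)[of x] by simp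
    then show "ennreal (h x) * indicator A x \<le> indicator A x + ennreal (u x)" by (auto simp: indicator_def)
  qed
  also have "\<dots> = emeasure lebesgue A + (\<integral>\<^sup>+x. ennreal (u x) \<partial>lebesgue)" by (subst nn_integral_add) auto
  also have "\<dots> < top" using A u(2) by simp
  finally show ?thesis .
qed

lemma set_integrable_nn:
  fixes f :: "real \<Rightarrow> 'a::{banach, second_countable_topology}"
  assumes [measurable]: "f \<in> borel_measurable lebesgue" "A \<in> sets lebesgue"
    and "(\<integral>\<^sup>+x\<in>A. ennreal (norm (f x)) \<partial>lebesgue) < top"
  shows "set_integrable lebesgue A f"
  unfolding set_integrable_def
proof (rule integrableI_bounded)
  have "(\<integral>\<^sup>+x. ennreal (norm (indicator A x *\<^sub>R f x)) \<partial>lebesgue) = (\<integral>\<^sup>+x\<in>A. ennreal (norm (f x)) \<partial>lebesgue)"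
    by (intro nn_integral_cong) (auto simp: indicator_def)
  then show "(\<integral>\<^sup>+x. ennreal (norm (indicator A x *\<^sub>R f x)) \<partial>lebesgue) < \<infinity>" using assms(3) by simp
qed measurable

lemma powr_dominates: assumes "2 \<le> p" "0 \<le> (t::real)" shows "t\<^sup>2 \<le> 1 + t powr p" "t \<le> 1 + t powr p"
proof -
  have "t \<le> 1 + t powr p \<and> t\<^sup>2 \<le> 1 + t powr p"
  proof (cases "t \<le> 1")
    case True
    then show ?thesis using assms(2) power_le_one[of t 2] powr_ge_zero[of t p] by linarith
  next
    case False
    have "t powr 2 \<le> t powr p" "t powr 1 \<le> t powr p" using assms False by (intro powr_mono; simp)+
    then show ?thesis using False by (simp add: powr_numeral)
  qed
  then show "t\<^sup>2 \<le> 1 + t powr p" "t \<le> 1 + t powr p" by auto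
qed

lemma Lp_local:
  assumes [measurable]: "f \<in> borel_measurable lebesgue" and p: "2 \<le> p"
    and fin: "(\<integral>\<^sup>+x. ennreal (norm (f x) powr p) \<partial>lebesgue) < top"
  shows "L1_loc f" "cell_finite (\<lambda>x. (norm (f x))\<^sup>2)"
proof -
  show "L1_loc f" unfolding L1_loc_def
  proof (intro allI)
    fix a b
    show "set_integrable lebesgue {a..<b} f"
    proof (rule set_integrable_nn)
      \<comment> \<open>the interval is empty if \<open>b < a\<close>\<close>
      have fin_ab: "emeasure lebesgue {a..<b} < top" by (cases "a \<le> b") auto
      show "(\<integral>\<^sup>+x\<in>{a..<b}. ennreal (norm (f x)) \<partial>lebesgue) < top"
        by (rule nn_integral_finite_on[where u="\<lambda>x. norm (f x) powr p"]) (use powr_dominates[OF p] fin fin_ab in auto)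
    qed auto
  qed
  show "cell_finite (\<lambda>x. (norm (f x))\<^sup>2)" unfolding cell_finite_def
  proof (intro allI)
    fix k j
    show "(\<integral>\<^sup>+x\<in>dyadic_interval k j. ennreal ((norm (f x))\<^sup>2) \<partial>lebesgue) < top"
      by (rule nn_integral_finite_on[where u="\<lambda>x. norm (f x) powr p"]) (use powr_dominates[OF p] fin in \<open>auto simp: emeasure_dyadic\<close>)
  qed
qed

lemma Lp_norm_complex: "Lp_norm p (\<lambda>x. ennreal (norm (f x))) = ennreal_powr (\<integral>\<^sup>+x. ennreal (norm (f x) powr p) \<partial>lebesgue) (1/p)"
  unfolding Lp_norm_def by (simp add: ennreal_powr_real)

theorem sq_fun_Lp:
  assumes p: "2 < p" and f: "in_Lp p f"
  shows "sq_fun f \<in> borel_measurable lebesgue"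
    and "Lp_norm p (sq_fun f) \<le> ennreal (Lq_const (p/2) powr (1/p)) * Lp_norm p (\<lambda>x. ennreal (norm (f x)))"
proof -
  let ?I = "\<integral>\<^sup>+x. ennreal (norm (f x) powr p) \<partial>lebesgue" let ?q = "p / 2"
  have m [measurable]: "f \<in> borel_measurable lebesgue" using f by (simp add: in_Lp_def)
  have fin: "?I < top" using f unfolding in_Lp_def Lp_norm_complex by (auto simp: ennreal_powr_def less_top[symmetric])
  note loc = Lp_local[OF m less_imp_le[OF p] fin]
  show "sq_fun f \<in> borel_measurable lebesgue" by (rule sq_fun_measurable[OF m loc(1)])
  have pw: "((norm (f x))\<^sup>2) powr ?q = norm (f x) powr p" for x
    by (cases "f x = 0") (simp_all add: powr_powr flip: powr_numeral)
  note [measurable] = sq_partial_measurable[OF m loc(1)]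
  have "(\<integral>\<^sup>+x. ennreal_powr (sq_fun f x) p \<partial>lebesgue) = (\<integral>\<^sup>+x. (SUP N. ennreal (sq_partial f N x powr ?q)) \<partial>lebesgue)"
  proof (intro nn_integral_cong)
    fix x
    have "ennreal_powr (sq_fun f x) p = ennreal_powr (SUP N. ennreal (sq_partial f N x)) ?q"
      unfolding sq_fun_eq[OF loc(1) m] ennreal_powr_powr by simp
    then show "ennreal_powr (sq_fun f x) p = (SUP N. ennreal (sq_partial f N x powr ?q))"
      using p by (simp add: ennreal_powr_SUP ennreal_powr_real sq_partial_nonneg)
  qed
  also have "\<dots> = (SUP N. \<integral>\<^sup>+x. ennreal (sq_partial f N x powr ?q) \<partial>lebesgue)"
    by (rule nn_integral_monotone_convergence_SUP)
       (use p in \<open>auto simp: incseq_def le_fun_def intro!: ennreal_leI powr_mono2 sq_partial_nonneg sq_partial_mono\<close>)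
  also have "\<dots> \<le> ennreal (Lq_const ?q) * ?I"
  proof (rule SUP_least)
    fix N
    have "(\<integral>\<^sup>+x. ennreal (sq_partial f N x powr ?q) \<partial>lebesgue) \<le> (\<integral>\<^sup>+x. ennreal ((\<Sum>k\<in>{-int N..int N}. majorant f k (cell k x)) powr ?q) \<partial>lebesgue)"
      using p by (intro nn_integral_mono ennreal_leI powr_mono2 sq_partial_le_majorant loc sq_partial_nonneg) auto
    also have "\<dots> \<le> ennreal (Lq_const ?q) * (\<integral>\<^sup>+x. ennreal (((norm (f x))\<^sup>2) powr ?q) \<partial>lebesgue)"
      by (rule majorant_Lq) (use p loc fin pw in auto)
    finally show "(\<integral>\<^sup>+x. ennreal (sq_partial f N x powr ?q) \<partial>lebesgue) \<le> ennreal (Lq_const ?q) * ?I"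
      by (simp only: pw)
  qed
  finally have "ennreal_powr (\<integral>\<^sup>+x. ennreal_powr (sq_fun f x) p \<partial>lebesgue) (1/p) \<le> ennreal_powr (ennreal (Lq_const ?q) * ?I) (1/p)"
    using p by (intro ennreal_powr_mono) auto
  then show "Lp_norm p (sq_fun f) \<le> ennreal (Lq_const (p/2) powr (1/p)) * Lp_norm p (\<lambda>x. ennreal (norm (f x)))"
    unfolding Lp_norm_complex unfolding Lp_norm_def using Lq_const_pos[of ?q] p by (simp add: ennreal_powr_mult)
qed

text \<open>
  Translating \<open>\<I> k x\<close> by \<open>- x\<close> gives one of the intervals over
  which the supremum is taken.
\<close>

lemma sq_fun_family_le:
  assumes "admissible_family \<I>" shows "sq_fun_family \<I> f x \<le> sq_fun f x"
proof -
  have "ennreal ((norm (avg (\<I> k x) f - dyadic_expectation k f x))\<^sup>2) \<le>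
     (SUP I\<in>intervals_at_origin k. ennreal ((norm (avg ((\<lambda>y. y + x) ` I) f - dyadic_expectation k f x))\<^sup>2))" for k
  proof -
    have I: "\<I> k x \<in> intervals_of_length (2 powi k)" "x \<in> \<I> k x" using assms by (auto simp: admissible_family_def)
    let ?J = "(\<lambda>y. y + (- x)) ` \<I> k x"
    have "0 \<in> ?J" using I(2) by (intro image_eqI[of _ _ x]) auto
    then have "?J \<in> intervals_at_origin k"
      using intervals_of_length_translate[OF I(1), of "- x"] by (simp add: intervals_at_origin_def)
    moreover have "(\<lambda>y. y + x) ` ?J = \<I> k x" by (simp add: image_image)
    ultimately show ?thesis by (intro SUP_upper2[of ?J]) auto
  qed
  then show ?thesis unfolding sq_fun_family_def sq_fun_def infsum_int_eq_SUP
    by (intro ennreal_powr_mono SUP_mono' sum_mono) simp_all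
qed

section \<open>Bounded mean oscillation\<close>

lemma norm_seg_integral_le_bounded:
  assumes m [measurable]: "f \<in> borel_measurable lebesgue" and M: "0 \<le> M" "AE x in lebesgue. norm (f x) \<le> M" and "a \<le> b"
  shows "norm (seg_integral f a b) \<le> M * (b - a)"
proof -
  have "energy f {a..<b} \<le> (\<integral>\<^sup>+x. ennreal (M\<^sup>2) * indicator {a..<b} x \<partial>lebesgue)"
    unfolding energy_def
    by (rule nn_integral_mono_AE) (use M(2) in \<open>auto elim!: eventually_mono intro!: mult_right_mono ennreal_leI power_mono\<close>)
  also have "\<dots> = ennreal (M\<^sup>2 * (b - a))"
    using assms(4) by (subst nn_integral_cmult_indicator) (auto simp: ennreal_mult')
  finally have e: "energy f {a..<b} \<le> ennreal (M\<^sup>2 * (b - a))" .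
  have "ennreal ((norm (seg_integral f a b))\<^sup>2) \<le> ennreal (b - a) * energy f {a..<b}" by (rule seg_integral_Cauchy_Schwarz[OF m assms(4)])
  also have "\<dots> \<le> ennreal (b - a) * ennreal (M\<^sup>2 * (b - a))" by (intro mult_left_mono e) auto
  also have "\<dots> = ennreal ((M * (b - a))\<^sup>2)"
    using assms(4) by (simp add: ennreal_mult'[symmetric] power2_eq_square ac_simps)
  finally have "(norm (seg_integral f a b))\<^sup>2 \<le> (M * (b - a))\<^sup>2" by simp
  then show ?thesis by (rule power2_le_imp_le) (use M assms(4) in auto)
qed

text \<open>
  Two translates of a segment differ by two segments whose length is the size of the
  translation.
\<close>

lemma slide_Lipschitz:
  assumes m: "f \<in> borel_measurable lebesgue" and l: "L1_loc f" and M: "0 \<le> M" "AE x in lebesgue. norm (f x) \<le> M" and d: "0 \<le> d"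
  shows "norm (seg_integral f s (s + d) - seg_integral f t (t + d)) \<le> 2 * M * \<bar>s - t\<bar>"
proof -
  have *: "norm (seg_integral f s (s + d) - seg_integral f t (t + d)) \<le> 2 * M * (t - s)" if "s \<le> t" for s t
  proof -
    have "seg_integral f s (t + d) = seg_integral f s t + seg_integral f t (t + d)" "seg_integral f s (t + d) = seg_integral f s (s + d) + seg_integral f (s + d) (t + d)"
      using that d by (auto intro!: seg_integral_split l)
    then have "seg_integral f s (s + d) - seg_integral f t (t + d) = seg_integral f s t - seg_integral f (s + d) (t + d)" by (simp add: algebra_simps)
    then have "norm (seg_integral f s (s + d) - seg_integral f t (t + d)) \<le> norm (seg_integral f s t) + norm (seg_integral f (s + d) (t + d))" by (metis norm_triangle_ineq4)
    also have "\<dots> \<le> M * (t - s) + M * ((t + d) - (s + d))" by (intro add_mono norm_seg_integral_le_bounded m M) (use that in auto)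
    finally show ?thesis by simp
  qed
  show ?thesis using *[of s t] *[of t s] by (cases "s \<le> t") (auto simp: norm_minus_commute)
qed

text \<open>
  At scales coarser than that of an interval \<open>Q\<close> the conditional expectation is
  constant on \<open>Q\<close>, and the sliding averages vary slowly. So the coarse part of the
  square function barely oscillates on \<open>Q\<close>, with a geometric gain in the scale.
\<close>

lemma wobble_diff:
  assumes m: "f \<in> borel_measurable lebesgue" and l: "L1_loc f" and M: "0 \<le> M" "AE x in lebesgue. norm (f x) \<le> M"
    and c: "cell K x = cell K y" and k: "K \<le> k"
  shows "\<bar>wobble f k x - wobble f k y\<bar> \<le> 2 * M * 2 powi (K - k)"
proof -
  have ck: "cell k x = cell k y" unfolding cell_coarser[OF k] c ..
  have xy: "\<bar>x - y\<bar> \<le> 2 powi K"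
  proof -
    have "x \<in> dyadic_interval K (cell K x)" "y \<in> dyadic_interval K (cell K x)" by (simp_all add: mem_dyadic_interval_iff c)
    then show ?thesis by (auto simp: dyadic_interval_def algebra_simps abs_le_iff)
  qed
  have *: "wobble f k x \<le> wobble f k y + 2 * M * 2 powi (K - k)" if "cell k x = cell k y" "\<bar>x - y\<bar> \<le> 2 powi K" for x y
  proof (rule wobble_le)
    fix a :: real assume a: "a \<in> {- (2 powi k)..0}"
    let ?s = "\<lambda>x. avg {x + a..<x + a + 2 powi k} f"
    have "norm (?s x - ?s y) = norm (seg_integral f (x + a) (x + a + 2 powi k) - seg_integral f (y + a) (y + a + 2 powi k)) / 2 powi k"
      unfolding slide_eq by (simp add: scaleR_diff_right[symmetric] divide_inverse mult.commute)
    also have "\<dots> \<le> 2 * M * \<bar>(x + a) - (y + a)\<bar> / 2 powi k"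
      by (intro divide_right_mono slide_Lipschitz m l M) auto
    also have "\<dots> \<le> 2 * M * 2 powi K / 2 powi k"
      using that M by (intro divide_right_mono mult_left_mono) auto
    also have "\<dots> = 2 * M * 2 powi (K - k)" by (simp add: power_int_diff)
    finally have 1: "norm (?s x - ?s y) \<le> 2 * M * 2 powi (K - k)" .
    have "norm (?s x - mean f k (cell k x)) \<le> norm (?s x - ?s y) + norm (?s y - mean f k (cell k y))"
      unfolding that(1) using norm_triangle_ineq[of "?s x - ?s y" "?s y - mean f k (cell k y)"] by simp
    also have "\<dots> \<le> 2 * M * 2 powi (K - k) + wobble f k y"
      by (intro add_mono 1 slide_le_wobble l a)
    finally show "norm (?s x - mean f k (cell k x)) \<le> wobble f k y + 2 * M * 2 powi (K - k)" by simp
  qed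
  show ?thesis using *[OF ck xy] *[OF ck[symmetric]] xy by (simp add: abs_minus_commute)
qed

lemma sum_powi_geometric: "(\<Sum>k\<in>{K+1..N}. (2 powi (K - k) :: real)\<^sup>2) \<le> 1/3"
proof (cases "K \<le> N")
  case True
  then have "(\<Sum>k\<in>{K+1..N}. (2 powi (K - k) :: real)\<^sup>2) = (1 - (2 powi (K - N))\<^sup>2) / 3"
  proof (induction N rule: int_ge_induct)
    case (step i)
    have "{K+1..i+1} = insert (i+1) {K+1..i}" using step.hyps by auto
    then have s: "(\<Sum>k\<in>{K+1..i+1}. (2 powi (K - k) :: real)\<^sup>2) = (2 powi (K - (i + 1)))\<^sup>2 + (\<Sum>k\<in>{K+1..i}. (2 powi (K - k))\<^sup>2)" by simp
    have "(2::real) powi (K - (i + 1)) = 2 powi (K - i) / 2"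
      using powi_pred[of "K - i"] by (simp add: algebra_simps)
    then have "((2::real) powi (K - (i + 1)))\<^sup>2 = (2 powi (K - i))\<^sup>2 / 4" by (simp only: power_divide) simp
    moreover have "X = B + S \<Longrightarrow> S = (1 - A) / 3 \<Longrightarrow> B = A / 4 \<Longrightarrow> X = (1 - B) / 3" for X A B S :: real
      by (simp add: field_simps)
    ultimately show ?case using s step.IH by blast
  qed simp
  then show ?thesis by simp
qed simp

definition sq_total :: "(real \<Rightarrow> complex) \<Rightarrow> real \<Rightarrow> ennreal" where
  "sq_total f x = (SUP N. ennreal (sq_partial f N x))"

lemma sq_total_finite:
  assumes f: "f \<in> borel_measurable lebesgue" "L1_loc f" and "sq_total f x < top"
  shows "sq_fun f x = ennreal (sqrt (enn2real (sq_total f x)))" "enn2real (sq_fun f x) = sqrt (enn2real (sq_total f x))"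
proof -
  show "sq_fun f x = ennreal (sqrt (enn2real (sq_total f x)))"
    unfolding sq_fun_eq[OF f(2,1)] sq_total_def[symmetric] using assms(3)
    by (simp add: ennreal_powr_def powr_half_sqrt)
  then show "enn2real (sq_fun f x) = sqrt (enn2real (sq_total f x))" by simp
qed

lemma sq_total_L2:
  assumes f: "f \<in> borel_measurable lebesgue" "L1_loc f"
  shows "(\<integral>\<^sup>+x. sq_total f x \<partial>lebesgue) \<le> 399 * energy f UNIV"
proof -
  note [measurable] = sq_partial_measurable[OF f]
  have "(\<integral>\<^sup>+x. sq_total f x \<partial>lebesgue) = (SUP N. \<integral>\<^sup>+x. ennreal (sq_partial f N x) \<partial>lebesgue)"
    unfolding sq_total_def by (rule nn_integral_monotone_convergence_SUP)
       (auto simp: incseq_def le_fun_def intro!: ennreal_leI sq_partial_mono)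
  also have "\<dots> \<le> 399 * energy f UNIV"
  proof (rule SUP_least)
    fix N
    have "(\<integral>\<^sup>+x. ennreal (sq_partial f N x) \<partial>lebesgue) \<le> (\<integral>\<^sup>+x. ennreal (\<Sum>k\<in>{-int N..int N}. majorant f k (cell k x)) \<partial>lebesgue)"
      by (intro nn_integral_mono ennreal_leI sq_partial_le_majorant f)
    also have "\<dots> \<le> 399 * energy f UNIV" by (rule majorant_L2[OF f(2,1)])
    finally show "(\<integral>\<^sup>+x. ennreal (sq_partial f N x) \<partial>lebesgue) \<le> 399 * energy f UNIV" .
  qed
  finally show ?thesis .
qed

text \<open>
  Freeze the coarse scales at a point \<open>y\<close> of the interval where the square function
  is finite, and drop the fine ones. The resulting sequence \<open>w\<close> has a finite
  Euclidean norm \<open>c\<close>, and by the triangle inequality the square function differs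
  from \<open>c\<close> by at most the Euclidean norm of the difference of the two sequences. In
  that difference the fine scales obey the local square integral bound, and the coarse scales
  are summable because of their slow variation.
\<close>

lemma sq_fun_oscillation:
  assumes m [measurable]: "f \<in> borel_measurable lebesgue" and l: "L1_loc f" and M: "0 \<le> M" "AE x in lebesgue. norm (f x) \<le> M"
    and fin: "AE x in lebesgue. sq_total f x < top"
  obtains c where "(\<integral>\<^sup>+x\<in>dyadic_interval K j. ennreal ((enn2real (sq_fun f x) - c)\<^sup>2) \<partial>lebesgue) \<le> ennreal (1225 * M\<^sup>2 * 2 powi K)"
proof -
  let ?Q = "dyadic_interval K j"
  have "\<exists>x\<in>?Q. sq_total f x < top"
  proof (rule ccontr)
    assume "\<not> (\<exists>x\<in>?Q. sq_total f x < top)"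
    then have "AE x in lebesgue. x \<notin> ?Q" using fin by (auto elim!: eventually_mono)
    then have "emeasure lebesgue ?Q = 0" by (subst (asm) AE_iff_measurable[of ?Q]) auto
    then show False by (simp add: emeasure_dyadic)
  qed
  then obtain y where y: "y \<in> ?Q" "sq_total f y < top" by auto
  have cy: "cell K y = j" using y(1) by (simp add: mem_dyadic_interval_iff)
  define w where "w k = (if k \<le> K then 0 else wobble f k y)" for k
  define W where "W N = (\<Sum>k\<in>{-int N..int N}. (w k)\<^sup>2)" for N
  define r where "r N x = (\<Sum>k\<in>{-int N..int N}. (wobble f k x - w k)\<^sup>2)" for N x
  have W_nn: "0 \<le> W N" for N unfolding W_def by (intro sum_nonneg) auto
  have r_nn: "0 \<le> r N x" for N x unfolding r_def by (intro sum_nonneg) auto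
  have r_mono: "r N x \<le> r N' x" if "N \<le> N'" for N N' x unfolding r_def using that by (intro sum_mono2) auto
  define T where "T = enn2real (sq_total f y)"
  have W_le: "W N \<le> T" for N
  proof -
    have "W N \<le> sq_partial f N y" unfolding W_def sq_partial_def w_def by (intro sum_mono) auto
    then have "ennreal (W N) \<le> sq_total f y" unfolding sq_total_def by (intro SUP_upper2[of N] ennreal_leI) auto
    then show ?thesis using y(2) unfolding T_def by (metis W_nn enn2real_ennreal enn2real_mono)
  qed
  define c where "c = sqrt (SUP N. W N)"
  have bdd: "bdd_above (range W)" using W_le by (auto intro!: bdd_aboveI)
  have c_nn: "0 \<le> c" unfolding c_def using cSUP_upper[OF _ bdd, of 0] W_nn[of 0] by (auto intro: order_trans)
  have W_c: "sqrt (W N) \<le> c" for N unfolding c_def by (intro real_sqrt_le_mono cSUP_upper bdd) auto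
  \<comment> \<open>Minkowski in both directions, for a finite range of scales\<close>
  have tri1: "sqrt (sq_partial f N x) \<le> sqrt (W N) + sqrt (r N x)" for N x
    using L2_set_triangle_ineq[of w "\<lambda>k. wobble f k x - w k" "{-int N..int N}"]
    by (simp add: L2_set_def sq_partial_def W_def r_def)
  have tri2: "sqrt (W N) \<le> sqrt (sq_partial f N x) + sqrt (r N x)" for N x
    using L2_set_triangle_ineq[of "\<lambda>k. wobble f k x" "\<lambda>k. w k - wobble f k x" "{-int N..int N}"]
    by (simp add: L2_set_def sq_partial_def W_def r_def power2_commute)
  have pt: "ennreal ((enn2real (sq_fun f x) - c)\<^sup>2) \<le> (SUP N. ennreal (r N x))" if fx: "sq_total f x < top" for x
  proof (cases "(SUP N. ennreal (r N x))" rule: ennreal_cases)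
    case (real s)
    define g where "g = sqrt (enn2real (sq_total f x))"
    have rs: "r N x \<le> s" for N
    proof -
      have "ennreal (r N x) \<le> ennreal s" unfolding real(2)[symmetric] by (rule SUP_upper) simp
      then show ?thesis using real(1) by simp
    qed
    have pg: "sqrt (sq_partial f N x) \<le> g" for N
    proof -
      have "ennreal (sq_partial f N x) \<le> sq_total f x" unfolding sq_total_def by (rule SUP_upper) simp
      then have "sq_partial f N x \<le> enn2real (sq_total f x)" using fx by (metis sq_partial_nonneg enn2real_ennreal enn2real_mono)
      then show ?thesis unfolding g_def by simp
    qed
    have "sq_total f x \<le> ennreal ((c + sqrt s)\<^sup>2)" unfolding sq_total_def
    proof (intro SUP_least ennreal_leI)
      fix N
      have "sqrt (sq_partial f N x) \<le> c + sqrt s" using tri1[of N x] W_c[of N] real_sqrt_le_mono[OF rs[of N]] by linarith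
      then have "(sqrt (sq_partial f N x))\<^sup>2 \<le> (c + sqrt s)\<^sup>2" by (intro power_mono) (auto simp: sq_partial_nonneg)
      then show "sq_partial f N x \<le> (c + sqrt s)\<^sup>2" by (simp add: sq_partial_nonneg)
    qed
    then have "enn2real (sq_total f x) \<le> (c + sqrt s)\<^sup>2" by (intro enn2real_leI) auto
    then have 1: "g \<le> c + sqrt s" unfolding g_def using c_nn real(1) by (intro real_le_lsqrt) auto
    have "(SUP N. W N) \<le> (g + sqrt s)\<^sup>2"
    proof (rule cSUP_least)
      fix N
      have "sqrt (W N) \<le> g + sqrt s" using tri2[of N x] pg[of N] real_sqrt_le_mono[OF rs[of N]] by linarith
      then have "(sqrt (W N))\<^sup>2 \<le> (g + sqrt s)\<^sup>2" by (intro power_mono) (auto simp: W_nn)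
      then show "W N \<le> (g + sqrt s)\<^sup>2" by (simp add: W_nn)
    qed simp
    moreover have "0 \<le> (SUP N. W N)" using cSUP_upper[OF _ bdd, of 0] W_nn[of 0] by auto
    ultimately have 2: "c \<le> g + sqrt s" unfolding c_def using real(1) by (intro real_le_lsqrt) (auto simp: g_def)
    have "\<bar>g - c\<bar> \<le> sqrt s" using 1 2 by linarith
    then have "(g - c)\<^sup>2 \<le> s" using real(1) by (metis abs_ge_zero power2_abs power_mono real_sqrt_pow2)
    then show ?thesis unfolding real(2) sq_total_finite(2)[OF m l fx] g_def[symmetric] by (rule ennreal_leI)
  next
    case top then show ?thesis by (simp only: top_greatest)
  qed
  have r_le: "r N x \<le> (\<Sum>k\<in>{-int N..K}. majorant f k (cell k x)) + 2 * M\<^sup>2" if "x \<in> ?Q" for N x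
  proof -
    have cx: "cell K x = cell K y" using that cy by (simp add: mem_dyadic_interval_iff)
    let ?h = "\<lambda>k. (wobble f k x - w k)\<^sup>2"
    have "r N x \<le> (\<Sum>k\<in>{-int N..K} \<union> {K+1..int N}. ?h k)" unfolding r_def by (intro sum_mono2) auto
    also have "\<dots> = (\<Sum>k\<in>{-int N..K}. ?h k) + (\<Sum>k\<in>{K+1..int N}. ?h k)" by (intro sum.union_disjoint) auto
    also have "(\<Sum>k\<in>{-int N..K}. ?h k) \<le> (\<Sum>k\<in>{-int N..K}. majorant f k (cell k x))"
      by (intro sum_mono) (simp add: w_def wobble_le_majorant l)
    also have "(\<Sum>k\<in>{K+1..int N}. ?h k) \<le> (\<Sum>k\<in>{K+1..int N}. (2 * M)\<^sup>2 * (2 powi (K - k))\<^sup>2)"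
    proof (intro sum_mono)
      fix k assume k: "k \<in> {K+1..int N}"
      have "\<bar>wobble f k x - wobble f k y\<bar> \<le> 2 * M * 2 powi (K - k)"
        by (rule wobble_diff[OF m l M cx]) (use k in auto)
      then have "\<bar>wobble f k x - wobble f k y\<bar>\<^sup>2 \<le> (2 * M * 2 powi (K - k))\<^sup>2" by (intro power_mono) auto
      then show "?h k \<le> (2 * M)\<^sup>2 * (2 powi (K - k))\<^sup>2" using k by (simp add: w_def power_mult_distrib)
    qed
    also have "(\<Sum>k\<in>{K+1..int N}. (2 * M)\<^sup>2 * (2 powi (K - k))\<^sup>2) \<le> (2 * M)\<^sup>2 * (1/3)"
      unfolding sum_distrib_left[symmetric] by (intro mult_left_mono sum_powi_geometric) auto
    also have "(2 * M)\<^sup>2 * (1/3) \<le> 2 * M\<^sup>2"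
    proof -
      have "4 * z * (1/3) \<le> 2 * z" if "0 \<le> z" for z :: real using that by simp
      from this[of "M\<^sup>2"] show ?thesis by (simp add: power_mult_distrib)
    qed
    finally show ?thesis by simp
  qed
  have [measurable]: "r N \<in> borel_measurable lebesgue" for N
    unfolding r_def[abs_def] by (intro borel_measurable_sum borel_measurable_power borel_measurable_diff wobble_measurable m l) auto
  have e3: "energy f (triple K j) \<le> ennreal (3 * M\<^sup>2 * 2 powi K)"
  proof -
    have "energy f (triple K j) \<le> (\<integral>\<^sup>+x. ennreal (M\<^sup>2) * indicator (triple K j) x \<partial>lebesgue)"
      unfolding energy_def
      by (rule nn_integral_mono_AE) (use M(2) in \<open>auto elim!: eventually_mono intro!: mult_right_mono ennreal_leI power_mono\<close>)
    also have "\<dots> = ennreal (M\<^sup>2) * emeasure lebesgue (triple K j)" by (subst nn_integral_cmult_indicator) auto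
    also have "emeasure lebesgue (triple K j) = ennreal (3 * 2 powi K)" by (simp add: triple_def left_diff_distrib distrib_right)
    finally show ?thesis by (simp add: ennreal_mult'[symmetric] ac_simps)
  qed
  have r_int: "(\<integral>\<^sup>+x. ennreal (r N x) * indicator ?Q x \<partial>lebesgue) \<le> ennreal (1225 * M\<^sup>2 * 2 powi K)" for N
  proof -
    let ?S = "\<lambda>x. \<Sum>k\<in>{-int N..K}. majorant f k (cell k x)"
    have [measurable]: "?S \<in> borel_measurable lebesgue" by (intro borel_measurable_sum measurable_step_borel)
    have "(\<integral>\<^sup>+x. ennreal (r N x) * indicator ?Q x \<partial>lebesgue) \<le> (\<integral>\<^sup>+x. ennreal (?S x) * indicator ?Q x + ennreal (2 * M\<^sup>2) * indicator ?Q x \<partial>lebesgue)"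
    proof (intro nn_integral_mono)
      fix x
      show "ennreal (r N x) * indicator ?Q x \<le> ennreal (?S x) * indicator ?Q x + ennreal (2 * M\<^sup>2) * indicator ?Q x"
      proof (cases "x \<in> ?Q")
        case True
        have "ennreal (r N x) \<le> ennreal (?S x + 2 * M\<^sup>2)" by (rule ennreal_leI[OF r_le[OF True]])
        also have "\<dots> = ennreal (?S x) + ennreal (2 * M\<^sup>2)" by (rule ennreal_plus) (auto intro!: sum_nonneg majorant_nonneg)
        finally show ?thesis using True by simp
      qed simp
    qed
    also have "\<dots> = (\<integral>\<^sup>+x\<in>?Q. ennreal (?S x) \<partial>lebesgue) + (\<integral>\<^sup>+x. ennreal (2 * M\<^sup>2) * indicator ?Q x \<partial>lebesgue)"
      by (rule nn_integral_add) measurable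
    also have "(\<integral>\<^sup>+x. ennreal (2 * M\<^sup>2) * indicator ?Q x \<partial>lebesgue) = ennreal (2 * M\<^sup>2 * 2 powi K)"
      by (subst nn_integral_cmult_indicator) (auto simp: emeasure_dyadic ennreal_mult')
    also have "(\<integral>\<^sup>+x\<in>?Q. ennreal (?S x) \<partial>lebesgue) \<le> 399 * energy f (triple K j)" by (rule majorant_local[OF l m])
    also have "\<dots> \<le> 399 * ennreal (3 * M\<^sup>2 * 2 powi K)" by (intro mult_left_mono e3) auto
    also have "399 * ennreal (3 * M\<^sup>2 * 2 powi K) + ennreal (2 * M\<^sup>2 * 2 powi K) = ennreal (1199 * M\<^sup>2 * 2 powi K)"
      using ennreal_mult'[of 399 "3 * M\<^sup>2 * 2 powi K"] ennreal_plus[of "1197 * M\<^sup>2 * 2 powi K" "2 * M\<^sup>2 * 2 powi K"]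
      by (simp add: algebra_simps)
    \<comment> \<open>round up to \<open>1225 = 35\<^sup>2\<close>\<close>
    also have "\<dots> \<le> ennreal (1225 * M\<^sup>2 * 2 powi K)" by (intro ennreal_leI mult_right_mono) auto
    finally show ?thesis by simp
  qed
  have "(\<integral>\<^sup>+x\<in>?Q. ennreal ((enn2real (sq_fun f x) - c)\<^sup>2) \<partial>lebesgue) \<le> (\<integral>\<^sup>+x. (SUP N. ennreal (r N x) * indicator ?Q x) \<partial>lebesgue)"
  proof (rule nn_integral_mono_AE, use fin in eventually_elim)
    case (elim x)
    show ?case using pt[OF elim] by (auto simp: indicator_def SUP_mult_right_ennreal[symmetric])
  qed
  also have "\<dots> = (SUP N. \<integral>\<^sup>+x. ennreal (r N x) * indicator ?Q x \<partial>lebesgue)"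
    by (rule nn_integral_monotone_convergence_SUP)
       (auto simp: incseq_def le_fun_def intro!: mult_right_mono ennreal_leI r_mono)
  also have "\<dots> \<le> ennreal (1225 * M\<^sup>2 * 2 powi K)" by (rule SUP_least[OF r_int])
  finally show ?thesis by (rule that)
qed

text \<open>
  Cauchy-Schwarz passes from the quadratic to the linear oscillation about \<open>c\<close>;
  replacing \<open>c\<close> by the mean of \<open>g\<close> at most doubles it.
\<close>

lemma BMO_from_oscillation:
  fixes g :: "real \<Rightarrow> real"
  assumes m [measurable]: "g \<in> borel_measurable lebesgue" and i: "set_integrable lebesgue (dyadic_interval K j) g" and B: "0 \<le> B"
    and osc: "(\<integral>\<^sup>+x\<in>dyadic_interval K j. ennreal ((g x - c)\<^sup>2) \<partial>lebesgue) \<le> ennreal (B\<^sup>2 * 2 powi K)"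
  shows "(\<integral>\<^sup>+x\<in>dyadic_interval K j. ennreal \<bar>g x - avg (dyadic_interval K j) g\<bar> \<partial>lebesgue) / emeasure lebesgue (dyadic_interval K j) \<le> ennreal (2 * B)"
proof -
  let ?Q = "dyadic_interval K j" let ?d = "2 powi K :: real"
  let ?L = "\<integral>\<^sup>+x\<in>?Q. ennreal \<bar>g x - c\<bar> \<partial>lebesgue"
  have "?L\<^sup>2 \<le> ennreal ?d * (\<integral>\<^sup>+x\<in>?Q. ennreal ((g x - c)\<^sup>2) \<partial>lebesgue)"
    using nn_Cauchy_Schwarz_set[of "\<lambda>x. g x - c" ?Q] by (simp add: emeasure_dyadic)
  also have "\<dots> \<le> ennreal ?d * ennreal (B\<^sup>2 * ?d)" by (intro mult_left_mono osc) auto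
  also have "\<dots> = ennreal ((B * ?d)\<^sup>2)" by (simp add: ennreal_mult'[symmetric] power2_eq_square ac_simps)
  finally have L2: "?L\<^sup>2 \<le> ennreal ((B * ?d)\<^sup>2)" .
  have L: "?L \<le> ennreal (B * ?d)"
  proof (cases ?L rule: ennreal_cases)
    case (real a)
    then have "a\<^sup>2 \<le> (B * ?d)\<^sup>2" using L2 by (simp add: ennreal_power)
    then have "a \<le> B * ?d" by (rule power2_le_imp_le) (use B in auto)
    then show ?thesis unfolding real(2) by (rule ennreal_leI)
  next
    case top
    then show ?thesis using L2 by (simp add: top_unique)
  qed
  have ic: "set_integrable lebesgue ?Q (\<lambda>x. c)"
    unfolding set_integrable_def by (intro integrable_scaleR_left integrable_real_indicator) (auto simp: emeasure_dyadic)
  have "(LINT x:?Q|lebesgue. c) = ?d * c"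
    unfolding set_lebesgue_integral_def by (simp add: measure_dyadic)
  then have "(LINT x:?Q|lebesgue. g x - c) = (LINT x:?Q|lebesgue. g x) - ?d * c"
    using set_integral_diff(2)[OF i ic] by simp
  then have "avg ?Q g - c = (LINT x:?Q|lebesgue. g x - c) / ?d"
    by (simp only: avg_def measure_dyadic) (simp add: field_simps)
  then have "ennreal \<bar>avg ?Q g - c\<bar> = ennreal \<bar>LINT x:?Q|lebesgue. g x - c\<bar> / ennreal ?d"
    by (simp add: divide_ennreal)
  also have "\<dots> \<le> ?L / ennreal ?d"
  proof (rule divide_right_mono_ennreal)
    have "ennreal (norm (LINT x:?Q|lebesgue. g x - c)) \<le> (\<integral>\<^sup>+x. ennreal (norm (indicator ?Q x *\<^sub>R (g x - c))) \<partial>lebesgue)"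
      unfolding set_lebesgue_integral_def using set_integral_diff(1)[OF i ic] unfolding set_integrable_def by (rule integral_norm_bound_ennreal)
    also have "\<dots> = ?L" by (intro nn_integral_cong) (auto simp: indicator_def)
    finally show "ennreal \<bar>LINT x:?Q|lebesgue. g x - c\<bar> \<le> ?L" by simp
  qed
  also have "\<dots> \<le> ennreal (B * ?d) / ennreal ?d" by (rule divide_right_mono_ennreal[OF L])
  also have "\<dots> = ennreal B" using B by (simp add: divide_ennreal)
  finally have a: "ennreal \<bar>avg ?Q g - c\<bar> \<le> ennreal B" .
  have "(\<integral>\<^sup>+x\<in>?Q. ennreal \<bar>g x - avg ?Q g\<bar> \<partial>lebesgue) \<le> (\<integral>\<^sup>+x. ennreal \<bar>g x - c\<bar> * indicator ?Q x + ennreal B * indicator ?Q x \<partial>lebesgue)"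
  proof (intro nn_integral_mono)
    fix x
    have "\<bar>avg ?Q g - c\<bar> \<le> B" using a B by simp
    then have "\<bar>g x - avg ?Q g\<bar> \<le> \<bar>g x - c\<bar> + B" by linarith
    then have "ennreal \<bar>g x - avg ?Q g\<bar> \<le> ennreal \<bar>g x - c\<bar> + ennreal B" using ennreal_leI B by (simp flip: ennreal_plus)
    then show "ennreal \<bar>g x - avg ?Q g\<bar> * indicator ?Q x \<le> ennreal \<bar>g x - c\<bar> * indicator ?Q x + ennreal B * indicator ?Q x"
      by (auto simp: indicator_def)
  qed
  also have "\<dots> = ?L + (\<integral>\<^sup>+x. ennreal B * indicator ?Q x \<partial>lebesgue)" by (rule nn_integral_add) measurable
  also have "(\<integral>\<^sup>+x. ennreal B * indicator ?Q x \<partial>lebesgue) = ennreal (B * ?d)"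
    using B by (subst nn_integral_cmult_indicator) (auto simp: emeasure_dyadic ennreal_mult')
  also have "?L + ennreal (B * ?d) \<le> ennreal (B * ?d) + ennreal (B * ?d)" by (intro add_right_mono L)
  also have "\<dots> = ennreal (2 * B * ?d)" using B by (simp flip: ennreal_plus)
  finally have "(\<integral>\<^sup>+x\<in>?Q. ennreal \<bar>g x - avg ?Q g\<bar> \<partial>lebesgue) / emeasure lebesgue ?Q \<le> ennreal (2 * B * ?d) / ennreal ?d"
    unfolding emeasure_dyadic by (rule divide_right_mono_ennreal)
  also have "\<dots> = ennreal (2 * B)" using B by (simp add: divide_ennreal)
  finally show ?thesis .
qed

theorem sq_fun_BMO:
  assumes "in_Linf_c f"
  shows "AE x in lebesgue. sq_fun f x < top" "locally_integrable (\<lambda>x. enn2real (sq_fun f x))"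
    "BMO_d_norm (\<lambda>x. enn2real (sq_fun f x)) \<le> ennreal 70 * Linf_norm f"
proof -
  have m [measurable]: "f \<in> borel_measurable lebesgue" using assms by (simp add: in_Linf_c_def)
  obtain C where C: "compact C" "AE x in lebesgue. x \<notin> C \<longrightarrow> f x = 0" using assms by (auto simp: in_Linf_c_def)
  define M where "M = enn2real (Linf_norm f)"
  have LM: "Linf_norm f = ennreal M" and M0: "0 \<le> M"
    using assms by (auto simp: in_Linf_c_def M_def)
  have "AE x in lebesgue. ennreal (norm (f x)) \<le> ennreal M" unfolding LM[symmetric] Linf_norm_def by (rule esssup_AE)
  then have M: "AE x in lebesgue. norm (f x) \<le> M" using M0 by simp
  have [measurable]: "C \<in> sets lebesgue" using C(1) by (simp add: borel_compact)
  have fC: "emeasure lebesgue C < top" using emeasure_compact_finite[OF C(1)] by (simp add: C(1) borel_compact)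
  have "energy f UNIV \<le> (\<integral>\<^sup>+x. ennreal (M\<^sup>2) * indicator C x \<partial>lebesgue)"
    unfolding energy_def
  proof (rule nn_integral_mono_AE, use M C(2) in eventually_elim)
    case (elim x)
    then show ?case by (cases "x \<in> C") (auto intro!: ennreal_leI power_mono)
  qed
  also have "\<dots> = ennreal (M\<^sup>2) * emeasure lebesgue C" by (subst nn_integral_cmult_indicator) auto
  also have "\<dots> < top" using fC by (simp add: ennreal_mult_less_top)
  finally have E: "energy f UNIV < top" .
  have pw: "norm (f x) powr 2 = (norm (f x))\<^sup>2" for x by (simp add: powr_numeral)
  have l: "L1_loc f" by (rule Lp_local(1)[OF m, of 2]) (use E in \<open>simp_all add: pw energy_def\<close>)
  note [measurable] = sq_partial_measurable[OF m l] sq_fun_measurable[OF m l]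
  have tm [measurable]: "sq_total f \<in> borel_measurable lebesgue" unfolding sq_total_def[abs_def] by measurable
  have T: "(\<integral>\<^sup>+x. sq_total f x \<partial>lebesgue) < top"
    by (rule order.strict_trans1[OF sq_total_L2[OF m l]]) (use E in \<open>simp add: ennreal_mult_less_top\<close>)
  have fin: "AE x in lebesgue. sq_total f x < top"
    using nn_integral_PInf_AE[OF tm] T by (auto elim!: eventually_mono simp: less_top)
  show "AE x in lebesgue. sq_fun f x < top"
    using fin by eventually_elim (simp add: sq_total_finite(1)[OF m l])
  let ?g = "\<lambda>x. enn2real (sq_fun f x)"
  have g2: "(\<integral>\<^sup>+x. ennreal ((?g x)\<^sup>2) \<partial>lebesgue) < top"
  proof -
    have "(\<integral>\<^sup>+x. ennreal ((?g x)\<^sup>2) \<partial>lebesgue) \<le> (\<integral>\<^sup>+x. sq_total f x \<partial>lebesgue)"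
      by (rule nn_integral_mono_AE, use fin in eventually_elim) (simp add: sq_total_finite(2)[OF m l])
    then show ?thesis using T by (rule order.strict_trans1)
  qed
  have int: "set_integrable lebesgue A ?g" if [measurable]: "A \<in> sets lebesgue" and A: "emeasure lebesgue A < top" for A
  proof (rule set_integrable_nn)
    have "t \<le> 1 + t\<^sup>2" if "0 \<le> t" for t :: real using powr_dominates(2)[of 2 t] that by (simp add: powr_numeral)
    then show "(\<integral>\<^sup>+x\<in>A. ennreal (norm (?g x)) \<partial>lebesgue) < top"
      by (intro nn_integral_finite_on[where u="\<lambda>x. (?g x)\<^sup>2"] g2 A) auto
  qed auto
  show "locally_integrable ?g" unfolding locally_integrable_def
  proof (intro allI impI int)
    fix K :: "real set" assume K: "compact K"
    then show "K \<in> sets lebesgue" by (simp add: borel_compact)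
    show "emeasure lebesgue K < top" using emeasure_compact_finite[OF K] by (simp add: K borel_compact)
  qed
  show "BMO_d_norm ?g \<le> ennreal 70 * Linf_norm f"
    unfolding BMO_d_norm_def
  proof (rule SUP_least)
    fix I :: "real set" assume "I \<in> (\<Union>k. range (dyadic_interval k))"
    then obtain K j where I: "I = dyadic_interval K j" by auto
    obtain c where c: "(\<integral>\<^sup>+x\<in>dyadic_interval K j. ennreal ((?g x - c)\<^sup>2) \<partial>lebesgue) \<le> ennreal (1225 * M\<^sup>2 * 2 powi K)"
      by (rule sq_fun_oscillation[OF m l M0 M fin])
    have "(\<integral>\<^sup>+x\<in>I. ennreal \<bar>?g x - avg I ?g\<bar> \<partial>lebesgue) / emeasure lebesgue I \<le> ennreal (2 * (35 * M))"
      unfolding I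
      by (rule BMO_from_oscillation[where c = c]) (use M0 c in \<open>auto intro!: int simp: emeasure_dyadic power_mult_distrib\<close>)
    also have "\<dots> = ennreal 70 * Linf_norm f" unfolding LM using ennreal_mult'[of 70 M] by simp
    finally show "(\<integral>\<^sup>+x\<in>I. ennreal \<bar>?g x - avg I ?g\<bar> \<partial>lebesgue) / emeasure lebesgue I \<le> ennreal 70 * Linf_norm f" .
  qed
qed

theorem theorem1p2:
  shows "(\<exists>C::real. C > 0 \<and>
            (\<forall>f. in_Linf_c f \<longrightarrow>
               (AE x in lebesgue. sq_fun f x < top) \<and>
               in_BMO_d (\<lambda>x. enn2real (sq_fun f x)) \<and>
               BMO_d_norm (\<lambda>x. enn2real (sq_fun f x)) \<le> ennreal C * Linf_norm f))
       \<and> (\<forall>p::real. 2 < p \<longrightarrow>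
            (\<exists>C::real. C > 0 \<and>
               (\<forall>f. in_Lp p f \<longrightarrow>
                  sq_fun f \<in> borel_measurable lebesgue \<and>
                  Lp_norm p (sq_fun f) \<le> ennreal C * Lp_norm p (\<lambda>x. ennreal (norm (f x))))))
       \<and> (\<forall>p::real. 2 < p \<longrightarrow>
            (\<exists>C::real. C > 0 \<and>
               (\<forall>\<I> f. admissible_family \<I> \<longrightarrow> in_Lp p f \<longrightarrow>
                  outer_Lp_norm p (sq_fun_family \<I> f)
                    \<le> ennreal C * Lp_norm p (\<lambda>x. ennreal (norm (f x))))))"
proof (intro conjI)
  have fin: "ennreal 70 * Linf_norm f < top" if "in_Linf_c f" for f
    using that by (auto simp: in_Linf_c_def ennreal_mult_less_top)
  show "\<exists>C::real. C > 0 \<and>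
            (\<forall>f. in_Linf_c f \<longrightarrow>
               (AE x in lebesgue. sq_fun f x < top) \<and>
               in_BMO_d (\<lambda>x. enn2real (sq_fun f x)) \<and>
               BMO_d_norm (\<lambda>x. enn2real (sq_fun f x)) \<le> ennreal C * Linf_norm f)"
    unfolding in_BMO_d_def
    by (intro exI[of _ 70] conjI allI impI sq_fun_BMO order.strict_trans1[OF sq_fun_BMO(3) fin]) simp_all
  have pos: "0 < Lq_const (p/2) powr (1/p)" if "2 < p" for p
    using Lq_const_pos[of "p/2"] that by simp
  show "\<forall>p::real. 2 < p \<longrightarrow>
            (\<exists>C::real. C > 0 \<and>
               (\<forall>f. in_Lp p f \<longrightarrow>
                  sq_fun f \<in> borel_measurable lebesgue \<and>
                  Lp_norm p (sq_fun f) \<le> ennreal C * Lp_norm p (\<lambda>x. ennreal (norm (f x)))))"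
    using pos sq_fun_Lp by blast
  show "\<forall>p::real. 2 < p \<longrightarrow>
            (\<exists>C::real. C > 0 \<and>
               (\<forall>\<I> f. admissible_family \<I> \<longrightarrow> in_Lp p f \<longrightarrow>
                  outer_Lp_norm p (sq_fun_family \<I> f)
                    \<le> ennreal C * Lp_norm p (\<lambda>x. ennreal (norm (f x)))))"
  proof (intro allI impI)
    fix p :: real assume p: "2 < p"
    have "outer_Lp_norm p (sq_fun_family \<I> f) \<le> Lp_norm p (sq_fun f)" if "admissible_family \<I>" "in_Lp p f" for \<I> f
      unfolding outer_Lp_norm_def by (rule INF_lower) (use sq_fun_Lp(1)[OF p that(2)] sq_fun_family_le[OF that(1)] in auto)
    then show "\<exists>C::real. C > 0 \<and>
               (\<forall>\<I> f. admissible_family \<I> \<longrightarrow> in_Lp p f \<longrightarrow>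
                  outer_Lp_norm p (sq_fun_family \<I> f)
                    \<le> ennreal C * Lp_norm p (\<lambda>x. ennreal (norm (f x))))"
      using pos[OF p] sq_fun_Lp(2)[OF p] by (meson order_trans)
  qed
qed

end
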